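(* Let $G$ be a finite group. Then the following are equivalent. (i) The group $G$ is evolving. (ii) There exist nilpotent groups $N$ and $T$ of coprime orders and a group homomorphism $\phi:T\to\mathrm{Int}(N)$ such that $G=N\rtimes_{\phi}T$.
   Context: A group $G$ is called evolving if it is finite and if, for every prime number $p$ and for every $p$-subgroup $I$ of $G$, there exists a subgroup $J$ of $G$ that contains $I$ and such that $|G:J|$ is a power of $p$ and $|J:I|$ is coprime to $p$. An automorphism $\alpha$ of a group $N$ is called intense if for each subgroup $H$ of $N$ there exists $x\in N$ such that $\alpha(H)=xHx^{-1}$; $\mathrm{Int}(N)\leq\mathrm{Aut}(N)$ denotes the group of intense automorphisms of $N$. The semidirect product $N\rtimes_\phi T$ is formed with respect to the action of $T$ on $N$ given by $\phi$, and the equality $G=N\rtimes_\phi T$ is understood up to isomorphism. *)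

theory Defs
  imports "HOL-Algebra.Bij" "HOL-Algebra.Generated_Groups" "HOL-Computational_Algebra.Primes"
begin

definition subgroup_index :: "('a, 'm) monoid_scheme \<Rightarrow> 'a set \<Rightarrow> nat" where
  "subgroup_index G H = card (rcosets\<^bsub>G\<^esub> H)"

text \<open>Trivial subgroups count as \<open>p\<close>-subgroups (exponent \<open>k = 0\<close>).\<close>

definition evolving :: "('a, 'm) monoid_scheme \<Rightarrow> bool" where
  "evolving G \<longleftrightarrow> group G \<and> finite (carrier G) \<and>
     (\<forall>p::nat. prime p \<longrightarrow>
       (\<forall>I. subgroup I G \<and> (\<exists>k. card I = p ^ k) \<longrightarrow>
         (\<exists>J. subgroup J G \<and> I \<subseteq> J \<and> (\<exists>k. subgroup_index G J = p ^ k) \<and>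
           coprime (subgroup_index (G\<lparr>carrier := J\<rparr>) I) p)))"

definition intense :: "('a, 'm) monoid_scheme \<Rightarrow> ('a \<Rightarrow> 'a) \<Rightarrow> bool" where
  "intense N \<alpha> \<longleftrightarrow> \<alpha> \<in> auto N \<and>
     (\<forall>H. subgroup H N \<longrightarrow>
       (\<exists>x \<in> carrier N. \<alpha> ` H = (x <#\<^bsub>N\<^esub> H) #>\<^bsub>N\<^esub> (inv\<^bsub>N\<^esub> x)))"

text \<open>The operation of \<open>AutoGroup\<close> is composition \<open>\<alpha> \<circ> \<beta>\<close>, so a homomorphism into \<open>IntGroup N\<close> is a left action.\<close>

definition IntGroup :: "('a, 'm) monoid_scheme \<Rightarrow> ('a \<Rightarrow> 'a) monoid" where
  "IntGroup N = AutoGroup N \<lparr>carrier := {\<alpha>. intense N \<alpha>}\<rparr>"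

definition commutator_subgroup :: "('a, 'm) monoid_scheme \<Rightarrow> 'a set \<Rightarrow> 'a set \<Rightarrow> 'a set" where
  "commutator_subgroup G H K = generate G
     {h \<otimes>\<^bsub>G\<^esub> k \<otimes>\<^bsub>G\<^esub> inv\<^bsub>G\<^esub> h \<otimes>\<^bsub>G\<^esub> inv\<^bsub>G\<^esub> k | h k. h \<in> H \<and> k \<in> K}"

primrec lower_central :: "('a, 'm) monoid_scheme \<Rightarrow> nat \<Rightarrow> 'a set" where
  "lower_central G 0 = carrier G"
| "lower_central G (Suc n) = commutator_subgroup G (lower_central G n) (carrier G)"

definition nilpotent_group :: "('a, 'm) monoid_scheme \<Rightarrow> bool" where
  "nilpotent_group G \<longleftrightarrow> group G \<and> (\<exists>n. lower_central G n = {\<one>\<^bsub>G\<^esub>})"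

definition semidirect_product ::
    "('b, 'm) monoid_scheme \<Rightarrow> ('c, 'n) monoid_scheme \<Rightarrow> ('c \<Rightarrow> 'b \<Rightarrow> 'b) \<Rightarrow> ('b \<times> 'c) monoid" where
  "semidirect_product N T \<phi> =
     \<lparr>carrier = carrier N \<times> carrier T,
      monoid.mult = (\<lambda>(n, t) (n', t'). (n \<otimes>\<^bsub>N\<^esub> \<phi> t n', t \<otimes>\<^bsub>T\<^esub> t')),
      one = (\<one>\<^bsub>N\<^esub>, \<one>\<^bsub>T\<^esub>)\<rparr>"

lemma l_r_coset_eq_image:
  "(x <#\<^bsub>N\<^esub> H) #>\<^bsub>N\<^esub> y = (\<lambda>h. x \<otimes>\<^bsub>N\<^esub> h \<otimes>\<^bsub>N\<^esub> y) ` H"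
  by (auto simp: l_coset_def r_coset_def)

lemma IntGroup_simps:
  "carrier (IntGroup N) = {\<alpha>. intense N \<alpha>}"
  "monoid.mult (IntGroup N) = monoid.mult (BijGroup (carrier N))"
  "monoid.one (IntGroup N) = (\<lambda>x \<in> carrier N. x)"
  by (auto simp: IntGroup_def AutoGroup_def BijGroup_def)

lemma intenseD:
  assumes "intense N \<alpha>"
  shows "\<alpha> \<in> Bij (carrier N)" "\<alpha> \<in> hom N N" "\<alpha> ` carrier N = carrier N"
    "x \<in> carrier N \<Longrightarrow> \<alpha> x \<in> carrier N"
    "x \<in> carrier N \<Longrightarrow> y \<in> carrier N \<Longrightarrow> \<alpha> (x \<otimes>\<^bsub>N\<^esub> y) = \<alpha> x \<otimes>\<^bsub>N\<^esub> \<alpha> y"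
  using assms by (auto simp: intense_def auto_def Bij_def bij_betw_def hom_def)

lemma IntGroup_mult:
  assumes "intense N \<alpha>" "intense N \<beta>"
  shows "\<alpha> \<otimes>\<^bsub>IntGroup N\<^esub> \<beta> = compose (carrier N) \<alpha> \<beta>"
  using intenseD(1)[OF assms(1)] intenseD(1)[OF assms(2)]
  by (simp add: IntGroup_simps BijGroup_def)

lemma (in group) conj_conj_image:
  assumes "H \<subseteq> carrier G" "x \<in> carrier G" "y \<in> carrier G"
  shows "(\<lambda>h. x \<otimes> h \<otimes> inv x) ` (\<lambda>h. y \<otimes> h \<otimes> inv y) ` H
       = (\<lambda>h. (x \<otimes> y) \<otimes> h \<otimes> inv (x \<otimes> y)) ` H"
  unfolding image_image
  by (rule image_cong) (use assms in \<open>auto simp: inv_mult_group m_assoc subset_iff\<close>)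

lemma (in group) subgroup_hom_image:
  assumes "\<alpha> \<in> hom G G" "subgroup H G"
  shows "subgroup (\<alpha> ` H) G"
proof -
  interpret group_hom G G \<alpha>
    using assms(1) by unfold_locales
  show ?thesis using subgroup_img_is_subgroup[OF assms(2)] .
qed

lemma (in group) subgroup_intense:
  "subgroup {\<alpha>. intense G \<alpha>} (AutoGroup G)"
proof
  show "{\<alpha>. intense G \<alpha>} \<subseteq> carrier (AutoGroup G)"
    by (auto simp: intense_def AutoGroup_def)
  have "(\<lambda>x\<in>carrier G. x) ` H = (\<lambda>h. \<one> \<otimes> h \<otimes> inv \<one>) ` H" if "subgroup H G" for H
    by (rule image_cong) (use subgroup.subset[OF that] in \<open>auto simp: subset_iff\<close>)
  then show "\<one>\<^bsub>AutoGroup G\<^esub> \<in> {\<alpha>. intense G \<alpha>}"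
    by (auto simp: intense_def id_in_auto AutoGroup_def BijGroup_def l_r_coset_eq_image intro!: bexI[of _ \<one>])
next
  fix \<alpha> \<beta> assume "\<alpha> \<in> {\<alpha>. intense G \<alpha>}" "\<beta> \<in> {\<alpha>. intense G \<alpha>}"
  then have a: "intense G \<alpha>" "intense G \<beta>" by auto
  interpret A: group "AutoGroup G" by (rule AutoGroup)
  have m: "\<alpha> \<otimes>\<^bsub>AutoGroup G\<^esub> \<beta> = compose (carrier G) \<alpha> \<beta>"
    using intenseD(1)[OF a(1)] intenseD(1)[OF a(2)] by (simp add: AutoGroup_def BijGroup_def)
  have "\<alpha> \<otimes>\<^bsub>AutoGroup G\<^esub> \<beta> \<in> auto G"
    using A.m_closed[of \<alpha> \<beta>] a by (simp add: AutoGroup_def intense_def)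
  moreover have "\<exists>x\<in>carrier G. compose (carrier G) \<alpha> \<beta> ` H = (x <# H) #> inv x"
    if H: "subgroup H G" for H
  proof -
    obtain y where y: "y \<in> carrier G" "\<beta> ` H = (\<lambda>h. y \<otimes> h \<otimes> inv y) ` H"
      using a(2) H by (auto simp: intense_def l_r_coset_eq_image)
    obtain x where x: "x \<in> carrier G" "\<alpha> ` \<beta> ` H = (\<lambda>h. x \<otimes> h \<otimes> inv x) ` \<beta> ` H"
      using a(1) subgroup_hom_image[OF intenseD(2)[OF a(2)] H]
      by (auto simp: intense_def l_r_coset_eq_image)
    have "compose (carrier G) \<alpha> \<beta> ` H = \<alpha> ` \<beta> ` H"
      unfolding image_image
      by (rule image_cong) (use subgroup.subset[OF H] in \<open>auto simp: compose_def\<close>)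
    also have "\<dots> = (\<lambda>h. (x \<otimes> y) \<otimes> h \<otimes> inv (x \<otimes> y)) ` H"
      using conj_conj_image[OF subgroup.subset[OF H] x(1) y(1)] x(2) y(2) by simp
    finally show ?thesis
      using x(1) y(1) by (auto simp: l_r_coset_eq_image)
  qed
  ultimately show "\<alpha> \<otimes>\<^bsub>AutoGroup G\<^esub> \<beta> \<in> {\<alpha>. intense G \<alpha>}"
    by (simp add: intense_def m)
next
  fix \<alpha> assume "\<alpha> \<in> {\<alpha>. intense G \<alpha>}"
  then have a: "intense G \<alpha>" by auto
  interpret A: group "AutoGroup G" by (rule AutoGroup)
  let ?i = "inv\<^bsub>AutoGroup G\<^esub> \<alpha>"
  have ac: "\<alpha> \<in> carrier (AutoGroup G)"
    using a by (simp add: AutoGroup_def intense_def)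
  have ic: "?i \<in> auto G"
    using A.inv_closed[OF ac] by (simp add: AutoGroup_def)
  have "\<alpha> \<otimes>\<^bsub>AutoGroup G\<^esub> ?i = compose (carrier G) \<alpha> ?i"
    using intenseD(1)[OF a] ic by (simp add: AutoGroup_def BijGroup_def auto_def)
  then have c: "compose (carrier G) \<alpha> ?i = (\<lambda>x\<in>carrier G. x)"
    using A.r_inv[OF ac] by (simp add: AutoGroup_def BijGroup_def)
  have ai: "\<alpha> (?i x) = x" if "x \<in> carrier G" for x
    using fun_cong[OF c, of x] that by (simp add: compose_def)
  have "\<exists>x\<in>carrier G. ?i ` H = (x <# H) #> inv x" if H: "subgroup H G" for H
  proof -
    have Hs: "H \<subseteq> carrier G" by (rule subgroup.subset[OF H])
    have K: "subgroup (?i ` H) G"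
      using ic H by (intro subgroup_hom_image) (auto simp: auto_def)
    have Ks: "?i ` H \<subseteq> carrier G" by (rule subgroup.subset[OF K])
    obtain x where x: "x \<in> carrier G" "\<alpha> ` ?i ` H = (\<lambda>h. x \<otimes> h \<otimes> inv x) ` ?i ` H"
      using a K by (auto simp: intense_def l_r_coset_eq_image)
    have "\<alpha> ` ?i ` H = H"
      using ai Hs by (force simp: image_image subset_iff image_iff)
    then have "(\<lambda>h. inv x \<otimes> h \<otimes> inv (inv x)) ` H
      = (\<lambda>h. inv x \<otimes> h \<otimes> inv (inv x)) ` (\<lambda>h. x \<otimes> h \<otimes> inv x) ` ?i ` H"
      using x(2) by simp
    also have "\<dots> = (\<lambda>h. (inv x \<otimes> x) \<otimes> h \<otimes> inv (inv x \<otimes> x)) ` ?i ` H"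
      by (rule conj_conj_image[OF Ks]) (use x(1) in auto)
    also have "\<dots> = (\<lambda>h. h) ` ?i ` H"
      by (rule image_cong) (use x(1) Ks in \<open>auto simp: subset_iff\<close>)
    finally show ?thesis
      using x(1) by (intro bexI[of _ "inv x"]) (simp_all add: l_r_coset_eq_image)
  qed
  then show "?i \<in> {\<alpha>. intense G \<alpha>}"
    using ic by (simp add: intense_def)
qed

lemma (in group) group_IntGroup: "group (IntGroup G)"
  unfolding IntGroup_def
  by (rule subgroup.subgroup_is_group[OF subgroup_intense AutoGroup])

lemma action_hom:
  assumes "\<phi> \<in> hom T (IntGroup N)" "t \<in> carrier T"
  shows "intense N (\<phi> t)"
    and "u \<in> carrier T \<Longrightarrow> n \<in> carrier N \<Longrightarrow> \<phi> (t \<otimes>\<^bsub>T\<^esub> u) n = \<phi> t (\<phi> u n)"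
proof -
  have *: "intense N (\<phi> s)" if "s \<in> carrier T" for s
    using hom_in_carrier[OF assms(1) that] by (simp add: IntGroup_simps)
  then show "intense N (\<phi> t)" using assms(2) by simp
  show "\<phi> (t \<otimes>\<^bsub>T\<^esub> u) n = \<phi> t (\<phi> u n)" if "u \<in> carrier T" "n \<in> carrier N"
    using hom_mult[OF assms(1) assms(2) that(1)] IntGroup_mult[OF *[OF assms(2)] *[OF that(1)]] that(2)
    by (simp add: compose_def)
qed

lemma group_semidirect_product:
  assumes "group N" "group T" "\<phi> \<in> hom T (IntGroup N)"
  shows "group (semidirect_product N T \<phi>)"
proof -
  interpret N: group N by fact
  interpret T: group T by fact
  interpret I: group "IntGroup N" by (rule N.group_IntGroup)
  interpret group_hom T "IntGroup N" \<phi>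
    using assms(3) by unfold_locales
  have cl: "\<phi> t n \<in> carrier N" if "t \<in> carrier T" "n \<in> carrier N" for t n
    using intenseD(4)[OF action_hom(1)[OF assms(3)]] that by simp
  have mul: "\<phi> t (n \<otimes>\<^bsub>N\<^esub> m) = \<phi> t n \<otimes>\<^bsub>N\<^esub> \<phi> t m"
    if "t \<in> carrier T" "n \<in> carrier N" "m \<in> carrier N" for t n m
    using intenseD(5)[OF action_hom(1)[OF assms(3)]] that by simp
  have one: "\<phi> \<one>\<^bsub>T\<^esub> n = n" if "n \<in> carrier N" for n
    using hom_one that by (simp add: IntGroup_simps)
  show ?thesis
  proof (rule groupI)
    fix x assume "x \<in> carrier (semidirect_product N T \<phi>)"
    then obtain n t where x: "x = (n, t)" "n \<in> carrier N" "t \<in> carrier T"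
      by (auto simp: semidirect_product_def)
    have "\<phi> (inv\<^bsub>T\<^esub> t) (inv\<^bsub>N\<^esub> n) \<otimes>\<^bsub>N\<^esub> \<phi> (inv\<^bsub>T\<^esub> t) n = \<phi> (inv\<^bsub>T\<^esub> t) \<one>\<^bsub>N\<^esub>"
      using mul[of "inv\<^bsub>T\<^esub> t" "inv\<^bsub>N\<^esub> n" n] x by simp
    also have "\<dots> = \<one>\<^bsub>N\<^esub>"
      by (rule Group.hom_one[OF intenseD(2)[OF action_hom(1)[OF assms(3)]] assms(1,1)]) (use x in simp)
    finally show "\<exists>y\<in>carrier (semidirect_product N T \<phi>).
        y \<otimes>\<^bsub>semidirect_product N T \<phi>\<^esub> x = \<one>\<^bsub>semidirect_product N T \<phi>\<^esub>"
      using x cl by (intro bexI[of _ "(\<phi> (inv\<^bsub>T\<^esub> t) (inv\<^bsub>N\<^esub> n), inv\<^bsub>T\<^esub> t)"])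
        (auto simp: semidirect_product_def simp del: hom_inv)
  qed (auto simp: semidirect_product_def cl mul one N.m_assoc T.m_assoc action_hom(2)[OF assms(3)] simp del: hom_mult hom_one)
qed

lemma commutator_subgroup_iso:
  assumes "group G" "group G'" "f \<in> iso G G'" "H \<subseteq> carrier G" "K \<subseteq> carrier G"
  shows "commutator_subgroup G' (f ` H) (f ` K) = f ` commutator_subgroup G H K"
    and "commutator_subgroup G H K \<subseteq> carrier G"
proof -
  interpret group_hom G G' f
    using assms(1-3) by (simp add: group_hom_def group_hom_axioms_def iso_def)
  let ?S = "{h \<otimes>\<^bsub>G\<^esub> k \<otimes>\<^bsub>G\<^esub> inv\<^bsub>G\<^esub> h \<otimes>\<^bsub>G\<^esub> inv\<^bsub>G\<^esub> k | h k. h \<in> H \<and> k \<in> K}"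
  have S: "?S \<subseteq> carrier G" using assms(4,5) by (auto simp: subset_iff)
  have e: "f (h \<otimes>\<^bsub>G\<^esub> k \<otimes>\<^bsub>G\<^esub> inv\<^bsub>G\<^esub> h \<otimes>\<^bsub>G\<^esub> inv\<^bsub>G\<^esub> k)
      = f h \<otimes>\<^bsub>G'\<^esub> f k \<otimes>\<^bsub>G'\<^esub> inv\<^bsub>G'\<^esub> f h \<otimes>\<^bsub>G'\<^esub> inv\<^bsub>G'\<^esub> f k" if "h \<in> H" "k \<in> K" for h k
  proof -
    have "h \<in> carrier G" "k \<in> carrier G" using that assms(4,5) by auto
    then show ?thesis by simp
  qed
  have "{h \<otimes>\<^bsub>G'\<^esub> k \<otimes>\<^bsub>G'\<^esub> inv\<^bsub>G'\<^esub> h \<otimes>\<^bsub>G'\<^esub> inv\<^bsub>G'\<^esub> k | h k. h \<in> f ` H \<and> k \<in> f ` K} = f ` ?S"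
  proof (intro subset_antisym subsetI)
    fix x assume "x \<in> {h \<otimes>\<^bsub>G'\<^esub> k \<otimes>\<^bsub>G'\<^esub> inv\<^bsub>G'\<^esub> h \<otimes>\<^bsub>G'\<^esub> inv\<^bsub>G'\<^esub> k | h k. h \<in> f ` H \<and> k \<in> f ` K}"
    then obtain h k where "h \<in> H" "k \<in> K"
      "x = f h \<otimes>\<^bsub>G'\<^esub> f k \<otimes>\<^bsub>G'\<^esub> inv\<^bsub>G'\<^esub> f h \<otimes>\<^bsub>G'\<^esub> inv\<^bsub>G'\<^esub> f k" by auto
    then show "x \<in> f ` ?S" using e[of h k, symmetric] by auto
  next
    fix x assume "x \<in> f ` ?S"
    then obtain h k where hk: "h \<in> H" "k \<in> K"
      "x = f (h \<otimes>\<^bsub>G\<^esub> k \<otimes>\<^bsub>G\<^esub> inv\<^bsub>G\<^esub> h \<otimes>\<^bsub>G\<^esub> inv\<^bsub>G\<^esub> k)" by auto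
    then show "x \<in> {h \<otimes>\<^bsub>G'\<^esub> k \<otimes>\<^bsub>G'\<^esub> inv\<^bsub>G'\<^esub> h \<otimes>\<^bsub>G'\<^esub> inv\<^bsub>G'\<^esub> k | h k. h \<in> f ` H \<and> k \<in> f ` K}"
      using e[of h k] by blast
  qed
  then show "commutator_subgroup G' (f ` H) (f ` K) = f ` commutator_subgroup G H K"
    using generate_img[OF S] by (simp add: commutator_subgroup_def)
  show "commutator_subgroup G H K \<subseteq> carrier G"
    using G.generate_incl[OF S] by (simp add: commutator_subgroup_def)
qed

lemma lower_central_iso:
  assumes "group G" "group G'" "f \<in> iso G G'"
  shows "lower_central G n \<subseteq> carrier G \<and> lower_central G' n = f ` lower_central G n"
proof (induction n)
  case 0
  show ?case using assms(3) by (auto simp: iso_def bij_betw_def)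
next
  case (Suc n)
  have "f ` carrier G = carrier G'" using assms(3) by (auto simp: iso_def bij_betw_def)
  then show ?case
    using Suc commutator_subgroup_iso[OF assms, of "lower_central G n" "carrier G"] by simp
qed

lemma nilpotent_group_iso:
  assumes "nilpotent_group G" "group G'" "G \<cong> G'"
  shows "nilpotent_group G'"
proof -
  have G: "group G" using assms(1) by (simp add: nilpotent_group_def)
  obtain f where f: "f \<in> iso G G'" using assms(3) by (auto simp: is_iso_def)
  obtain n where "lower_central G n = {\<one>\<^bsub>G\<^esub>}" using assms(1) by (auto simp: nilpotent_group_def)
  moreover have "f \<one>\<^bsub>G\<^esub> = \<one>\<^bsub>G'\<^esub>"
    using f hom_one[OF _ G assms(2)] by (simp add: iso_def)
  ultimately have "lower_central G' n = {\<one>\<^bsub>G'\<^esub>}"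
    using lower_central_iso[OF G assms(2) f, of n] by simp
  then show ?thesis using assms(2) by (auto simp: nilpotent_group_def)
qed

lemma intense_transport:
  assumes "group N" "group N'" "group_isomorphisms N N' f f'" "intense N \<alpha>"
  shows "intense N' (\<lambda>x\<in>carrier N'. f (\<alpha> (f' x)))" (is "intense N' ?\<beta>")
proof -
  interpret N: group N by fact
  interpret N': group N' by fact
  have fh: "f \<in> hom N N'" and f'h: "f' \<in> hom N' N"
    and f'f: "\<And>x. x \<in> carrier N \<Longrightarrow> f' (f x) = x"
    and ff': "\<And>x. x \<in> carrier N' \<Longrightarrow> f (f' x) = x"
    using assms(3) by (auto simp: group_isomorphisms_def)
  interpret f: group_hom N N' f using fh by unfold_locales
  interpret f': group_hom N' N f' using f'h by unfold_locales
  note a = intenseD[OF assms(4)]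
  have h: "?\<beta> \<in> hom N' N'"
    by (auto simp: hom_def a)
  have "bij_betw f' (carrier N') (carrier N)"
    by (rule bij_betw_byWitness[where f' = f]) (auto simp: f'f ff')
  moreover have "bij_betw f (carrier N) (carrier N')"
    by (rule bij_betw_byWitness[where f' = f']) (auto simp: f'f ff')
  moreover have "bij_betw \<alpha> (carrier N) (carrier N)"
    using a(1) by (simp add: Bij_def)
  ultimately have "bij_betw (f \<circ> (\<alpha> \<circ> f')) (carrier N') (carrier N')"
    by (blast intro: bij_betw_trans)
  then have "bij_betw ?\<beta> (carrier N') (carrier N')"
    by (rule bij_betw_cong[THEN iffD1, rotated]) simp
  with h have "?\<beta> \<in> auto N'" by (simp add: auto_def Bij_def)
  moreover have "\<exists>x\<in>carrier N'. ?\<beta> ` H = (x <#\<^bsub>N'\<^esub> H) #>\<^bsub>N'\<^esub> (inv\<^bsub>N'\<^esub> x)"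
    if H: "subgroup H N'" for H
  proof -
    have Hs: "H \<subseteq> carrier N'" by (rule subgroup.subset[OF H])
    have K: "subgroup (f' ` H) N" by (rule f'.subgroup_img_is_subgroup[OF H])
    obtain x where x: "x \<in> carrier N" "\<alpha> ` f' ` H = (\<lambda>h. x \<otimes>\<^bsub>N\<^esub> h \<otimes>\<^bsub>N\<^esub> inv\<^bsub>N\<^esub> x) ` f' ` H"
      using assms(4) K by (auto simp: intense_def l_r_coset_eq_image)
    have "?\<beta> ` H = f ` \<alpha> ` f' ` H"
      unfolding image_image by (rule image_cong) (use Hs in auto)
    also have "\<dots> = (\<lambda>h. f x \<otimes>\<^bsub>N'\<^esub> h \<otimes>\<^bsub>N'\<^esub> inv\<^bsub>N'\<^esub> (f x)) ` H"
      unfolding x(2) unfolding image_image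
    proof (rule image_cong)
      fix h assume "h \<in> H"
      then have "h \<in> carrier N'" using Hs by auto
      then show "f (x \<otimes>\<^bsub>N\<^esub> f' h \<otimes>\<^bsub>N\<^esub> inv\<^bsub>N\<^esub> x) = f x \<otimes>\<^bsub>N'\<^esub> h \<otimes>\<^bsub>N'\<^esub> inv\<^bsub>N'\<^esub> f x"
        using x(1) by (simp add: ff')
    qed simp
    finally show ?thesis using x(1) by (auto simp: l_r_coset_eq_image)
  qed
  ultimately show ?thesis by (simp add: intense_def)
qed

lemma semidirect_product_transport:
  assumes "group N" "group N'" "group T" "group T'" "N \<cong> N'" "T \<cong> T'"
    and \<phi>: "\<phi> \<in> hom T (IntGroup N)"
  shows "\<exists>\<psi>. \<psi> \<in> hom T' (IntGroup N') \<and> semidirect_product N T \<phi> \<cong> semidirect_product N' T' \<psi>"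
proof -
  interpret N: group N by fact
  interpret N': group N' by fact
  interpret T: group T by fact
  interpret T': group T' by fact
  obtain f f' where iN: "group_isomorphisms N N' f f'"
    using assms(5) N.iso_iff_group_isomorphisms by (fastforce simp: is_iso_def)
  obtain g g' where iT: "group_isomorphisms T T' g g'"
    using assms(6) T.iso_iff_group_isomorphisms by (fastforce simp: is_iso_def)
  interpret f: group_hom N N' f using iN by unfold_locales (simp add: group_isomorphisms_def)
  interpret f': group_hom N' N f' using iN by unfold_locales (simp add: group_isomorphisms_def)
  interpret g: group_hom T T' g using iT by unfold_locales (simp add: group_isomorphisms_def)
  interpret g': group_hom T' T g' using iT by unfold_locales (simp add: group_isomorphisms_def)
  have inv: "\<And>x. x \<in> carrier N \<Longrightarrow> f' (f x) = x" "\<And>x. x \<in> carrier N' \<Longrightarrow> f (f' x) = x"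
    "\<And>x. x \<in> carrier T \<Longrightarrow> g' (g x) = x" "\<And>x. x \<in> carrier T' \<Longrightarrow> g (g' x) = x"
    using iN iT by (auto simp: group_isomorphisms_def)
  define \<psi> where "\<psi> = (\<lambda>t. \<lambda>x\<in>carrier N'. f (\<phi> (g' t) (f' x)))"
  have ps: "intense N' (\<psi> t)" if "t \<in> carrier T'" for t
    unfolding \<psi>_def using that
    by (intro intense_transport[OF assms(1,2) iN] action_hom(1)[OF \<phi>]) simp
  have cl: "\<phi> t n \<in> carrier N" if "t \<in> carrier T" "n \<in> carrier N" for t n
    using intenseD(4)[OF action_hom(1)[OF \<phi>]] that by simp
  have "\<psi> \<in> hom T' (IntGroup N')"
  proof (rule homI)
    show "\<psi> t \<in> carrier (IntGroup N')" if "t \<in> carrier T'" for t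
      using ps[OF that] by (simp add: IntGroup_simps)
  next
    fix t u assume tu: "t \<in> carrier T'" "u \<in> carrier T'"
    have "\<psi> (t \<otimes>\<^bsub>T'\<^esub> u) = compose (carrier N') (\<psi> t) (\<psi> u)"
    proof
      fix x show "\<psi> (t \<otimes>\<^bsub>T'\<^esub> u) x = compose (carrier N') (\<psi> t) (\<psi> u) x"
        using tu action_hom(2)[OF \<phi>, of "g' t" "g' u" "f' x"] cl[of "g' u" "f' x"]
        by (cases "x \<in> carrier N'") (simp_all add: \<psi>_def compose_def inv)
    qed
    then show "\<psi> (t \<otimes>\<^bsub>T'\<^esub> u) = \<psi> t \<otimes>\<^bsub>IntGroup N'\<^esub> \<psi> u"
      using IntGroup_mult[OF ps[OF tu(1)] ps[OF tu(2)]] by simp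
  qed
  moreover have "map_prod f g \<in> iso (semidirect_product N T \<phi>) (semidirect_product N' T' \<psi>)"
  proof -
    have "map_prod f g \<in> hom (semidirect_product N T \<phi>) (semidirect_product N' T' \<psi>)"
      by (rule homI) (auto simp: semidirect_product_def \<psi>_def inv cl)
    moreover have "bij_betw (map_prod f g) (carrier N \<times> carrier T) (carrier N' \<times> carrier T')"
      by (rule bij_betw_byWitness[where f' = "map_prod f' g'"]) (auto simp: inv)
    ultimately show ?thesis by (simp add: iso_def semidirect_product_def)
  qed
  ultimately show ?thesis by (auto simp: is_iso_def)
qed

lemma (in group) iso_copy_of_mon:
  fixes H :: "('h, 'n) monoid_scheme"
  assumes "group H" "f \<in> mon H G"
  shows "\<exists>K :: 'a monoid. group K \<and> H \<cong> K"
proof -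
  interpret H: group H by fact
  interpret f: group_hom H G f
    using assms(2) by unfold_locales (simp add: mon_def)
  let ?K = "\<lparr>carrier = f ` carrier H, monoid.mult = monoid.mult G, one = \<one>\<rparr>"
  have "f \<in> iso H ?K"
    using assms(2) by (auto simp: iso_def mon_def hom_def bij_betw_def)
  moreover have "group ?K"
  proof (rule groupI)
    fix x assume "x \<in> carrier ?K"
    then obtain h where "h \<in> carrier H" "x = f h" by auto
    then show "\<exists>y\<in>carrier ?K. y \<otimes>\<^bsub>?K\<^esub> x = \<one>\<^bsub>?K\<^esub>"
      by (auto intro!: bexI[of _ "inv\<^bsub>H\<^esub> h"])
  next
    show "\<one>\<^bsub>?K\<^esub> \<in> carrier ?K"
      by (simp add: image_iff) (metis H.one_closed f.hom_one)
  next
    fix x y assume "x \<in> carrier ?K" "y \<in> carrier ?K"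
    then obtain h k where "h \<in> carrier H" "x = f h" "k \<in> carrier H" "y = f k" by auto
    then show "x \<otimes>\<^bsub>?K\<^esub> y \<in> carrier ?K"
      by (auto intro!: image_eqI[of _ _ "h \<otimes>\<^bsub>H\<^esub> k"])
  qed (auto simp: m_assoc)
  ultimately show ?thesis by (auto simp: is_iso_def)
qed

lemma mon_comp_iso:
  assumes "f \<in> mon H K" "h \<in> iso K L"
  shows "h \<circ> f \<in> mon H L"
proof -
  have "f ` carrier H \<subseteq> carrier K"
    using assms(1) by (auto simp: mon_def hom_def)
  then have "inj_on h (f ` carrier H)"
    using assms(2) by (auto simp: iso_def bij_betw_def intro: inj_on_subset)
  then show ?thesis
    using assms hom_compose[of f H K h L] by (auto simp: mon_def iso_def intro: comp_inj_on)
qed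

text \<open>
  HOL does not allow an existential quantifier over types. Quantifying only over factors with
  elements in the type of the group \<open>G\<close> is no restriction: an intense semidirect decomposition
  of \<open>G\<close> with factors on arbitrary types yields one with factors on the type of \<open>G\<close>.
\<close>

lemma intense_decomposition_same_type:
  fixes G :: "('a, 'm) monoid_scheme" and N :: "('b, 'n) monoid_scheme"
    and T :: "('c, 'k) monoid_scheme"
  assumes "group G" "nilpotent_group N" "nilpotent_group T" "coprime (order N) (order T)"
    "\<phi> \<in> hom T (IntGroup N)" "G \<cong> semidirect_product N T \<phi>"
  shows "\<exists>(N' :: 'a monoid) (T' :: 'a monoid) \<psi>.
    nilpotent_group N' \<and> nilpotent_group T' \<and> coprime (order N') (order T') \<and>
    \<psi> \<in> hom T' (IntGroup N') \<and> G \<cong> semidirect_product N' T' \<psi>"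
proof -
  interpret G: group G by fact
  have gN: "group N" and gT: "group T" using assms(2,3) by (auto simp: nilpotent_group_def)
  interpret N: group N by fact
  interpret T: group T by fact
  interpret I: group "IntGroup N" by (rule N.group_IntGroup)
  interpret p: group_hom T "IntGroup N" \<phi> using assms(5) by unfold_locales
  let ?P = "semidirect_product N T \<phi>"
  interpret P: group ?P by (rule group_semidirect_product[OF gN gT assms(5)])
  obtain h where h: "h \<in> iso ?P G"
    using G.iso_sym[OF assms(6)] by (auto simp: is_iso_def)
  have "(\<lambda>n. (n, \<one>\<^bsub>T\<^esub>)) \<in> mon N ?P"
    using p.hom_one by (auto simp: mon_def hom_def inj_on_def semidirect_product_def IntGroup_simps)
  then have hN: "h \<circ> (\<lambda>n. (n, \<one>\<^bsub>T\<^esub>)) \<in> mon N G"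
    using h by (rule mon_comp_iso)
  have "\<phi> t \<one>\<^bsub>N\<^esub> = \<one>\<^bsub>N\<^esub>" if "t \<in> carrier T" for t
    using Group.hom_one[OF intenseD(2)[OF action_hom(1)[OF assms(5) that]] gN gN] .
  then have "(\<lambda>t. (\<one>\<^bsub>N\<^esub>, t)) \<in> mon T ?P"
    by (auto simp: mon_def hom_def inj_on_def semidirect_product_def)
  then have hT: "h \<circ> (\<lambda>t. (\<one>\<^bsub>N\<^esub>, t)) \<in> mon T G"
    using h by (rule mon_comp_iso)
  obtain N' :: "'a monoid" where N': "group N'" "N \<cong> N'"
    using G.iso_copy_of_mon[OF gN hN] by auto
  obtain T' :: "'a monoid" where T': "group T'" "T \<cong> T'"
    using G.iso_copy_of_mon[OF gT hT] by auto
  obtain \<psi> where \<psi>: "\<psi> \<in> hom T' (IntGroup N')" "?P \<cong> semidirect_product N' T' \<psi>"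
    using semidirect_product_transport[OF gN N'(1) gT T'(1) N'(2) T'(2) assms(5)] by auto
  have "order N' = order N" "order T' = order T"
    using iso_same_card[OF N'(2)] iso_same_card[OF T'(2)] by (auto simp: order_def)
  then show ?thesis
    using nilpotent_group_iso[OF assms(2) N'] nilpotent_group_iso[OF assms(3) T'] \<psi> assms(4)
      iso_trans[OF assms(6) \<psi>(2)]
    by (intro exI[of _ N'] exI[of _ T'] exI[of _ \<psi>]) simp
qed

end

(* From evolving to intense. Let r be the largest prime dividing |G|. Normality of subgroups of
   smallest prime index shows that the Sylow r-subgroup R is normal. Every normal subgroup of R is
   then normal in G, so a complement K acts on each R/W with |R : W| = r, and the derived subgroup
   of K acts trivially on all of them. By induction along K, for each prime q either a Sylow
   q-subgroup is normal or there is a normal q-complement. Let A be the set of primes without a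
   normal complement, N the product of the Sylow q-subgroups for q in A, and T the intersection of
   q-complements, one for each q in A. Both are nilpotent, and intersecting suitable subgroups J
   of q-power index, one for each q in A, shows that conjugation maps every subgroup of N to an
   N-conjugate.

   From intense to evolving, for a p-subgroup I. If p does not divide |N|, extend I by the normal
   p-complement of G. Otherwise intensity gives N_G(I) N = G, and a Frattini argument finds in
   N_G(I) a subgroup of order |T|, which together with I and the p-complement of N generates the
   required J. *)

theory Submission
  imports Defs "HOL-Algebra.Sylow" "HOL-Algebra.Multiplicative_Group"
begin

section \<open>Parts of natural numbers\<close>

text \<open>The trivial subgroup is a p-subgroup, so the evolving condition itself supplies
  complements to Sylow subgroups; K and the q-complements that meet in T all arise this way. Being
  of smallest prime index is what forces normality, so the primes are removed from below and the
  largest one is left with a normal Sylow subgroup.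

  The quotients R/W of order r stand in for R modulo its Frattini subgroup. Automorphisms of a group
  of prime order commute, which kills the derived subgroup K' on each R/W, and an s-subgroup with s
  \<noteq> r that is trivial on all of them centralizes R. This yields the dichotomy for a normal
  Sylow q-subgroup Q of K: inside K' it centralizes R and becomes normal in G; outside K' it has a
  quotient of order q on which K is trivial, triviality spreads to all such quotients of Q, and a
  q-complement of K centralizes Q.

  In the converse the obstacle is that a conjugate of T need not be visible inside N_G(I). A
  subgroup of order |T| is found there instead, which is enough because J is judged only by its
  order.\<close>

definition p_part :: "nat \<Rightarrow> nat \<Rightarrow> nat" where
  "p_part p n = p ^ multiplicity p n"

lemma p_part_dvd: "p_part p n dvd n"
  by (simp add: p_part_def multiplicity_dvd)

lemma p_part_eqI:
  assumes "prime p" "n = p ^ a * b" "\<not> p dvd b"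
  shows "p_part p n = p ^ a"
proof -
  have "multiplicity p n = a"
    unfolding assms(2)
    by (rule multiplicity_eqI) (use assms in auto)
  then show ?thesis by (simp add: p_part_def)
qed

lemma p_part_decompose:
  assumes "prime p" "n > 0"
  obtains b where "n = p_part p n * b" "\<not> p dvd b"
proof -
  obtain b where b: "n = p ^ multiplicity p n * b" "\<not> p dvd b"
    using multiplicity_decompose'[of n p] assms by (metis not_prime_unit less_numeral_extra(3))
  then show ?thesis using that by (simp add: p_part_def)
qed

lemma coprime_prime_power_cancel:
  fixes p :: nat
  assumes "prime p" "p ^ a * b = p ^ c * d" "\<not> p dvd b" "\<not> p dvd d"
  shows "a = c" "b = d"
proof -
  have "p_part p (p ^ a * b) = p ^ a" "p_part p (p ^ a * b) = p ^ c"
    using p_part_eqI[OF assms(1) refl assms(3)] p_part_eqI[OF assms(1,2,4)] by auto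
  then show "a = c" using assms(1) by (metis power_inject_exp prime_gt_1_nat)
  then show "b = d" using assms prime_gt_0_nat[of p] by auto
qed

lemma dvd_if_p_parts_dvd:
  assumes "n > 0" "\<And>p. prime p \<Longrightarrow> p dvd n \<Longrightarrow> p_part p n dvd (m::nat)" 
  shows "n dvd m"
proof (cases "m = 0")
  case False
  show ?thesis
  proof (rule multiplicity_le_imp_dvd)
    show "n \<noteq> 0" using assms by simp
    fix p :: nat assume p: "prime p"
    show "multiplicity p n \<le> multiplicity p m"
    proof (cases "p dvd n")
      case True
      then have "p ^ multiplicity p n dvd m" using assms(2)[OF p] by (simp add: p_part_def)
      then show ?thesis using False p
        by (intro multiplicity_geI) (auto dest: prime_gt_1_nat)
    qed (simp add: not_dvd_imp_multiplicity_0)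
  qed
qed simp

lemma coprime_p_part:
  assumes "prime p" "\<not> p dvd m" shows "coprime (p_part p n) m"
  using assms by (simp add: p_part_def prime_imp_coprime)

lemma coprime_if_no_common_prime:
  assumes "\<And>p. prime p \<Longrightarrow> p dvd m \<Longrightarrow> p dvd n \<Longrightarrow> False"
  shows "coprime m (n::nat)"
  using assms coprime_iff_gcd_eq_1 prime_factor_nat[of "gcd m n"] by (auto simp: coprime_iff_gcd_eq_1)

lemma card_eq_fibers:
  assumes "finite A" "\<And>y. y \<in> f ` A \<Longrightarrow> card {x\<in>A. f x = y} = n"
  shows "card A = card (f ` A) * n"
proof -
  have "card A = (\<Sum>y\<in>f ` A. \<Sum>x\<in>{x\<in>A. f x = y}. 1)"
    using sum.image_gen[OF assms(1), of "\<lambda>_. 1::nat" f] by simp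
  also have "\<dots> = card (f ` A) * n" using assms(2) by simp
  finally show ?thesis .
qed

section \<open>Conjugation, products and orders of subgroups\<close>

locale finite_group = group +
  assumes finite_carrier: "finite (carrier G)"

context group
begin

definition conj_by :: "'a \<Rightarrow> 'a \<Rightarrow> 'a" where
  "conj_by g x = g \<otimes> x \<otimes> inv g"

text \<open>Only the inclusion of h K h^-1 in K is asked, and H and K may be arbitrary sets, so
  singletons are covered too. On a finite K inside the carrier, injectivity of conjugation turns the
  inclusion into equality.\<close>

definition normalizes :: "'a set \<Rightarrow> 'a set \<Rightarrow> bool" where
  "normalizes H K \<longleftrightarrow> (\<forall>h\<in>H. \<forall>k\<in>K. conj_by h k \<in> K)"

lemma conj_by_closed [simp, intro]:
  "g \<in> carrier G \<Longrightarrow> x \<in> carrier G \<Longrightarrow> conj_by g x \<in> carrier G"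
  by (simp add: conj_by_def)

lemma inv_mult_cancel:
  "x \<in> carrier G \<Longrightarrow> y \<in> carrier G \<Longrightarrow> inv x \<otimes> (x \<otimes> y) = y"
  "x \<in> carrier G \<Longrightarrow> y \<in> carrier G \<Longrightarrow> x \<otimes> (inv x \<otimes> y) = y"
  by (simp_all add: m_assoc[symmetric])

lemma conj_by_mult:
  "g \<in> carrier G \<Longrightarrow> x \<in> carrier G \<Longrightarrow> y \<in> carrier G \<Longrightarrow>
    conj_by g (x \<otimes> y) = conj_by g x \<otimes> conj_by g y"
  by (simp add: conj_by_def m_assoc inv_mult_cancel)

lemma conj_by_conj_by:
  "g \<in> carrier G \<Longrightarrow> h \<in> carrier G \<Longrightarrow> x \<in> carrier G \<Longrightarrow>
    conj_by (g \<otimes> h) x = conj_by g (conj_by h x)"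
  by (simp add: conj_by_def m_assoc inv_mult_group)

lemma conj_by_one [simp]: "x \<in> carrier G \<Longrightarrow> conj_by \<one> x = x"
  by (simp add: conj_by_def)

lemma conj_by_id [simp]: "g \<in> carrier G \<Longrightarrow> conj_by g \<one> = \<one>"
  by (simp add: conj_by_def)

lemma conj_by_inv:
  "g \<in> carrier G \<Longrightarrow> x \<in> carrier G \<Longrightarrow> conj_by g (inv x) = inv (conj_by g x)"
  by (simp add: conj_by_def inv_mult_group m_assoc)

lemma conj_by_cancel [simp]:
  "g \<in> carrier G \<Longrightarrow> x \<in> carrier G \<Longrightarrow> conj_by (inv g) (conj_by g x) = x"
  "g \<in> carrier G \<Longrightarrow> x \<in> carrier G \<Longrightarrow> conj_by g (conj_by (inv g) x) = x"
  by (simp_all add: conj_by_conj_by[symmetric])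

lemma conj_by_inj: "g \<in> carrier G \<Longrightarrow> inj_on (conj_by g) (carrier G)"
  by (rule inj_on_inverseI[of _ "conj_by (inv g)"]) simp

lemma conj_by_hom: "g \<in> carrier G \<Longrightarrow> conj_by g \<in> hom G G"
  by (auto simp: hom_def conj_by_mult)

lemma subgroup_conj_by: "g \<in> carrier G \<Longrightarrow> subgroup H G \<Longrightarrow> subgroup (conj_by g ` H) G"
  by (rule subgroup_hom_image[OF conj_by_hom])

lemma normalizesD: "normalizes H K \<Longrightarrow> h \<in> H \<Longrightarrow> k \<in> K \<Longrightarrow> conj_by h k \<in> K"
  by (simp add: normalizes_def)

lemma normalizesI: "(\<And>h k. h \<in> H \<Longrightarrow> k \<in> K \<Longrightarrow> conj_by h k \<in> K) \<Longrightarrow> normalizes H K"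
  by (simp add: normalizes_def)

lemma normalizes_mono: "normalizes H K \<Longrightarrow> H' \<subseteq> H \<Longrightarrow> normalizes H' K"
  by (auto simp: normalizes_def)

lemma normalizes_Int: "normalizes H K \<Longrightarrow> normalizes H L \<Longrightarrow> normalizes H (K \<inter> L)"
  by (auto simp: normalizes_def)

lemma normalizes_self: "subgroup H G \<Longrightarrow> K \<subseteq> H \<Longrightarrow> normalizes K H"
  by (auto simp: normalizes_def conj_by_def subgroup.m_closed subgroup.m_inv_closed subset_iff)

lemma subgroup_Int: "subgroup H G \<Longrightarrow> subgroup K G \<Longrightarrow> subgroup (H \<inter> K) G"
  by (rule subgroups_Inter_pair)

lemma subgroup_sub: "subgroup H G \<Longrightarrow> x \<in> H \<Longrightarrow> x \<in> carrier G"
  by (rule subgroup.mem_carrier)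

lemma set_mult_subgroupI:
  assumes H: "subgroup H G" and K: "subgroup K G" and n: "normalizes H K"
  shows "subgroup (H <#> K) G"
proof
  note [simp] = subgroup_sub[OF H] subgroup_sub[OF K] subgroup.m_inv_closed[OF H]
    subgroup.m_inv_closed[OF K] subgroup.m_closed[OF H] subgroup.m_closed[OF K]
  show "H <#> K \<subseteq> carrier G" by (auto simp: set_mult_def)
  show "\<one> \<in> H <#> K"
    using subgroup.one_closed[OF H] subgroup.one_closed[OF K]
    by (force simp: set_mult_def)
  fix x assume "x \<in> H <#> K"
  then obtain h k where x: "h \<in> H" "k \<in> K" "x = h \<otimes> k" by (auto simp: set_mult_def)
  have "inv x = inv h \<otimes> conj_by h (inv k)"
    using x by (simp add: conj_by_def m_assoc inv_mult_group inv_mult_cancel)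
  then show "inv x \<in> H <#> K"
    using x normalizesD[OF n x(1), of "inv k"] by (auto simp: set_mult_def)
  fix y assume "y \<in> H <#> K"
  then obtain h' k' where y: "h' \<in> H" "k' \<in> K" "y = h' \<otimes> k'" by (auto simp: set_mult_def)
  have "x \<otimes> y = (h \<otimes> h') \<otimes> (conj_by (inv h') k \<otimes> k')"
    using x y by (simp add: conj_by_def m_assoc inv_mult_cancel)
  moreover have "h \<otimes> h' \<in> H" "conj_by (inv h') k \<otimes> k' \<in> K"
    using x y normalizesD[OF n, of "inv h'" k] by auto
  ultimately show "x \<otimes> y \<in> H <#> K" by (auto simp: set_mult_def)
qed

lemma set_mult_sub: "subgroup L G \<Longrightarrow> H \<subseteq> L \<Longrightarrow> K \<subseteq> L \<Longrightarrow> H <#> K \<subseteq> L"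
  by (auto simp: set_mult_def subset_iff subgroup.m_closed)

lemma sub_set_mult_left: "subgroup H G \<Longrightarrow> subgroup K G \<Longrightarrow> H \<subseteq> H <#> K"
  using subgroup.one_closed[of K] by (force simp: set_mult_def dest: subgroup_sub)

lemma sub_set_mult_right: "subgroup H G \<Longrightarrow> subgroup K G \<Longrightarrow> K \<subseteq> H <#> K"
  using subgroup.one_closed[of H] by (force simp: set_mult_def dest: subgroup_sub)

lemma normalizes_set_mult_right:
  assumes "X \<subseteq> carrier G" "H \<subseteq> carrier G" "K \<subseteq> carrier G" "normalizes X H" "normalizes X K"
  shows "normalizes X (H <#> K)"
proof (rule normalizesI)
  fix x y assume x: "x \<in> X" and "y \<in> H <#> K"
  then obtain h k where y: "h \<in> H" "k \<in> K" "y = h \<otimes> k" by (auto simp: set_mult_def)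
  have c: "x \<in> carrier G" "h \<in> carrier G" "k \<in> carrier G" using x y assms by auto
  then show "conj_by x y \<in> H <#> K"
    using normalizesD[OF assms(4) x y(1)] normalizesD[OF assms(5) x y(2)] y(3)
    by (auto simp: conj_by_mult set_mult_def)
qed

lemma normalizes_set_mult_left:
  assumes "X \<subseteq> carrier G" "H \<subseteq> carrier G" "K \<subseteq> carrier G" "normalizes H X" "normalizes K X"
  shows "normalizes (H <#> K) X"
proof (rule normalizesI)
  fix x y assume x: "x \<in> X" and "y \<in> H <#> K"
  then obtain h k where y: "h \<in> H" "k \<in> K" "y = h \<otimes> k" by (auto simp: set_mult_def)
  have c: "x \<in> carrier G" "h \<in> carrier G" "k \<in> carrier G" using x y assms by auto
  then show "conj_by y x \<in> X"
    using normalizesD[OF assms(4) y(1)] normalizesD[OF assms(5) y(2) x] y(3)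
    by (auto simp: conj_by_conj_by)
qed

lemma set_mult_subgroupI':
  assumes H: "subgroup H G" and K: "subgroup K G" and n: "normalizes K H"
  shows "subgroup (H <#> K) G"
proof -
  have "H <#> K = K <#> H"
  proof (intro subset_antisym subsetI)
    note [simp] = subgroup_sub[OF H] subgroup_sub[OF K] subgroup.m_inv_closed[OF H]
      subgroup.m_inv_closed[OF K]
    fix x assume "x \<in> H <#> K"
    then obtain h k where x: "h \<in> H" "k \<in> K" "x = h \<otimes> k" by (auto simp: set_mult_def)
    have "x = k \<otimes> conj_by (inv k) h"
      using x by (simp add: conj_by_def m_assoc inv_mult_cancel)
    then show "x \<in> K <#> H"
      using x normalizesD[OF n, of "inv k" h] by (auto simp: set_mult_def)
  next
    note [simp] = subgroup_sub[OF H] subgroup_sub[OF K] subgroup.m_inv_closed[OF H]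
      subgroup.m_inv_closed[OF K]
    fix x assume "x \<in> K <#> H"
    then obtain h k where x: "h \<in> H" "k \<in> K" "x = k \<otimes> h" by (auto simp: set_mult_def)
    have "x = conj_by k h \<otimes> k"
      using x by (simp add: conj_by_def m_assoc inv_mult_cancel)
    then show "x \<in> H <#> K"
      using x normalizesD[OF n, of "k" h] by (auto simp: set_mult_def)
  qed
  then show ?thesis using set_mult_subgroupI[OF K H n] by simp
qed

end

section \<open>Orders of products, Hall subgroups, existence of Sylow subgroups\<close>

context finite_group
begin

lemma finite_subgroup [simp]: "subgroup H G \<Longrightarrow> finite H"
  by (rule finite_subset[OF subgroup.subset finite_carrier])

lemma card_subgroup_pos: "subgroup H G \<Longrightarrow> card H > 0"
  using subgroup.one_closed[of H] by (auto simp: card_gt_0_iff)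

lemma card_conj_by: "g \<in> carrier G \<Longrightarrow> H \<subseteq> carrier G \<Longrightarrow> card (conj_by g ` H) = card H"
  by (meson card_image conj_by_inj inj_on_subset)

lemma card_subgroup_dvd:
  assumes "subgroup H G" "subgroup K G" "H \<subseteq> K"
  shows "card H dvd card K"
proof -
  interpret K: group "G\<lparr>carrier := K\<rparr>" by (rule subgroup_imp_group[OF assms(2)])
  have "card (rcosets\<^bsub>G\<lparr>carrier := K\<rparr>\<^esub> H) * card H = card K"
    using K.lagrange[OF subgroup_incl[OF assms]] by (simp add: order_def)
  then show ?thesis by (metis dvd_triv_right)
qed

text \<open>The fibre of multiplication over h k consists of the pairs (h d, d^-1 k) with d in
  \<open>H \<inter> K\<close>. The set product need not be a subgroup, so the identity can be used
  to compare sizes before that is known.\<close>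

lemma card_set_mult:
  assumes H: "subgroup H G" and K: "subgroup K G"
  shows "card (H <#> K) * card (H \<inter> K) = card H * card K"
proof -
  note [simp] = subgroup_sub[OF H] subgroup_sub[OF K] subgroup.m_inv_closed[OF H]
    subgroup.m_inv_closed[OF K] subgroup.m_closed[OF H] subgroup.m_closed[OF K]
  let ?f = "\<lambda>(h, k). h \<otimes> k"
  have im: "?f ` (H \<times> K) = H <#> K" by (auto simp: set_mult_def)
  have "card {z \<in> H \<times> K. ?f z = y} = card (H \<inter> K)" if fy: "y \<in> ?f ` (H \<times> K)" for y
  proof -
    obtain h k where y: "h \<in> H" "k \<in> K" "y = h \<otimes> k" using fy by auto
    let ?g = "\<lambda>d. (h \<otimes> d, inv d \<otimes> k)"
    have "{z \<in> H \<times> K. ?f z = y} = ?g ` (H \<inter> K)"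
    proof (intro subset_antisym subsetI)
      fix z assume "z \<in> {z \<in> H \<times> K. ?f z = y}"
      then obtain a b where ab: "a \<in> H" "b \<in> K" "a \<otimes> b = y" "z = (a, b)" by auto
      have e: "inv h \<otimes> a = k \<otimes> inv b"
      proof -
        have "inv h \<otimes> a = inv h \<otimes> (a \<otimes> b \<otimes> inv b)" using ab(1,2) y(1) by (simp add: m_assoc)
        also have "\<dots> = k \<otimes> inv b"
          unfolding ab(3) y(3) using ab(1,2) y(1,2) by (simp add: inv_mult_cancel m_assoc)
        finally show ?thesis .
      qed
      have "inv (inv h \<otimes> a) \<otimes> k = b"
        unfolding e using ab(2) y(2) by (simp add: inv_mult_group m_assoc)
      moreover have "h \<otimes> (inv h \<otimes> a) = a" using ab(1) y(1) by (simp add: inv_mult_cancel)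
      moreover have "inv h \<otimes> a \<in> H" using ab(1) y(1) by simp
      moreover have "inv h \<otimes> a \<in> K" unfolding e using ab(2) y(2) by simp
      ultimately show "z \<in> ?g ` (H \<inter> K)"
        unfolding ab(4) by (intro image_eqI[of _ _ "inv h \<otimes> a"]) auto
    qed (use y in \<open>auto simp: m_assoc inv_mult_cancel\<close>)
    moreover have "inj_on ?g (H \<inter> K)"
      using y by (auto simp: inj_on_def)
    ultimately show ?thesis by (simp add: card_image)
  qed
  then have "card (H \<times> K) = card (H <#> K) * card (H \<inter> K)"
    using card_eq_fibers[of "H \<times> K" ?f "card (H \<inter> K)"] H K by (simp add: im)
  then show ?thesis by (simp add: card_cartesian_product)
qed

lemma coprime_subgroup_Int:
  assumes "subgroup H G" "subgroup K G" "coprime (card H) (card K)"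
  shows "H \<inter> K = {\<one>}"
proof -
  have "card (H \<inter> K) dvd 1"
    using card_subgroup_dvd[OF subgroup_Int[OF assms(1,2)] assms(1)]
      card_subgroup_dvd[OF subgroup_Int[OF assms(1,2)] assms(2)] assms(3)
    by (metis Int_lower1 Int_lower2 coprime_def)
  then obtain x where "H \<inter> K = {x}" by (auto simp: card_1_singleton_iff)
  then show ?thesis
    using subgroup.one_closed[OF assms(1)] subgroup.one_closed[OF assms(2)] by auto
qed

lemma card_set_mult_coprime:
  assumes "subgroup H G" "subgroup K G" "coprime (card H) (card K)"
  shows "card (H <#> K) = card H * card K"
  using card_set_mult[OF assms(1,2)] coprime_subgroup_Int[OF assms] by simp

lemma subgroup_eqI_card:
  assumes "subgroup H G" "subgroup K G" "H \<subseteq> K" "card K dvd card H"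
  shows "H = K"
  using assms by (metis card_subset_eq card_subgroup_dvd dvd_antisym finite_subgroup)

text \<open>If one of \<open>X\<close>, \<open>Y\<close> normalizes the other, \<open>X <#> Y\<close> is a subgroup and \<open>|X : X \<inter> Y|\<close>
  divides \<open>|H : Y|\<close>.\<close>

lemma subset_of_coprime_index:
  assumes H: "subgroup H G" and X: "subgroup X G" "X \<subseteq> H" and Y: "subgroup Y G" "Y \<subseteq> H"
    and n: "normalizes X Y \<or> normalizes Y X"
    and c: "card H = card Y * m" "coprime (card X) m"
  shows "X \<subseteq> Y"
proof -
  have s: "subgroup (X <#> Y) G"
    using n set_mult_subgroupI[OF X(1) Y(1)] set_mult_subgroupI'[OF X(1) Y(1)] by blast
  have "card (X <#> Y) dvd card H"
    by (rule card_subgroup_dvd[OF s H set_mult_sub[OF H X(2) Y(2)]])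
  then have "card X * card Y dvd card Y * m * card (X \<inter> Y)"
    using card_set_mult[OF X(1) Y(1)] c(1) by (metis dvd_refl mult_dvd_mono)
  then have "card X dvd m * card (X \<inter> Y)"
    using card_subgroup_pos[OF Y(1)] by (simp add: mult.commute mult.left_commute)
  then have "card X dvd card (X \<inter> Y)"
    using c(2) coprime_dvd_mult_right_iff by blast
  then have "X \<inter> Y = X"
    by (intro subgroup_eqI_card[OF subgroup_Int[OF X(1) Y(1)] X(1)]) auto
  then show ?thesis by auto
qed

text \<open>A conjugate of M by an element of H stays in J and has order |M|, prime to |J : M|, so
  it falls into M. This is the argument that a normal Hall subgroup is characteristic, used to lift
  normality from J to H.\<close>

lemma normalizes_Hall_trans:
  assumes H: "subgroup H G" and J: "subgroup J G" "J \<subseteq> H" and M: "subgroup M G" "M \<subseteq> J"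
    and n: "normalizes H J" "normalizes J M" and c: "card J = card M * m" "coprime (card M) m"
  shows "normalizes H M"
proof (rule normalizesI)
  fix h k assume h: "h \<in> H" and k: "k \<in> M"
  have hc: "h \<in> carrier G" using subgroup_sub[OF H h] .
  have X: "subgroup (conj_by h ` M) G" using subgroup_conj_by[OF hc M(1)] .
  have "conj_by h ` M \<subseteq> J" using normalizesD[OF n(1) h] M(2) by auto
  then have "conj_by h ` M \<subseteq> M"
    using subset_of_coprime_index[OF J(1) X _ M] normalizes_mono[OF n(2)] c
      card_conj_by[OF hc subgroup.subset[OF M(1)]] by metis
  then show "conj_by h k \<in> M" using k by auto
qed

text \<open>The cofactor m may still be divisible by p, so every power of p dividing |H| occurs as
  the order of a subgroup, not only the full p-part. Subgroups of index p in a Sylow subgroup are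
  obtained this way.\<close>

lemma sylow_in:
  assumes "subgroup H G" "prime p" "p ^ a dvd card H"
  obtains S where "subgroup S G" "S \<subseteq> H" "card S = p ^ a"
proof -
  interpret H: group "G\<lparr>carrier := H\<rparr>" by (rule subgroup_imp_group[OF assms(1)])
  obtain m where "card H = p ^ a * m" using assms(3) by auto
  then obtain S where S: "subgroup S (G\<lparr>carrier := H\<rparr>)" "card S = p ^ a"
    using sylow_thm[OF assms(2) H.is_group, of a m] assms(1) by (auto simp: order_def)
  have "S \<subseteq> H" using subgroup.subset[OF S(1)] by simp
  then show ?thesis
    by (rule that[OF incl_subgroup[OF assms(1) S(1)] _ S(2)])
qed

text \<open>Meant for subgroups L, such as centralizers and intersections, about which one only
  knows that they contain a Sylow subgroup of J for each prime.\<close>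

lemma subgroup_eqI_p_parts:
  assumes "subgroup L G" "subgroup J G" "L \<subseteq> J"
    "\<And>p. prime p \<Longrightarrow> p dvd card J \<Longrightarrow> \<exists>S. subgroup S G \<and> S \<subseteq> L \<and> card S = p_part p (card J)"
  shows "L = J"
proof (rule subgroup_eqI_card[OF assms(1-3)])
  show "card J dvd card L"
  proof (rule dvd_if_p_parts_dvd[OF card_subgroup_pos[OF assms(2)]])
    fix p :: nat assume p: "prime p" "p dvd card J"
    obtain S where "subgroup S G" "S \<subseteq> L" "card S = p_part p (card J)"
      using assms(4)[OF p] by auto
    then show "p_part p (card J) dvd card L" using card_subgroup_dvd[OF _ assms(1)] by metis
  qed
qed

section \<open>Actions of p-groups\<close>

text \<open>Orbit-stabilizer counting: the fibres of \<open>a \<mapsto> f a e\<close> over the orbit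
  are the left cosets of the stabilizer \<open>?T\<close>. The action laws are stated at the single
  point e, so \<open>f\<close> can be any function.\<close>

lemma orbit_card_dvd:
  assumes S: "subgroup S G" and one: "f \<one> e = e"
    and act: "\<And>a b. a \<in> S \<Longrightarrow> b \<in> S \<Longrightarrow> f (a \<otimes> b) e = f a (f b e)"
  shows "card ((\<lambda>a. f a e) ` S) dvd card S"
proof -
  note [simp] = subgroup_sub[OF S] subgroup.m_inv_closed[OF S] subgroup.m_closed[OF S]
  let ?T = "{b\<in>S. f b e = e}"
  have "card {b\<in>S. f b e = y} = card ?T" if fy: "y \<in> (\<lambda>a. f a e) ` S" for y
  proof -
    obtain a where a: "a \<in> S" "y = f a e" using fy by auto
    have ia: "f (inv a) y = e"
      using act[of "inv a" a] a one by simp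
    have "{b\<in>S. f b e = y} = (\<lambda>b. a \<otimes> b) ` ?T"
    proof (intro subset_antisym subsetI)
      fix b assume b: "b \<in> {b\<in>S. f b e = y}"
      then have "f (inv a \<otimes> b) e = e" using act[of "inv a" b] a(1) ia by simp
      moreover have "b = a \<otimes> (inv a \<otimes> b)" using a(1) b by (simp add: inv_mult_cancel)
      ultimately show "b \<in> (\<lambda>b. a \<otimes> b) ` ?T"
        using a(1) b by (intro image_eqI[of _ _ "inv a \<otimes> b"]) auto
    next
      fix b assume "b \<in> (\<lambda>b. a \<otimes> b) ` ?T"
      then obtain t where "t \<in> S" "f t e = e" "b = a \<otimes> t" by auto
      then show "b \<in> {b\<in>S. f b e = y}" using a act[of a t] by simp
    qed
    moreover have "inj_on (\<lambda>b. a \<otimes> b) ?T" using a(1) by (auto simp: inj_on_def)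
    ultimately show ?thesis by (simp add: card_image)
  qed
  then have "card S = card ((\<lambda>a. f a e) ` S) * card ?T"
    by (rule card_eq_fibers[OF finite_subgroup[OF S]])
  then show ?thesis by simp
qed

text \<open>A nontrivial orbit has size a positive power of p and contains no fixed point, so
  removing it changes neither side; induct until only fixed points remain. Of the congruence |E| =
  |Fix| mod p just the divisibility by p is recorded.\<close>

lemma fixed_points_cong:
  assumes S: "subgroup S G" "card S = p ^ n" and p: "prime p" and E: "finite E"
    and cl: "\<And>a e. a \<in> S \<Longrightarrow> e \<in> E \<Longrightarrow> f a e \<in> E"
    and one: "\<And>e. e \<in> E \<Longrightarrow> f \<one> e = e"
    and act: "\<And>a b e. a \<in> S \<Longrightarrow> b \<in> S \<Longrightarrow> e \<in> E \<Longrightarrow> f (a \<otimes> b) e = f a (f b e)"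
  shows "p dvd card E \<longleftrightarrow> p dvd card {e\<in>E. \<forall>a\<in>S. f a e = e}"
  using E cl one act
proof (induction "card E" arbitrary: E rule: less_induct)
  case less
  note [simp] = subgroup_sub[OF S(1)] subgroup.m_inv_closed[OF S(1)] subgroup.m_closed[OF S(1)]
  show ?case
  proof (cases "\<forall>e\<in>E. \<forall>a\<in>S. f a e = e")
    case True
    then have "{e\<in>E. \<forall>a\<in>S. f a e = e} = E" by auto
    then show ?thesis by simp
  next
    case False
    then obtain e a0 where e: "e \<in> E" "a0 \<in> S" "f a0 e \<noteq> e" by auto
    let ?O = "(\<lambda>a. f a e) ` S"
    have O: "?O \<subseteq> E" using less.prems(2) e by auto
    have eO: "e \<in> ?O" using less.prems(3)[OF e(1)] subgroup.one_closed[OF S(1)] by force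
    have "card ?O dvd p ^ n"
      using orbit_card_dvd[OF S(1), of f e] less.prems e(1) S(2) by simp
    then obtain k where k: "card ?O = p ^ k" using divides_primepow_nat[OF p] by auto
    have "k \<noteq> 0"
    proof
      assume "k = 0"
      then have "card ?O = 1" using k by simp
      then obtain z where "?O = {z}" by (auto simp: card_1_singleton_iff)
      then show False using eO e imageI[OF e(2), of "\<lambda>a. f a e"] by auto
    qed
    then have pO: "p dvd card ?O" using k by simp
    have fO: "finite ?O" using O less.prems(1) finite_subset by blast
    have stab: "f b y \<in> ?O" if "b \<in> S" "y \<in> ?O" for b y
      using that less.prems(4)[of b _ e] e(1) by (force simp flip: less.prems(4))
    have cl: "f b y \<in> E - ?O" if "b \<in> S" "y \<in> E - ?O" for b y
    proof -
      have "f (inv b) (f b y) = y"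
        using less.prems(4)[of "inv b" b y] less.prems(3)[of y] that by simp
      then show ?thesis using stab[of "inv b" "f b y"] less.prems(2)[of b y] that by auto
    qed
    have "card (E - ?O) < card E"
      using eO e(1) less.prems(1) by (intro psubset_card_mono) auto
    then have IH: "p dvd card (E - ?O) \<longleftrightarrow> p dvd card {e\<in>E - ?O. \<forall>a\<in>S. f a e = e}"
      by (rule less.hyps) (use less.prems cl in auto)
    have "{e\<in>E - ?O. \<forall>a\<in>S. f a e = e} = {e\<in>E. \<forall>a\<in>S. f a e = e}"
    proof (intro subset_antisym subsetI)
      fix y assume y: "y \<in> {e\<in>E. \<forall>a\<in>S. f a e = e}"
      have "y \<notin> ?O"
      proof
        assume "y \<in> ?O"
        then obtain b where b: "b \<in> S" "y = f b e" by auto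
        have "e = f (inv b) y" using b less.prems(4)[of "inv b" b e] less.prems(3)[of e] e by simp
        then have "e = y" using y b by auto
        then show False using y e by auto
      qed
      then show "y \<in> {e\<in>E - ?O. \<forall>a\<in>S. f a e = e}" using y by auto
    qed auto
    moreover have "card E = card ?O + card (E - ?O)"
      using O fO less.prems(1) by (metis card_Diff_subset card_mono le_add_diff_inverse)
    ultimately show ?thesis using IH pO dvd_add_right_iff[of p "card ?O"] by simp
  qed
qed

end

section \<open>Left cosets and the p-groups acting on them\<close>

context group
begin

lemma conj_by_inv_eq: "x \<in> carrier G \<Longrightarrow> conj_by (inv x) s = inv x \<otimes> s \<otimes> x"
  by (simp add: conj_by_def)

lemma l_coset_eq_iff:
  assumes Y: "subgroup Y G" and x: "x \<in> carrier G" and y: "y \<in> carrier G"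
  shows "x <# Y = y <# Y \<longleftrightarrow> inv x \<otimes> y \<in> Y"
proof
  assume e: "x <# Y = y <# Y"
  have "y \<otimes> \<one> \<in> y <# Y" using subgroup.one_closed[OF Y] unfolding l_coset_def by blast
  then have "y \<in> x <# Y" using e y by simp
  then obtain h where "h \<in> Y" "y = x \<otimes> h" by (auto simp: l_coset_def)
  then show "inv x \<otimes> y \<in> Y" using x subgroup_sub[OF Y] by (simp add: inv_mult_cancel)
next
  have *: "u <# Y \<subseteq> v <# Y"
    if "u \<in> carrier G" "v \<in> carrier G" "inv v \<otimes> u \<in> Y" for u v
  proof
    fix z assume "z \<in> u <# Y"
    then obtain h where h: "h \<in> Y" "z = u \<otimes> h" by (auto simp: l_coset_def)
    have "z = v \<otimes> (inv v \<otimes> u \<otimes> h)"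
      using that(1,2) h subgroup_sub[OF Y] by (simp add: m_assoc inv_mult_cancel)
    then show "z \<in> v <# Y"
      using subgroup.m_closed[OF Y that(3) h(1)] by (auto simp: l_coset_def)
  qed
  assume "inv x \<otimes> y \<in> Y"
  moreover from this have "inv y \<otimes> x \<in> Y"
    using subgroup.m_inv_closed[OF Y, of "inv x \<otimes> y"] x y by (simp add: inv_mult_group)
  ultimately show "x <# Y = y <# Y" using *[OF x y] *[OF y x] by blast
qed

lemma inj_on_l_mult: "x \<in> carrier G \<Longrightarrow> Y \<subseteq> carrier G \<Longrightarrow> inj_on (\<lambda>h. x \<otimes> h) Y"
  by (auto simp: inj_on_def subset_iff)

lemma card_l_coset:
  assumes "x \<in> carrier G" "Y \<subseteq> carrier G" shows "card (x <# Y) = card Y"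
proof -
  have "x <# Y = (\<lambda>h. x \<otimes> h) ` Y" by (auto simp: l_coset_def)
  then show ?thesis using inj_on_l_mult[OF assms] by (simp add: card_image)
qed

end

context finite_group
begin

lemma card_l_cosets:
  assumes H: "subgroup H G" and Y: "subgroup Y G" "Y \<subseteq> H"
  shows "card H = card ((\<lambda>x. x <# Y) ` H) * card Y"
proof (rule card_eq_fibers[OF finite_subgroup[OF H]])
  fix e assume "e \<in> (\<lambda>x. x <# Y) ` H"
  then obtain y where y: "y \<in> H" "e = y <# Y" by auto
  have "{x\<in>H. x <# Y = e} = y <# Y"
  proof (intro subset_antisym subsetI)
    fix x assume "x \<in> {x\<in>H. x <# Y = e}"
    then have x: "x \<in> H" "y <# Y = x <# Y" using y by auto
    then have "inv y \<otimes> x \<in> Y" using l_coset_eq_iff[OF Y(1)] subgroup_sub[OF H] y by blast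
    moreover have "x = y \<otimes> (inv y \<otimes> x)" using x y subgroup_sub[OF H] by (simp add: inv_mult_cancel)
    ultimately show "x \<in> y <# Y" unfolding l_coset_def by blast
  next
    fix x assume "x \<in> y <# Y"
    then obtain h where h: "h \<in> Y" "x = y \<otimes> h" by (auto simp: l_coset_def)
    have xH: "x \<in> H" using h y Y(2) subgroup.m_closed[OF H] by auto
    have "inv y \<otimes> x = h" using h y subgroup_sub[OF H] subgroup_sub[OF Y(1)]
      by (simp add: inv_mult_cancel)
    then have "y <# Y = x <# Y"
      using l_coset_eq_iff[OF Y(1) subgroup_sub[OF H y(1)] subgroup_sub[OF H xH]] h by simp
    then show "x \<in> {x\<in>H. x <# Y = e}" using xH y by simp
  qed
  then show "card {x\<in>H. x <# Y = e} = card Y"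
    using card_l_coset[OF subgroup_sub[OF H y(1)] subgroup.subset[OF Y(1)]] by simp
qed

text \<open>S acts on H/Y by left multiplication, and x Y is fixed exactly when x^-1 S x lies in Y.
  If p does not divide the index m, a fixed coset must exist; if p divides m and S = Y, the fixed
  coset Y cannot be the only one.\<close>

lemma dvd_card_fixed_cosets:
  assumes H: "subgroup H G" and Y: "subgroup Y G" "Y \<subseteq> H" and S: "subgroup S G" "S \<subseteq> H"
    and p: "prime p" "card S = p ^ n" and m: "card H = card Y * m"
  shows "p dvd m \<longleftrightarrow> p dvd card ((\<lambda>x. x <# Y) ` {x\<in>H. \<forall>s\<in>S. conj_by (inv x) s \<in> Y})"
proof -
  let ?E = "(\<lambda>x. x <# Y) ` H"
  have Yc: "Y \<subseteq> carrier G" by (rule subgroup.subset[OF Y(1)])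
  have "m = card ?E"
    using m card_l_cosets[OF H Y] card_subgroup_pos[OF Y(1)] by (simp add: mult.commute)
  moreover have "p dvd card ?E \<longleftrightarrow> p dvd card {e\<in>?E. \<forall>a\<in>S. a <# e = e}"
  proof (rule fixed_points_cong[OF S(1) p(2,1)])
    show "finite ?E" using H by simp
    fix a e assume a: "a \<in> S" "e \<in> ?E"
    then obtain x where x: "x \<in> H" "e = x <# Y" by auto
    have "a <# e = (a \<otimes> x) <# Y"
      using a x S(2) subgroup_sub[OF H] Yc by (auto simp: lcos_m_assoc)
    then show "a <# e \<in> ?E" using a x S(2) subgroup.m_closed[OF H] by auto
  next
    fix e assume "e \<in> ?E"
    then show "\<one> <# e = e"
      using lcos_mult_one l_coset_subset_G[OF Yc] subgroup_sub[OF H] by auto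
  next
    fix a b e assume ab: "a \<in> S" "b \<in> S" "e \<in> ?E"
    then obtain x where x: "x \<in> H" "e = x <# Y" by auto
    show "(a \<otimes> b) <# e = a <# (b <# e)"
      using ab x(2) lcos_m_assoc[OF l_coset_subset_G[OF Yc subgroup_sub[OF H x(1)]]]
        subgroup_sub[OF S(1)] by simp
  qed
  moreover have "{e\<in>?E. \<forall>a\<in>S. a <# e = e} =
      (\<lambda>x. x <# Y) ` {x\<in>H. \<forall>s\<in>S. conj_by (inv x) s \<in> Y}"
  proof -
    have "a <# (x <# Y) = x <# Y \<longleftrightarrow> conj_by (inv x) a \<in> Y" if "a \<in> S" "x \<in> H" for a x
    proof -
      have c: "a \<in> carrier G" "x \<in> carrier G" using that S(2) subgroup_sub[OF H] by auto
      have "a <# (x <# Y) = x <# Y \<longleftrightarrow> x <# Y = (a \<otimes> x) <# Y"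
        using c Yc by (auto simp: lcos_m_assoc)
      also have "\<dots> \<longleftrightarrow> conj_by (inv x) a \<in> Y"
        using l_coset_eq_iff[OF Y(1), of x "a \<otimes> x"] c by (simp add: conj_by_inv_eq m_assoc)
      finally show ?thesis .
    qed
    then show ?thesis by blast
  qed
  ultimately show ?thesis by simp
qed

text \<open>The number of fixed cosets is not divisible by p, hence not zero. For a Sylow subgroup Y
  this is Sylow's conjugacy theorem, in the form that the Frattini argument uses.\<close>

lemma ex_conj_into:
  assumes "subgroup H G" "subgroup Y G" "Y \<subseteq> H" "subgroup S G" "S \<subseteq> H"
    and "prime p" "card S = p ^ n" "card H = card Y * m" "\<not> p dvd m"
  obtains x where "x \<in> H" "\<And>s. s \<in> S \<Longrightarrow> conj_by (inv x) s \<in> Y"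
proof -
  have "{x\<in>H. \<forall>s\<in>S. conj_by (inv x) s \<in> Y} \<noteq> {}"
    using dvd_card_fixed_cosets[OF assms(1-8)] assms(9)
    by (metis (no_types, lifting) card.empty dvd_0_right image_empty)
  then show ?thesis using that by blast
qed

text \<open>The number of fixed cosets of Y acting on H/Y is a multiple of p, and Y itself is one of
  them, so there is another. This is the growth of normalizers of p-subgroups.\<close>

lemma ex_outside_normalizing:
  assumes H: "subgroup H G" and Y: "subgroup Y G" "Y \<subseteq> H"
    and p: "prime p" "card Y = p ^ n" "card H = card Y * m" "p dvd m"
  obtains x where "x \<in> H" "x \<notin> Y" "\<And>y. y \<in> Y \<Longrightarrow> conj_by x y \<in> Y"
proof -
  let ?A = "{x\<in>H. \<forall>s\<in>Y. conj_by (inv x) s \<in> Y}"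
  have d: "p dvd card ((\<lambda>x. x <# Y) ` ?A)"
    using dvd_card_fixed_cosets[OF H Y Y p(1-3)] p(4) by simp
  have "\<exists>x\<in>?A. x \<notin> Y"
  proof (rule ccontr)
    assume "\<not> ?thesis"
    then have A: "?A \<subseteq> Y" by auto
    have "x <# Y = \<one> <# Y" if "x \<in> Y" for x
      using l_coset_eq_iff[OF Y(1), of x \<one>] that Y(1) subgroup_sub[OF Y(1)]
      by (simp add: subgroup.m_inv_closed)
    then have "(\<lambda>x. x <# Y) ` ?A \<subseteq> {\<one> <# Y}" using A by blast
    moreover have "\<one> \<in> ?A"
      using subgroup.one_closed[OF H] subgroup_sub[OF Y(1)] by (auto simp: conj_by_def)
    ultimately have "(\<lambda>x. x <# Y) ` ?A = {\<one> <# Y}" by blast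
    then have "p dvd 1" using d by simp
    then show False using p(1) by simp
  qed
  then obtain x where x: "x \<in> H" "x \<notin> Y" "\<forall>s\<in>Y. conj_by (inv x) s \<in> Y" by auto
  show ?thesis
  proof (rule that[of "inv x"])
    show "inv x \<in> H" using x H by (simp add: subgroup.m_inv_closed)
    show "inv x \<notin> Y"
      using x subgroup.m_inv_closed[OF Y(1), of "inv x"] subgroup_sub[OF H] by auto
  qed (use x in auto)
qed

text \<open>J acts on the p cosets in H/J and fixes J, so any other orbit has fewer than p elements.
  Its length divides |J|, whose prime factors are all at least p, so every coset is fixed by
  J.\<close>

lemma normalizes_if_smallest_prime_index:
  assumes H: "subgroup H G" and J: "subgroup J G" "J \<subseteq> H"
    and p: "prime p" "card H = card J * p" "\<And>q. prime q \<Longrightarrow> q dvd card H \<Longrightarrow> p \<le> q"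
  shows "normalizes H J"
proof (rule normalizesI)
  fix x j assume x: "x \<in> H" and j: "j \<in> J"
  note Hc = subgroup_sub[OF H] and Jc = subgroup_sub[OF J(1)]
  have Js: "J \<subseteq> carrier G" by (rule subgroup.subset[OF J(1)])
  show "conj_by x j \<in> J"
  proof (cases "x \<in> J")
    case True
    then show ?thesis using normalizesD[OF normalizes_self[OF J(1) subset_refl] True j] by simp
  next
    case False
    \<comment> \<open>The base point is the coset of \<open>inv x\<close>, not of x: that j fixes it
      then says that \<open>x \<otimes> j \<otimes> inv x\<close> lies in J.\<close>
    let ?E = "(\<lambda>x. x <# J) ` H" and ?e = "inv x <# J"
    let ?O = "(\<lambda>a. a <# ?e) ` J"
    have ix: "inv x \<in> H" using x H by (simp add: subgroup.m_inv_closed)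
    have a: "a <# ?e = (a \<otimes> inv x) <# J" if "a \<in> J" for a
      using that Jc Hc ix Js by (simp add: lcos_m_assoc)
    have cE: "card ?E = p"
      using p(2) card_l_cosets[OF H J] card_subgroup_pos[OF J(1)] by (simp add: mult.commute)
    have Osub: "?O \<subseteq> ?E - {\<one> <# J}"
    proof
      fix z assume "z \<in> ?O"
      then obtain a where aj: "a \<in> J" "z = (a \<otimes> inv x) <# J" using a by auto
      have "z \<noteq> \<one> <# J"
      proof
        assume "z = \<one> <# J"
        then have "inv \<one> \<otimes> (a \<otimes> inv x) \<in> J"
          using aj l_coset_eq_iff[OF J(1), of \<one> "a \<otimes> inv x"] Jc Hc ix by auto
        then have "a \<otimes> inv x \<in> J" using aj Jc Hc ix by simp
        then have "inv (a \<otimes> inv x) \<otimes> a \<in> J"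
          using aj J(1) by (simp add: subgroup.m_inv_closed subgroup.m_closed)
        then show False using False aj Jc Hc[OF x] by (simp add: inv_mult_group m_assoc)
      qed
      moreover have "z \<in> ?E" using aj J(2) ix subgroup.m_closed[OF H] by auto
      ultimately show "z \<in> ?E - {\<one> <# J}" by simp
    qed
    have "\<one> <# J \<in> ?E" using subgroup.one_closed[OF H] by blast
    moreover have "A \<subset> E" if "A \<subseteq> E - {z}" "z \<in> E" for A E :: "'a set set" and z using that by blast
    ultimately have "?O \<subset> ?E" using Osub by metis
    then have lt: "card ?O < p"
      using psubset_card_mono[of ?E ?O] H cE by simp
    have dv: "card ?O dvd card J"
    proof (rule orbit_card_dvd[OF J(1)])
      show "\<one> <# ?e = ?e" using lcos_mult_one[OF l_coset_subset_G[OF Js]] Hc ix by auto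
      show "(a \<otimes> b) <# ?e = a <# (b <# ?e)" if "a \<in> J" "b \<in> J" for a b
        using lcos_m_assoc[OF l_coset_subset_G[OF Js]] that Jc Hc ix by auto
    qed
    have "card ?O = 1"
    proof (rule ccontr)
      assume "card ?O \<noteq> 1"
      then obtain q where q: "prime q" "q dvd card ?O" using prime_factor_nat by blast
      have "?O \<noteq> {}" using subgroup.one_closed[OF J(1)] by blast
      then have "card ?O > 0" using J(1) by (simp add: card_gt_0_iff)
      then have "q \<le> card ?O" using q(2) dvd_imp_le by blast
      moreover have "q dvd card H" using q(2) dv p(2) by (simp add: dvd_trans)
      ultimately show False using p(3)[OF q(1)] lt by simp
    qed
    then obtain z where z: "?O = {z}" by (auto simp: card_1_singleton_iff)
    have "\<one> <# ?e \<in> ?O" "j <# ?e \<in> ?O" using j subgroup.one_closed[OF J(1)] by blast+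
    then have "\<one> <# ?e = j <# ?e" using z by simp
    then have "inv x <# J = (j \<otimes> inv x) <# J"
      using a[OF j] a[OF subgroup.one_closed[OF J(1)]] Hc ix by simp
    then have "x \<otimes> (j \<otimes> inv x) \<in> J"
      using l_coset_eq_iff[OF J(1), of "inv x" "j \<otimes> inv x"] Jc[OF j] Hc[OF x] by simp
    then show ?thesis using Jc[OF j] Hc[OF x] by (simp add: conj_by_def m_assoc)
  qed
qed

section \<open>Normal subgroups of prime index\<close>

text \<open>For an r-group R with r prime these W are the maximal subgroups of R, and their
  intersection is the Frattini subgroup. Actions on R modulo that intersection are studied through
  the single quotients R/W of order r.\<close>

definition normal_of_index :: "nat \<Rightarrow> 'a set \<Rightarrow> 'a set \<Rightarrow> bool" where
  "normal_of_index r R W \<longleftrightarrow>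
    subgroup W G \<and> W \<subseteq> R \<and> normalizes R W \<and> card R = card W * r"

lemma subgroup_normalizing:
  assumes R: "subgroup R G" and W: "subgroup W G"
  shows "subgroup {x\<in>R. \<forall>w\<in>W. conj_by x w \<in> W} G" (is "subgroup ?N G")
proof
  note Rc = subgroup_sub[OF R] and Wc = subgroup_sub[OF W]
  show "?N \<subseteq> carrier G" using Rc by auto
  show "\<one> \<in> ?N" using Wc subgroup.one_closed[OF R] by simp
  show "x \<otimes> y \<in> ?N" if "x \<in> ?N" "y \<in> ?N" for x y
    using that Rc Wc subgroup.m_closed[OF R] by (simp add: conj_by_conj_by)
  fix x assume x: "x \<in> ?N"
  \<comment> \<open>The defining condition is one-sided; finiteness of W makes conjugation by x a
    permutation of W, and the condition then passes to \<open>inv x\<close>.\<close>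
  have "conj_by x ` W = W"
  proof (rule card_subset_eq)
    show "finite W" using W by simp
    show "conj_by x ` W \<subseteq> W" using x by auto
    show "card (conj_by x ` W) = card W" using x Rc card_conj_by subgroup.subset[OF W] by auto
  qed
  moreover have "conj_by (inv x) ` conj_by x ` W = W"
    unfolding image_image using x Rc Wc by simp
  ultimately have "conj_by (inv x) ` W = W" by simp
  then show "inv x \<in> ?N" using x R by (auto simp: subgroup.m_inv_closed)
qed

lemma ex_maximal_proper_subgroup:
  assumes "subgroup C G" "C \<subset> R" "subgroup R G"
  obtains W where "subgroup W G" "C \<subseteq> W" "W \<subset> R"
    "\<And>X. subgroup X G \<Longrightarrow> W \<subset> X \<Longrightarrow> X \<subseteq> R \<Longrightarrow> X = R"
proof -
  let ?A = "{W. subgroup W G \<and> C \<subseteq> W \<and> W \<subset> R}"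
  have "finite ?A" using finite_subgroup[OF assms(3)] by (rule_tac finite_subset[of _ "Pow R"]) auto
  moreover have "C \<in> ?A" using assms by auto
  ultimately obtain W where W: "W \<in> ?A" "\<And>X. X \<in> ?A \<Longrightarrow> W \<subseteq> X \<Longrightarrow> W = X"
    using finite_has_maximal[of ?A] by (metis (lifting) empty_iff)
  show ?thesis
  proof (rule that[of W])
    fix X assume X: "subgroup X G" "W \<subset> X" "X \<subseteq> R"
    show "X = R"
    proof (rule ccontr)
      assume "X \<noteq> R"
      then have "X \<in> ?A" using X W(1) by auto
      then show False using W(2) X by blast
    qed
  qed (use W in auto)
qed

text \<open>A maximal proper W above C is normal because its normalizer in R is strictly larger. The
  index is computed with an auxiliary Y satisfying Y W = R and |Y : Y \<inter> W| = r.\<close>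

lemma ex_normal_of_index:
  assumes r: "prime r" and R: "subgroup R G" "card R = r ^ n" and C: "subgroup C G" "C \<subset> R"
  obtains W where "normal_of_index r R W" "C \<subseteq> W"
proof -
  obtain W where W: "subgroup W G" "C \<subseteq> W" "W \<subset> R"
    and mx: "\<And>X. subgroup X G \<Longrightarrow> W \<subset> X \<Longrightarrow> X \<subseteq> R \<Longrightarrow> X = R"
    using ex_maximal_proper_subgroup[OF C R(1)] by blast
  obtain m where m: "card R = card W * m"
    using card_subgroup_dvd[OF W(1) R(1)] W(3) by (auto elim: dvdE)
  have wk: "card W dvd r ^ n" using m R(2) by simp
  then obtain k where k: "card W = r ^ k" using divides_primepow_nat[OF r] by auto
  have "m dvd r ^ n" using m R(2) by simp
  then obtain l where l: "m = r ^ l" using divides_primepow_nat[OF r] by auto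
  have "m \<noteq> 1" using W(3) m R(1) finite_subgroup by (metis mult.right_neutral psubset_card_mono less_irrefl)
  then have rm: "r dvd m" using l by (cases l) auto
  obtain x where x: "x \<in> R" "x \<notin> W" "\<And>y. y \<in> W \<Longrightarrow> conj_by x y \<in> W"
    using ex_outside_normalizing[OF R(1) W(1) _ r k m rm] W(3) by auto
  let ?N = "{x\<in>R. \<forall>w\<in>W. conj_by x w \<in> W}"
  have "W \<subset> ?N"
    using x W(3) normalizesD[OF normalizes_self[OF W(1) subset_refl]] by auto
  then have "?N = R" using mx[OF subgroup_normalizing[OF R(1) W(1)]] by auto
  then have nm: "normalizes R W" by (auto simp: normalizes_def)
  \<comment> \<open>A minimal Y not inside W has all its proper subgroups inside W, in particular
    one of index r in Y; so \<open>Y \<inter> W\<close> has index r in Y, while Y W = R by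
    maximality of W.\<close>
  let ?A = "{Y. subgroup Y G \<and> Y \<subseteq> R \<and> \<not> Y \<subseteq> W}"
  have "finite ?A" using finite_subgroup[OF R(1)] by (rule_tac finite_subset[of _ "Pow R"]) auto
  moreover have "R \<in> ?A" using R W by auto
  ultimately obtain Y where Y: "Y \<in> ?A" "\<And>X. X \<in> ?A \<Longrightarrow> X \<subseteq> Y \<Longrightarrow> Y = X"
    using finite_has_minimal[of ?A] by (metis (lifting) empty_iff)
  have Ys: "subgroup Y G" "Y \<subseteq> R" "\<not> Y \<subseteq> W" using Y(1) by auto
  have "card Y dvd r ^ n" using card_subgroup_dvd[OF Ys(1) R(1) Ys(2)] R(2) by simp
  then obtain a where a: "card Y = r ^ a" using divides_primepow_nat[OF r] by auto
  have "a \<noteq> 0"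
  proof
    assume "a = 0"
    then have "card Y = 1" using a by simp
    then have "Y = {\<one>}" using subgroup.one_closed[OF Ys(1)] by (auto simp: card_1_singleton_iff)
    then show False using Ys(3) subgroup.one_closed[OF W(1)] by auto
  qed
  then obtain b where b: "a = Suc b" by (cases a) auto
  then have "r ^ b dvd card Y" using a by simp
  then obtain V where V: "subgroup V G" "V \<subseteq> Y" "card V = r ^ b"
    using sylow_in[OF Ys(1) r] by blast
  have "V \<noteq> Y" using V(3) a b r by (metis prime_gt_1_nat nat_neq_iff power_inject_exp n_not_Suc_n)
  then have VW: "V \<subseteq> W" using Y(2)[of V] V Ys by auto
  have I: "subgroup (Y \<inter> W) G" using subgroup_Int Ys W by blast
  have "card V dvd card (Y \<inter> W)" using card_subgroup_dvd[OF V(1) I] V VW by auto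
  then obtain c where c: "card (Y \<inter> W) = r ^ b * c" using V(3) by auto
  have "card (Y \<inter> W) dvd card Y" using card_subgroup_dvd[OF I Ys(1)] by simp
  then have "c dvd r" using c a b r by (simp add: mult.commute prime_gt_0_nat)
  moreover have "c \<noteq> r"
  proof
    assume "c = r"
    then have "card (Y \<inter> W) = card Y" using a b c by simp
    then have "Y \<inter> W = Y" using card_subset_eq[of Y "Y \<inter> W"] Ys by simp
    then show False using Ys by auto
  qed
  ultimately have "c = 1" using r prime_nat_iff by blast
  then have cI: "card (Y \<inter> W) = r ^ b" using c by simp
  have nY: "normalizes Y W" using normalizes_mono[OF nm Ys(2)] .
  have YW: "subgroup (Y <#> W) G" using set_mult_subgroupI[OF Ys(1) W(1) nY] .
  have "Y <#> W \<subseteq> R" using set_mult_sub[OF R(1) Ys(2)] W(3) by auto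
  moreover have "W \<subset> Y <#> W"
    using sub_set_mult_right[OF Ys(1) W(1)] sub_set_mult_left[OF Ys(1) W(1)] Ys(3) by auto
  ultimately have "Y <#> W = R" using mx[OF YW] by auto
  then have "card R * r ^ b = r ^ b * r * card W"
    using card_set_mult[OF Ys(1) W(1)] cI a b by simp
  then have "card R = card W * r" using r prime_gt_0_nat[OF r] by simp
  then show ?thesis
    using that[of W] W nm by (auto simp: normal_of_index_def)
qed

section \<open>Actions on a quotient of prime order\<close>

lemma quotient_of_index:
  assumes NI: "normal_of_index r R W" and R: "subgroup R G"
  obtains Q :: "'a set monoid" and \<pi> where "group_hom (G\<lparr>carrier := R\<rparr>) Q \<pi>" "order Q = r"
    "\<And>x y. x \<in> R \<Longrightarrow> y \<in> R \<Longrightarrow> \<pi> x = \<pi> y \<longleftrightarrow> x \<otimes> inv y \<in> W"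
proof -
  have W: "subgroup W G" "W \<subseteq> R" "normalizes R W" "card R = card W * r"
    using NI by (auto simp: normal_of_index_def)
  let ?R = "G\<lparr>carrier := R\<rparr>"
  interpret R: group ?R by (rule subgroup_imp_group[OF R])
  have sW: "subgroup W ?R" by (rule subgroup_incl[OF W(1) R W(2)])
  have "W \<lhd> ?R"
  proof (rule R.normal_invI[OF sW])
    fix x h assume "x \<in> carrier ?R" "h \<in> W"
    then show "x \<otimes>\<^bsub>?R\<^esub> h \<otimes>\<^bsub>?R\<^esub> inv\<^bsub>?R\<^esub> x \<in> W"
      using normalizesD[OF W(3)] R by (simp add: conj_by_def)
  qed
  then interpret N: normal W ?R .
  have g: "group_hom ?R (?R Mod W) (\<lambda>x. W #>\<^bsub>?R\<^esub> x)"
    using N.factorgroup_is_group N.r_coset_hom_Mod R.is_group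
    by (simp add: group_hom_def group_hom_axioms_def)
  have "card (rcosets\<^bsub>?R\<^esub> W) * card W = card W * r"
    using R.lagrange[OF sW] W(4) by (simp add: order_def)
  then have o: "order (?R Mod W) = r"
    using card_subgroup_pos[OF W(1)] by (simp add: order_def FactGroup_def)
  have "(W #>\<^bsub>?R\<^esub> x) = (W #>\<^bsub>?R\<^esub> y) \<longleftrightarrow> x \<otimes> inv y \<in> W" if xy: "x \<in> R" "y \<in> R" for x y
  proof
    note Rc = subgroup_sub[OF R] and Wc = subgroup_sub[OF W(1)]
    {
      assume "(W #>\<^bsub>?R\<^esub> x) = (W #>\<^bsub>?R\<^esub> y)"
      then have "x \<in> W #>\<^bsub>?R\<^esub> y" using R.rcos_self[OF _ sW, of x] xy by simp
      then obtain w where "w \<in> W" "x = w \<otimes> y" by (auto simp: r_coset_def)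
      then show "x \<otimes> inv y \<in> W" using xy Rc Wc by (simp add: m_assoc)
    next
      assume a: "x \<otimes> inv y \<in> W"
      have "x = (x \<otimes> inv y) \<otimes> y" using xy Rc by (simp add: m_assoc)
      then have "x \<in> W #>\<^bsub>?R\<^esub> y" using a by (auto simp: r_coset_def)
      then show "(W #>\<^bsub>?R\<^esub> x) = (W #>\<^bsub>?R\<^esub> y)"
        using R.repr_independence[OF _ _ sW, of x y] xy by simp
    }
  qed
  then show ?thesis using that[OF g o] by simp
qed

lemma prime_order_generated:
  assumes "prime (order G)" "y \<in> carrier G" "y \<noteq> \<one>" "x \<in> carrier G"
  obtains k :: int where "x = y [^] k"
proof -
  have s: "subgroup (generate G {y}) G" using generate_is_subgroup assms by simp
  have "card (generate G {y}) dvd order G"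
    using card_subgroup_dvd[OF s subgroup_self subgroup.subset[OF s]] by (simp add: order_def)
  moreover have "card (generate G {y}) \<noteq> 1"
    using generate.incl[of y "{y}" G] generate.one[of G "{y}"] assms(3)
    by (auto simp: card_1_singleton_iff)
  ultimately have "card (generate G {y}) = card (carrier G)"
    using assms(1) by (auto simp: prime_nat_iff order_def)
  then have "generate G {y} = carrier G"
    using card_subset_eq[OF finite_carrier subgroup.subset[OF s]] by simp
  then show ?thesis using generate_pow[OF assms(2)] assms(4) that by auto
qed

lemma ex_outside_of_index:
  assumes "normal_of_index r R W" "prime r" "subgroup R G"
  obtains y where "y \<in> R" "y \<notin> W"
proof -
  have "W \<subseteq> R" "card R = card W * r" "card R > 0"
    using assms(1) card_subgroup_pos[OF assms(3)] by (auto simp: normal_of_index_def)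
  moreover have "r \<noteq> 1" using assms(2) by auto
  ultimately have "W \<noteq> R" by auto
  then show ?thesis using \<open>W \<subseteq> R\<close> that by auto
qed

lemma conj_by_int_pow:
  "a \<in> carrier G \<Longrightarrow> x \<in> carrier G \<Longrightarrow> conj_by a (x [^] (k::int)) = conj_by a x [^] k"
  using group_hom.hom_int_pow[of G G "conj_by a" x k] conj_by_hom is_group
  by (simp add: group_hom_def group_hom_axioms_def)

text \<open>Automorphisms of a group of prime order are power maps.\<close>

lemma conj_by_is_power_mod:
  assumes NI: "normal_of_index r R W" and R: "subgroup R G" and r: "prime r"
    and \<pi>: "group_hom (G\<lparr>carrier := R\<rparr>) Q \<pi>" "order Q = r"
      "\<And>x y. x \<in> R \<Longrightarrow> y \<in> R \<Longrightarrow> \<pi> x = \<pi> y \<longleftrightarrow> x \<otimes> inv y \<in> W"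
    and a: "a \<in> carrier G" "normalizes {a} R" "normalizes {a} W"
  obtains i :: int where "\<And>x. x \<in> R \<Longrightarrow> \<pi> (conj_by a x) = \<pi> x [^]\<^bsub>Q\<^esub> i"
proof -
  have W: "subgroup W G" "W \<subseteq> R" "normalizes R W" "card R = card W * r"
    using NI by (auto simp: normal_of_index_def)
  note Rc = subgroup_sub[OF R] and Wc = subgroup_sub[OF W(1)]
  let ?R = "G\<lparr>carrier := R\<rparr>"
  interpret \<pi>: group_hom ?R Q \<pi> by fact
  interpret Q: finite_group Q
    by unfold_locales (metis \<pi>(2) card_eq_0_iff finite.emptyI not_prime_0 order_def r)
  have pow: "x [^]\<^bsub>?R\<^esub> k = x [^] k" if "x \<in> R" for x and k :: int
    using int_pow_consistent[OF R that] by simp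
  have pR: "x [^] k \<in> R" if "x \<in> R" for x and k :: int
    using subgroup_int_pow_closed[OF R that] .
  have \<pi>pow: "\<pi> (x [^] k) = \<pi> x [^]\<^bsub>Q\<^esub> k" if "x \<in> R" for x and k :: int
    using \<pi>.hom_int_pow[of x k] that pow by simp
  have \<pi>c: "\<pi> x \<in> carrier Q" if "x \<in> R" for x using \<pi>.hom_closed[of x] that by simp
  obtain y where y: "y \<in> R" "y \<notin> W" using ex_outside_of_index[OF NI r R] .
  have "\<pi> y \<noteq> \<pi> \<one>" using y \<pi>(3)[of y \<one>] subgroup.one_closed[OF R] Rc by simp
  then have y1: "\<pi> y \<noteq> \<one>\<^bsub>Q\<^esub>" using \<pi>.hom_one by simp
  have gen: "\<exists>k::int. z = \<pi> y [^]\<^bsub>Q\<^esub> k" if "z \<in> carrier Q" for z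
    using Q.prime_order_generated[of "\<pi> y" z] r \<pi>(2) \<pi>c y y1 that by metis
  have aR: "conj_by a x \<in> R" if "x \<in> R" for x using normalizesD[OF a(2) _ that] by simp
  obtain i where i: "\<pi> (conj_by a y) = \<pi> y [^]\<^bsub>Q\<^esub> (i::int)" using gen \<pi>c aR y by blast
  show ?thesis
  proof (rule that[of i])
    fix x assume x: "x \<in> R"
    obtain k where k: "\<pi> x = \<pi> y [^]\<^bsub>Q\<^esub> (k::int)" using gen \<pi>c x by blast
    then have "\<pi> x = \<pi> (y [^] k)" using \<pi>pow y by simp
    then have "x \<otimes> inv (y [^] k) \<in> W" using \<pi>(3) x pR y by simp
    then have "conj_by a (x \<otimes> inv (y [^] k)) \<in> W" using normalizesD[OF a(3)] by simp
    then have "conj_by a x \<otimes> inv (conj_by a y [^] k) \<in> W"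
      using Rc x y a by (simp add: conj_by_mult conj_by_inv conj_by_int_pow)
    then have "\<pi> (conj_by a x) = \<pi> (conj_by a y [^] k)"
      using \<pi>(3) aR x y pR by simp
    also have "\<dots> = (\<pi> y [^]\<^bsub>Q\<^esub> i) [^]\<^bsub>Q\<^esub> k" using \<pi>pow aR y i by simp
    also have "\<dots> = (\<pi> y [^]\<^bsub>Q\<^esub> k) [^]\<^bsub>Q\<^esub> i"
      using \<pi>c y by (simp add: \<pi>.H.int_pow_pow mult.commute)
    finally show "\<pi> (conj_by a x) = \<pi> x [^]\<^bsub>Q\<^esub> i" using k by simp
  qed
qed

text \<open>The element \<open>conj_by g x \<otimes> inv x\<close> is the commutator [g, x]. When W
  is normal in R, this expresses that S acts trivially on R/W without forming the quotient.\<close>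

definition trivial_mod :: "'a set \<Rightarrow> 'a set \<Rightarrow> 'a set \<Rightarrow> bool" where
  "trivial_mod S R W \<longleftrightarrow> (\<forall>g\<in>S. \<forall>x\<in>R. conj_by g x \<otimes> inv x \<in> W)"

text \<open>Each element of K acts on R/W as a power map, and power maps commute, so commutators of
  K act trivially. The elements acting trivially form a subgroup, hence contain all of
  \<open>derived G K\<close>.\<close>

lemma derived_trivial_mod:
  assumes NI: "normal_of_index r R W" and R: "subgroup R G" and r: "prime r"
    and K: "subgroup K G" "normalizes K R" "normalizes K W"
  shows "trivial_mod (derived G K) R W"
proof -
  have W: "subgroup W G" "W \<subseteq> R" "normalizes R W" "card R = card W * r"
    using NI by (auto simp: normal_of_index_def)
  note Rc = subgroup_sub[OF R] and Wc = subgroup_sub[OF W(1)] and Kc = subgroup_sub[OF K(1)]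
  obtain Q :: "'a set monoid" and \<pi> where \<pi>: "group_hom (G\<lparr>carrier := R\<rparr>) Q \<pi>" "order Q = r"
    "\<And>x y. x \<in> R \<Longrightarrow> y \<in> R \<Longrightarrow> \<pi> x = \<pi> y \<longleftrightarrow> x \<otimes> inv y \<in> W"
    using quotient_of_index[OF NI R] by blast
  interpret \<pi>: group_hom "G\<lparr>carrier := R\<rparr>" Q \<pi> by fact
  have \<pi>c: "\<pi> x \<in> carrier Q" if "x \<in> R" for x using \<pi>.hom_closed[of x] that by simp
  have aR: "conj_by a x \<in> R" if "a \<in> K" "x \<in> R" for a x using normalizesD[OF K(2) that] .
  let ?A = "{a\<in>K. \<forall>x\<in>R. \<pi> (conj_by a x) = \<pi> x}"
  have "subgroup ?A G"
  proof
    show "?A \<subseteq> carrier G" using Kc by auto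
    show "\<one> \<in> ?A" using subgroup.one_closed[OF K(1)] Rc by simp
    fix a assume a: "a \<in> ?A"
    have iK: "inv a \<in> K" using a K(1) by (simp add: subgroup.m_inv_closed)
    have "\<pi> (conj_by (inv a) x) = \<pi> x" if x: "x \<in> R" for x
    proof -
      have "conj_by (inv a) x \<in> R" using aR[OF iK x] .
      then have "\<pi> (conj_by a (conj_by (inv a) x)) = \<pi> (conj_by (inv a) x)" using a by simp
      then show ?thesis using a x Kc Rc by simp
    qed
    then show "inv a \<in> ?A" using iK by simp
    fix b assume b: "b \<in> ?A"
    then show "a \<otimes> b \<in> ?A"
      using a subgroup.m_closed[OF K(1)] Kc Rc aR by (simp add: conj_by_conj_by)
  qed
  moreover have "a \<otimes> b \<otimes> inv a \<otimes> inv b \<in> ?A" if ab: "a \<in> K" "b \<in> K" for a b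
  proof -
    let ?c = "a \<otimes> b \<otimes> inv a \<otimes> inv b"
    have c: "?c \<in> K" using ab K(1) by (simp add: subgroup.m_closed subgroup.m_inv_closed)
    have n: "normalizes {a} R" "normalizes {a} W" "normalizes {b} R" "normalizes {b} W"
      using ab K normalizes_mono by auto
    obtain i where i: "\<And>x. x \<in> R \<Longrightarrow> \<pi> (conj_by a x) = \<pi> x [^]\<^bsub>Q\<^esub> (i::int)"
      using conj_by_is_power_mod[OF NI R r \<pi> _ n(1,2)] Kc ab by metis
    obtain j where j: "\<And>x. x \<in> R \<Longrightarrow> \<pi> (conj_by b x) = \<pi> x [^]\<^bsub>Q\<^esub> (j::int)"
      using conj_by_is_power_mod[OF NI R r \<pi> _ n(3,4)] Kc ab by metis
    have "\<pi> (conj_by ?c x) = \<pi> x" if x: "x \<in> R" for x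
    proof -
      \<comment> \<open>Chosen so that x is y moved by a and then b, while the commutator moves x to
        y moved by b and then a. Commuting the two power maps identifies the images.\<close>
      define y where "y = conj_by (inv a) (conj_by (inv b) x)"
      have y: "y \<in> R" using x ab aR K(1) by (simp add: y_def subgroup.m_inv_closed)
      have 1: "conj_by ?c x = conj_by a (conj_by b y)"
        using ab Kc x Rc by (simp add: y_def conj_by_conj_by m_assoc)
      have 2: "x = conj_by b (conj_by a y)"
        using ab Kc x Rc by (simp add: y_def)
      have "\<pi> (conj_by ?c x) = (\<pi> y [^]\<^bsub>Q\<^esub> j) [^]\<^bsub>Q\<^esub> i"
        unfolding 1 using i j aR ab y by simp
      also have "\<dots> = (\<pi> y [^]\<^bsub>Q\<^esub> i) [^]\<^bsub>Q\<^esub> j"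
        using \<pi>c y by (simp add: \<pi>.H.int_pow_pow mult.commute)
      also have "\<dots> = \<pi> (conj_by b (conj_by a y))" using i j aR ab y by simp
      finally show ?thesis unfolding 2[symmetric] .
    qed
    then show ?thesis using c by simp
  qed
  ultimately have "derived G K \<subseteq> ?A"
    unfolding derived_def by (intro generate_subgroup_incl) auto
  then show ?thesis
    using \<pi>(3) aR by (auto simp: trivial_mod_def subset_iff)
qed

text \<open>R/W has prime order, so it is generated by any image other than the identity and is
  abelian.\<close>

lemma trivial_mod_self:
  assumes NI: "normal_of_index r R W" and R: "subgroup R G" and r: "prime r"
  shows "trivial_mod R R W"
  unfolding trivial_mod_def
proof (intro ballI)
  have W: "subgroup W G" "W \<subseteq> R" "normalizes R W" "card R = card W * r"
    using NI by (auto simp: normal_of_index_def)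
  note Rc = subgroup_sub[OF R]
  obtain Q :: "'a set monoid" and \<pi> where \<pi>: "group_hom (G\<lparr>carrier := R\<rparr>) Q \<pi>" "order Q = r"
    "\<And>x y. x \<in> R \<Longrightarrow> y \<in> R \<Longrightarrow> \<pi> x = \<pi> y \<longleftrightarrow> x \<otimes> inv y \<in> W"
    using quotient_of_index[OF NI R] by blast
  interpret \<pi>: group_hom "G\<lparr>carrier := R\<rparr>" Q \<pi> by fact
  interpret Q: finite_group Q
    by unfold_locales (metis \<pi>(2) card_eq_0_iff finite.emptyI not_prime_0 order_def r)
  have \<pi>c: "\<pi> x \<in> carrier Q" if "x \<in> R" for x using \<pi>.hom_closed[of x] that by simp
  have \<pi>m: "\<pi> (x \<otimes> y) = \<pi> x \<otimes>\<^bsub>Q\<^esub> \<pi> y" if "x \<in> R" "y \<in> R" for x y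
    using \<pi>.hom_mult[of x y] that by simp
  fix g x assume g: "g \<in> R" and x: "x \<in> R"
  have gxR: "g \<otimes> x \<in> R" "x \<otimes> g \<in> R" using g x R by (auto intro: subgroup.m_closed)
  show "conj_by g x \<otimes> inv x \<in> W"
  proof (cases "\<pi> x = \<one>\<^bsub>Q\<^esub>")
    case True
    have "\<pi> (g \<otimes> x) = \<pi> (x \<otimes> g)" using True \<pi>m g x \<pi>c by simp
    then have "(g \<otimes> x) \<otimes> inv (x \<otimes> g) \<in> W" using \<pi>(3) gxR by simp
    then show ?thesis using g x Rc by (simp add: conj_by_def inv_mult_group m_assoc)
  next
    case False
    obtain k :: int where k: "\<pi> g = \<pi> x [^]\<^bsub>Q\<^esub> k"
      using Q.prime_order_generated[of "\<pi> x" "\<pi> g"] r \<pi>(2) \<pi>c g x False by metis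
    have "\<pi> (g \<otimes> x) = \<pi> (x \<otimes> g)"
      using \<pi>m g x k \<pi>.H.int_pow_mult[of "\<pi> x" k 1] \<pi>.H.int_pow_mult[of "\<pi> x" 1 k] \<pi>c
      by (simp add: add.commute)
    then have "(g \<otimes> x) \<otimes> inv (x \<otimes> g) \<in> W" using \<pi>(3) gxR by simp
    then show ?thesis using g x Rc by (simp add: conj_by_def inv_mult_group m_assoc)
  qed
qed

lemma pow_index_mem:
  assumes NI: "normal_of_index r R W" and R: "subgroup R G" and x: "x \<in> R"
  shows "x [^] r \<in> W"
proof -
  obtain Q :: "'a set monoid" and \<pi> where \<pi>: "group_hom (G\<lparr>carrier := R\<rparr>) Q \<pi>" "order Q = r"
    "\<And>x y. x \<in> R \<Longrightarrow> y \<in> R \<Longrightarrow> \<pi> x = \<pi> y \<longleftrightarrow> x \<otimes> inv y \<in> W"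
    using quotient_of_index[OF NI R] by blast
  interpret \<pi>: group_hom "G\<lparr>carrier := R\<rparr>" Q \<pi> by fact
  have "\<pi> (x [^]\<^bsub>G\<lparr>carrier := R\<rparr>\<^esub> r) = \<pi> x [^]\<^bsub>Q\<^esub> order Q"
    using \<pi>.hom_nat_pow[of x r] x \<pi>(2) by simp
  also have "\<dots> = \<one>\<^bsub>Q\<^esub>"
    using \<pi>.H.pow_order_eq_1[of "\<pi> x"] \<pi>.hom_closed[of x] x by simp
  finally have "\<pi> (x [^] r) = \<pi> \<one>" using \<pi>.hom_one nat_pow_consistent[of x r R] by simp
  moreover have "x [^] r \<in> R"
    using subgroup_int_pow_closed[OF R x, of "int r"] by (simp add: int_pow_int)
  ultimately have "x [^] r \<otimes> inv \<one> \<in> W" using \<pi>(3) subgroup.one_closed[OF R] by blast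
  then show ?thesis using subgroup_sub[OF R x] by simp
qed

text \<open>The element y maps to a generator of R/W, and a acts as a power map; fixing one
  generator, it fixes all its powers.\<close>

lemma trivial_mod_if_one_point:
  assumes NI: "normal_of_index r R W" and R: "subgroup R G" and r: "prime r"
    and a: "a \<in> carrier G" "normalizes {a} R" "normalizes {a} W"
    and y: "y \<in> R" "y \<notin> W" "conj_by a y \<otimes> inv y \<in> W"
  shows "trivial_mod {a} R W"
proof -
  note Rc = subgroup_sub[OF R]
  obtain Q :: "'a set monoid" and \<pi> where \<pi>: "group_hom (G\<lparr>carrier := R\<rparr>) Q \<pi>" "order Q = r"
    "\<And>x y. x \<in> R \<Longrightarrow> y \<in> R \<Longrightarrow> \<pi> x = \<pi> y \<longleftrightarrow> x \<otimes> inv y \<in> W"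
    using quotient_of_index[OF NI R] by blast
  interpret \<pi>: group_hom "G\<lparr>carrier := R\<rparr>" Q \<pi> by fact
  interpret Q: finite_group Q
    by unfold_locales (metis \<pi>(2) card_eq_0_iff finite.emptyI not_prime_0 order_def r)
  have \<pi>c: "\<pi> x \<in> carrier Q" if "x \<in> R" for x using \<pi>.hom_closed[of x] that by simp
  have aR: "conj_by a x \<in> R" if "x \<in> R" for x using normalizesD[OF a(2) _ that] by simp
  have "\<pi> y \<noteq> \<pi> \<one>" using y \<pi>(3)[of y \<one>] subgroup.one_closed[OF R] Rc by simp
  then have y1: "\<pi> y \<noteq> \<one>\<^bsub>Q\<^esub>" using \<pi>.hom_one by simp
  obtain i where i: "\<And>x. x \<in> R \<Longrightarrow> \<pi> (conj_by a x) = \<pi> x [^]\<^bsub>Q\<^esub> (i::int)"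
    using conj_by_is_power_mod[OF NI R r \<pi> a] by metis
  have yi: "\<pi> y [^]\<^bsub>Q\<^esub> i = \<pi> y" using i[OF y(1)] \<pi>(3)[OF aR[OF y(1)] y(1)] y(3) by simp
  have "conj_by a x \<otimes> inv x \<in> W" if x: "x \<in> R" for x
  proof -
    obtain k :: int where k: "\<pi> x = \<pi> y [^]\<^bsub>Q\<^esub> k"
      using Q.prime_order_generated[of "\<pi> y" "\<pi> x"] r \<pi>(2) \<pi>c x y y1 by metis
    have "\<pi> (conj_by a x) = (\<pi> y [^]\<^bsub>Q\<^esub> k) [^]\<^bsub>Q\<^esub> i" using i x k by simp
    also have "\<dots> = (\<pi> y [^]\<^bsub>Q\<^esub> i) [^]\<^bsub>Q\<^esub> k"
      using \<pi>c y by (simp add: \<pi>.H.int_pow_pow mult.commute)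
    also have "\<dots> = \<pi> x" using yi k by simp
    finally show ?thesis using \<pi>(3) aR x by simp
  qed
  then show ?thesis by (simp add: trivial_mod_def)
qed

text \<open>A coset \<open>W x\<close> with \<open>x \<notin> W\<close> is stable under \<open>S\<close> and its size is prime to \<open>|S|\<close>,
  so \<open>S\<close> has a fixed point in it; hence the centralizer of \<open>S\<close> in \<open>R\<close> lies in no such \<open>W\<close>.\<close>

lemma centralizes_if_trivial_mod:
  assumes s: "prime s" "subgroup S G" "card S = s ^ n"
    and r: "prime r" "subgroup R G" "card R = r ^ k" "r \<noteq> s" and n: "normalizes S R"
    and t: "\<And>W. normal_of_index r R W \<Longrightarrow> trivial_mod S R W"
    and gx: "g \<in> S" "x \<in> R"
  shows "conj_by g x = x"
proof -
  note Rc = subgroup_sub[OF r(2)] and Sc = subgroup_sub[OF s(2)]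
  let ?C = "{x\<in>R. \<forall>g\<in>S. conj_by g x = x}"
  have C: "subgroup ?C G"
  proof
    show "?C \<subseteq> carrier G" using Rc by auto
    show "\<one> \<in> ?C" using subgroup.one_closed[OF r(2)] Sc by simp
    show "inv x \<in> ?C" if "x \<in> ?C" for x
      using that r(2) Rc Sc by (simp add: subgroup.m_inv_closed conj_by_inv)
    show "x \<otimes> y \<in> ?C" if "x \<in> ?C" "y \<in> ?C" for x y
      using that r(2) Rc Sc by (simp add: subgroup.m_closed conj_by_mult)
  qed
  have "?C = R"
  proof (rule ccontr)
    assume "?C \<noteq> R"
    then have "?C \<subset> R" by auto
    then obtain W where W: "normal_of_index r R W" "?C \<subseteq> W"
      using ex_normal_of_index[OF r(1,2,3) C] by blast
    have Ws: "subgroup W G" "W \<subseteq> R" using W(1) by (auto simp: normal_of_index_def)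
    note Wc = subgroup_sub[OF Ws(1)]
    obtain x where x: "x \<in> R" "x \<notin> W" using ex_outside_of_index[OF W(1) r(1,2)] .
    have tr: "conj_by g x \<otimes> inv x \<in> W" if "g \<in> S" "x \<in> R" for g x
      using t[OF W(1)] that by (simp add: trivial_mod_def)
    have gW: "conj_by g w \<in> W" if "g \<in> S" "w \<in> W" for g w
    proof -
      have "conj_by g w = (conj_by g w \<otimes> inv w) \<otimes> w"
        using that Wc Sc by (simp add: m_assoc)
      then show ?thesis
        using subgroup.m_closed[OF Ws(1) tr[OF that(1)] that(2)] that(2) Ws(2) by (metis subsetD)
    qed
    let ?E = "(\<lambda>w. w \<otimes> x) ` W"
    have "inj_on (\<lambda>w. w \<otimes> x) W" using Wc Rc x by (auto simp: inj_on_def)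
    then have cE: "card ?E = card W" by (simp add: card_image)
    have "card W dvd r ^ k" using card_subgroup_dvd[OF Ws(1) r(2) Ws(2)] r(3) by simp
    then have "\<not> s dvd card ?E"
      using cE s(1) r(1,4) by (metis dvd_trans prime_dvd_power primes_dvd_imp_eq)
    moreover have "s dvd card ?E \<longleftrightarrow> s dvd card {e\<in>?E. \<forall>a\<in>S. conj_by a e = e}"
    proof (rule fixed_points_cong[OF s(2,3,1)])
      show "finite ?E" using Ws by simp
      fix a e assume a: "a \<in> S" "e \<in> ?E"
      then obtain w where w: "w \<in> W" "e = w \<otimes> x" by auto
      have "conj_by a e = (conj_by a w \<otimes> (conj_by a x \<otimes> inv x)) \<otimes> x"
        using w a Sc Wc Rc x by (simp add: conj_by_mult m_assoc)
      then show "conj_by a e \<in> ?E"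
        using gW[OF a(1) w(1)] tr[OF a(1) x(1)] subgroup.m_closed[OF Ws(1)] by blast
    qed (use Rc Wc Sc x in \<open>auto simp: conj_by_conj_by\<close>)
    ultimately have "{e\<in>?E. \<forall>a\<in>S. conj_by a e = e} \<noteq> {}" by (metis card.empty dvd_0_right)
    then obtain w where w: "w \<in> W" "\<forall>a\<in>S. conj_by a (w \<otimes> x) = w \<otimes> x" by auto
    have "w \<otimes> x \<in> R" using w x Ws(2) subgroup.m_closed[OF r(2)] by auto
    then have "w \<otimes> x \<in> W" using w W(2) by auto
    then have "inv w \<otimes> (w \<otimes> x) \<in> W" using w Ws by (simp add: subgroup.m_closed subgroup.m_inv_closed)
    then show False using x Rc Wc w by (simp add: inv_mult_cancel)
  qed
  then show ?thesis using gx by auto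
qed

end

text \<open>Commuting is symmetric: if J fixes Q pointwise, then Q fixes J pointwise. This yields
  normality in Q K or Q J once the second factor has been dealt with.\<close>

lemma (in group) normalizes_if_fixes:
  assumes "Q \<subseteq> carrier G" "J \<subseteq> carrier G" "\<And>j x. j \<in> J \<Longrightarrow> x \<in> Q \<Longrightarrow> conj_by j x = x"
  shows "normalizes Q J"
proof (rule normalizesI)
  fix x j assume xj: "x \<in> Q" "j \<in> J"
  have c: "x \<in> carrier G" "j \<in> carrier G" using xj assms by auto
  have "conj_by j x \<otimes> j = x \<otimes> j" using assms(3)[OF xj(2,1)] by simp
  then have "j \<otimes> x = x \<otimes> j" using c by (simp add: conj_by_def m_assoc)
  then have "conj_by x j = j"
    using c by (simp add: conj_by_def m_assoc flip: \<open>j \<otimes> x = x \<otimes> j\<close>)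
  then show "conj_by x j \<in> J" using xj by simp
qed

context finite_group
begin

section \<open>Evolving subgroups\<close>

text \<open>The evolving property of a subgroup H, phrased with orders inside the fixed group: b
  stands for |J : I| and p^k for |H : J|. Inductions over subgroups then never change the ambient
  group structure.\<close>

definition evolving_in :: "'a set \<Rightarrow> bool" where
  "evolving_in H \<longleftrightarrow> (\<forall>p I. prime p \<longrightarrow> subgroup I G \<longrightarrow> I \<subseteq> H \<longrightarrow> (\<exists>i. card I = p ^ i) \<longrightarrow>
    (\<exists>J b k. subgroup J G \<and> I \<subseteq> J \<and> J \<subseteq> H \<and> card J = card I * b \<and> card H = card J * p ^ k
      \<and> \<not> p dvd b))"

lemma evolving_inE:
  assumes "evolving_in H" "prime p" "subgroup I G" "I \<subseteq> H" "card I = p ^ i"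
  obtains J b k where "subgroup J G" "I \<subseteq> J" "J \<subseteq> H" "card J = card I * b"
    "card H = card J * p ^ k" "\<not> p dvd b"
  using assms unfolding evolving_in_def by meson

lemma evolving_inI:
  assumes "\<And>p I i. prime p \<Longrightarrow> subgroup I G \<Longrightarrow> I \<subseteq> H \<Longrightarrow> card I = p ^ i \<Longrightarrow>
    \<exists>J b k. subgroup J G \<and> I \<subseteq> J \<and> J \<subseteq> H \<and> card J = card I * b \<and> card H = card J * p ^ k
      \<and> \<not> p dvd b"
  shows "evolving_in H"
  using assms unfolding evolving_in_def by blast

lemma subgroup_card_factor:
  assumes "subgroup I G" "subgroup D G" "subgroup J G" "I \<subseteq> D" "D \<subseteq> J" "card J = card I * b"
  obtains c where "card D = card I * c" "c dvd b"
proof -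
  obtain c where c: "card D = card I * c"
    using card_subgroup_dvd[OF assms(1,2,4)] by (auto elim: dvdE)
  have "card I * c dvd card I * b" using card_subgroup_dvd[OF assms(2,3,5)] assms(6) c by simp
  then show ?thesis using that[OF c] card_subgroup_pos[OF assms(1)] by simp
qed

text \<open>Intersect with M the J obtained in H. The index |M : J \<inter> M| equals |J M : J|, a
  divisor of |H : J|, and |J \<inter> M : I| divides |J : I|.\<close>

lemma evolving_in_normal_subgroup:
  assumes ev: "evolving_in H" and H: "subgroup H G" and M: "subgroup M G" "M \<subseteq> H" "normalizes H M"
  shows "evolving_in M"
proof (rule evolving_inI)
  fix p I i assume p: "prime p" and I: "subgroup I G" "I \<subseteq> M" "card I = p ^ i"
  obtain J b k where J: "subgroup J G" "I \<subseteq> J" "J \<subseteq> H" "card J = card I * b"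
    "card H = card J * p ^ k" "\<not> p dvd b"
    using evolving_inE[OF ev p I(1) _ I(3)] I(2) M(2) by blast
  have D: "subgroup (J \<inter> M) G" using subgroup_Int J M by blast
  obtain c where c: "card (J \<inter> M) = card I * c" "c dvd b"
    using subgroup_card_factor[OF I(1) D J(1) _ _ J(4)] I J by auto
  have JM: "subgroup (J <#> M) G"
    using set_mult_subgroupI[OF J(1) M(1)] normalizes_mono[OF M(3) J(3)] by simp
  obtain d where d: "card (J <#> M) = card J * d"
    using card_subgroup_dvd[OF J(1) JM sub_set_mult_left[OF J(1) M(1)]] by (auto elim: dvdE)
  have "card J * d dvd card J * p ^ k"
    using card_subgroup_dvd[OF JM H set_mult_sub[OF H J(3) M(2)]] d J(5) by simp
  then have "d dvd p ^ k" using card_subgroup_pos[OF J(1)] by simp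
  then obtain e where e: "d = p ^ e" using divides_primepow_nat[OF p] by auto
  have "card J * d * card (J \<inter> M) = card J * card M" using card_set_mult[OF J(1) M(1)] d by simp
  then have "card M = card (J \<inter> M) * p ^ e"
    using card_subgroup_pos[OF J(1)] e by (simp add: mult.commute)
  moreover have "\<not> p dvd c" using c(2) J(6) dvd_trans by blast
  ultimately show "\<exists>J b k. subgroup J G \<and> I \<subseteq> J \<and> J \<subseteq> M \<and> card J = card I * b \<and>
      card M = card J * p ^ k \<and> \<not> p dvd b"
    using D c I J by blast
qed

text \<open>If p does not divide |K|, then I is trivial and K itself serves. Otherwise p does not
  divide |R|, so R lies in the J obtained in H; hence J K = H, and \<open>J \<inter> K\<close> has
  in K the same index as J in H.\<close>

lemma evolving_in_complement:
  assumes ev: "evolving_in H" and H: "subgroup H G" and R: "subgroup R G" "R \<subseteq> H" "normalizes H R"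
    and K: "subgroup K G" "K \<subseteq> H" and c: "card H = card R * card K" "coprime (card R) (card K)"
  shows "evolving_in K"
proof (rule evolving_inI)
  fix p I i assume p: "prime p" and I: "subgroup I G" "I \<subseteq> K" "card I = p ^ i"
  show "\<exists>J b k. subgroup J G \<and> I \<subseteq> J \<and> J \<subseteq> K \<and> card J = card I * b \<and>
      card K = card J * p ^ k \<and> \<not> p dvd b"
  proof (cases "p dvd card K")
    case False
    have "p ^ i dvd card K" using card_subgroup_dvd[OF I(1) K(1) I(2)] I(3) by simp
    then have "i = 0" using False by (cases i) (auto intro: dvd_trans)
    then have "card K = card I * card K" "card K = card K * p ^ 0" using I(3) by auto
    then show ?thesis using False I K by blast
  next
    case True
    then have pR: "\<not> p dvd card R" using c(2) p by (metis coprime_common_divisor not_prime_unit)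
    obtain J b k where J: "subgroup J G" "I \<subseteq> J" "J \<subseteq> H" "card J = card I * b"
      "card H = card J * p ^ k" "\<not> p dvd b"
      using evolving_inE[OF ev p I(1) _ I(3)] I(2) K(2) by blast
    have "coprime (card R) (p ^ k)" using pR p by (simp add: prime_imp_coprime coprime_commute)
    then have RJ: "R \<subseteq> J"
      using subset_of_coprime_index[OF H R(1,2) J(1,3) _ J(5)] normalizes_mono[OF R(3) J(3)] by simp
    have D: "subgroup (J \<inter> K) G" using subgroup_Int J K by blast
    obtain d where d: "card (J \<inter> K) = card I * d" "d dvd b"
      using subgroup_card_factor[OF I(1) D J(1) _ _ J(4)] I J by auto
    have JK: "J <#> K \<subseteq> H" using set_mult_sub[OF H J(3) K(2)] .
    then have f: "finite (J <#> K)" using finite_subset finite_subgroup[OF H] by blast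
    have "card (R <#> K) \<le> card (J <#> K)" by (rule card_mono[OF f mono_set_mult[OF RJ subset_refl]])
    moreover have "card (R <#> K) = card H" using card_set_mult_coprime[OF R(1) K(1)] c by simp
    moreover have "card (J <#> K) \<le> card H" using JK H by (simp add: card_mono)
    ultimately have "card H * card (J \<inter> K) = card J * card K"
      using card_set_mult[OF J(1) K(1)] by simp
    then have "card K = card (J \<inter> K) * p ^ k"
      using card_subgroup_pos[OF J(1)] J(5) by (simp add: mult.commute mult.left_commute)
    moreover have "\<not> p dvd d" using d(2) J(6) dvd_trans by blast
    ultimately show ?thesis using D d I J by blast
  qed
qed

section \<open>Normal p-complements and normal Sylow subgroups in evolving groups\<close>

definition normal_p_complement :: "nat \<Rightarrow> 'a set \<Rightarrow> 'a set \<Rightarrow> bool" where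
  "normal_p_complement p H M \<longleftrightarrow> subgroup M G \<and> M \<subseteq> H \<and> normalizes H M \<and> \<not> p dvd card M \<and>
    (\<exists>k. card H = card M * p ^ k)"

definition normal_sylow :: "nat \<Rightarrow> 'a set \<Rightarrow> 'a set \<Rightarrow> bool" where
  "normal_sylow p H S \<longleftrightarrow> subgroup S G \<and> S \<subseteq> H \<and> normalizes H S \<and> card S = p_part p (card H)"

lemma normal_p_complement_self:
  "subgroup H G \<Longrightarrow> \<not> p dvd card H \<Longrightarrow> normal_p_complement p H H"
  by (auto simp: normal_p_complement_def normalizes_self intro: exI[of _ 0])

text \<open>A J of index p is normal since p is the smallest prime, and it is again evolving. Its
  normal p-complement, obtained by induction, is a normal Hall subgroup of J and so is normal in
  H.\<close>

lemma ex_normal_p_complement_if_smallest: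
  assumes "evolving_in H" "subgroup H G" "prime p" "\<And>q. prime q \<Longrightarrow> q dvd card H \<Longrightarrow> p \<le> q"
  shows "\<exists>M. normal_p_complement p H M"
  using assms
proof (induction "card H" arbitrary: H rule: less_induct)
  case less
  note ev = less.prems(1) and H = less.prems(2) and p = less.prems(3)
  show ?case
  proof (cases "p dvd card H")
    case False
    then show ?thesis using normal_p_complement_self[OF H] by blast
  next
    case True
    obtain m where m: "card H = p_part p (card H) * m" "\<not> p dvd m"
      using p_part_decompose[OF p card_subgroup_pos[OF H]] by blast
    obtain a where a: "p_part p (card H) = p ^ a" by (simp add: p_part_def)
    have "a \<noteq> 0" using True m a by (cases a) auto
    then obtain a' where a': "a = Suc a'" by (cases a) auto
    \<comment> \<open>The exponent is one below that of a Sylow p-subgroup: J then has the same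
      p-part as C, and since its index is a power of p, the index is exactly p.\<close>
    have "p ^ a' dvd card H" using m a a' by (metis dvd_mult2 le_imp_power_dvd le_SucI order_refl)
    then obtain C where C: "subgroup C G" "C \<subseteq> H" "card C = p ^ a'"
      using sylow_in[OF H p] by blast
    obtain J b k where J: "subgroup J G" "C \<subseteq> J" "J \<subseteq> H" "card J = card C * b"
      "card H = card J * p ^ k" "\<not> p dvd b"
      using evolving_inE[OF ev p C] by blast
    have "p ^ (a' + k) * b = p ^ a * m" 
      using J(4,5) C(3) m(1) a by (metis mult.assoc mult.commute power_add)
    then have "a' + k = a" using coprime_prime_power_cancel[OF p _ J(6) m(2)] by blast
    then have J': "card H = card J * p" using J(5) a' by simp
    have nJ: "normalizes H J"
      by (rule normalizes_if_smallest_prime_index[OF H J(1,3) p J' less.prems(4)])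
    have "card J < card H" using J' card_subgroup_pos[OF J(1)] prime_gt_1_nat[OF p] by simp
    moreover have "evolving_in J" by (rule evolving_in_normal_subgroup[OF ev H J(1,3) nJ])
    ultimately obtain M where "normal_p_complement p J M"
      using less.hyps[of J] J p J' less.prems(4) by (metis dvd_mult2)
    then obtain l where M: "subgroup M G" "M \<subseteq> J" "normalizes J M" "\<not> p dvd card M"
      "card J = card M * p ^ l" by (auto simp: normal_p_complement_def)
    have "coprime (card M) (p ^ l)" using M(4) p by (simp add: prime_imp_coprime coprime_commute)
    then have "normalizes H M"
      using normalizes_Hall_trans[OF H J(1,3) M(1,2) nJ M(3,5)] by simp
    moreover have "card H = card M * p ^ Suc l" using J' M(5) by simp
    ultimately have "normal_p_complement p H M"
      unfolding normal_p_complement_def using M(1,2,4) J(3) by blast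
    then show ?thesis by blast
  qed
qed

lemma normal_sylow_Hall:
  assumes "normal_sylow p H S" "prime p" "subgroup H G"
  obtains m where "card H = card S * m" "\<not> p dvd m" "coprime (card S) m"
proof -
  obtain m where m: "card H = p_part p (card H) * m" "\<not> p dvd m"
    using p_part_decompose[OF assms(2) card_subgroup_pos[OF assms(3)]] by blast
  then show ?thesis using that[of m] assms coprime_p_part[OF assms(2)] by (simp add: normal_sylow_def)
qed

lemma p_part_mult_coprime:
  assumes "prime p" "n > 0" "\<not> p dvd m" shows "p_part p (n * m) = p_part p n"
proof -
  obtain b where b: "n = p_part p n * b" "\<not> p dvd b" using p_part_decompose[OF assms(1,2)] by blast
  have "p_part p (n * m) = p ^ multiplicity p n"
    by (rule p_part_eqI[OF assms(1), of _ _ "b * m"])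
      (use b assms in \<open>auto simp: p_part_def prime_dvd_mult_iff mult.assoc\<close>)
  then show ?thesis by (simp add: p_part_def)
qed

text \<open>Unless H is an r-group, the smallest prime p differs from r, and the normal p-complement
  M has the same r-part as H. Induction applies to M, and its normal Sylow r-subgroup is Hall in M,
  hence normal in H.\<close>

lemma ex_normal_sylow_if_largest:
  assumes "evolving_in H" "subgroup H G" "prime r" "\<And>q. prime q \<Longrightarrow> q dvd card H \<Longrightarrow> q \<le> r"
  shows "\<exists>R. normal_sylow r H R"
  using assms
proof (induction "card H" arbitrary: H rule: less_induct)
  case less
  note ev = less.prems(1) and H = less.prems(2) and r = less.prems(3)
  show ?case
  proof (cases "\<exists>q. prime q \<and> q dvd card H \<and> q \<noteq> r")
    case False
    obtain m where m: "card H = p_part r (card H) * m" "\<not> r dvd m"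
      using p_part_decompose[OF r card_subgroup_pos[OF H]] by blast
    have "m = 1"
    proof (rule ccontr)
      assume "m \<noteq> 1"
      then obtain q where "prime q" "q dvd m" using prime_factor_nat by blast
      then show False using False m by (metis dvd_mult)
    qed
    then have "normal_sylow r H H" using m H by (simp add: normal_sylow_def normalizes_self)
    then show ?thesis by blast
  next
    case True
    let ?P = "\<lambda>q. prime q \<and> q dvd card H"
    define p where "p = (LEAST q. ?P q)"
    have p: "prime p" "p dvd card H" using LeastI_ex[of ?P] True unfolding p_def by blast+
    have pl: "p \<le> q" if "prime q" "q dvd card H" for q
      unfolding p_def by (rule Least_le) (use that in simp)
    have "p \<noteq> r" using True pl less.prems(4) by (metis le_antisym)
    obtain M where "normal_p_complement p H M"
      using ex_normal_p_complement_if_smallest[OF ev H p(1) pl] by blast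
    then obtain k where M: "subgroup M G" "M \<subseteq> H" "normalizes H M" "\<not> p dvd card M"
      "card H = card M * p ^ k" by (auto simp: normal_p_complement_def)
    have "card M dvd card H" using M(5) by simp
    moreover have "card M \<noteq> card H" using M(4) p(2) by metis
    ultimately
    have "card M < card H" using card_subgroup_pos[OF H] by (simp add: dvd_imp_le le_neq_implies_less)
    moreover have "evolving_in M" by (rule evolving_in_normal_subgroup[OF ev H M(1-3)])
    ultimately obtain R where R: "normal_sylow r M R"
      using less.hyps[of M] M r less.prems(4) by (metis dvd_mult2)
    then obtain m where m: "card M = card R * m" "\<not> r dvd m" "coprime (card R) m"
      using normal_sylow_Hall[OF R r M(1)] by blast
    have Rs: "subgroup R G" "R \<subseteq> M" "normalizes M R" "card R = p_part r (card M)"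
      using R by (auto simp: normal_sylow_def)
    have "normalizes H R"
      by (rule normalizes_Hall_trans[OF H M(1,2) Rs(1,2) M(3) Rs(3) m(1,3)])
    moreover have "\<not> r dvd p ^ k" using \<open>p \<noteq> r\<close> p r by (metis prime_dvd_power primes_dvd_imp_eq)
    then have "p_part r (card H) = p_part r (card M)"
      unfolding M(5) by (rule p_part_mult_coprime[OF r card_subgroup_pos[OF M(1)]])
    ultimately have "normal_sylow r H R" using Rs M by (auto simp: normal_sylow_def)
    then show ?thesis by blast
  qed
qed

text \<open>Take J for the r-subgroup U. The index |J \<inter> R : U| is a power of r dividing a
  number prime to r, so \<open>J \<inter> R\<close> = U, which J normalizes because R is normal.
  Counting gives J R = H, and R normalizes U by hypothesis.\<close>

lemma normal_if_normal_in_normal_sylow: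
  assumes ev: "evolving_in H" and H: "subgroup H G" and r: "prime r" and R: "normal_sylow r H R"
    and U: "subgroup U G" "U \<subseteq> R" "normalizes R U"
  shows "normalizes H U"
proof -
  have Rs: "subgroup R G" "R \<subseteq> H" "normalizes H R" using R by (auto simp: normal_sylow_def)
  obtain a where a: "card R = r ^ a" using R by (auto simp: normal_sylow_def p_part_def)
  obtain m where m: "card H = card R * m" "\<not> r dvd m" using normal_sylow_Hall[OF R r H] by blast
  have "card U dvd r ^ a" using card_subgroup_dvd[OF U(1) Rs(1) U(2)] a by simp
  then obtain i where i: "card U = r ^ i" using divides_primepow_nat[OF r] by auto
  obtain J b k where J: "subgroup J G" "U \<subseteq> J" "J \<subseteq> H" "card J = card U * b"
    "card H = card J * r ^ k" "\<not> r dvd b"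
    using evolving_inE[OF ev r U(1) _ i] U Rs by blast
  have D: "subgroup (J \<inter> R) G" using subgroup_Int J Rs by blast
  obtain c where c: "card (J \<inter> R) = card U * c" "c dvd b"
    using subgroup_card_factor[OF U(1) D J(1) _ _ J(4)] U J by auto
  have "card (J \<inter> R) dvd r ^ a" using card_subgroup_dvd[OF D Rs(1)] a by simp
  then have "c dvd r ^ a" using c(1) by (metis dvd_mult_right)
  then obtain e where e: "c = r ^ e" using divides_primepow_nat[OF r] by auto
  have "e = 0"
  proof (rule ccontr)
    assume "e \<noteq> 0"
    then have "r dvd c" using e by simp
    then show False using c(2) J(6) dvd_trans by blast
  qed
  then have "card (J \<inter> R) = card U" using c e by simp
  moreover have "U \<subseteq> J \<inter> R" using J(2) U(2) by blast
  ultimately have JR: "J \<inter> R = U"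
    using card_subset_eq[OF finite_subgroup[OF D], of U] by simp
  have "r ^ (i + k) * b = r ^ a * m" using J(4,5) i a m by (simp add: power_add mult.assoc mult.commute)
  then have "i + k = a" using coprime_prime_power_cancel[OF r _ J(6) m(2)] by blast
  then have "r ^ a = r ^ i * r ^ k" by (simp flip: power_add)
  then have "card (J <#> R) * r ^ i = card J * (r ^ i * r ^ k)"
    using card_set_mult[OF J(1) Rs(1)] JR i a by simp
  then have "card (J <#> R) = card H" using J(5) prime_gt_0_nat[OF r] by (simp add: mult.commute)
  then have "J <#> R = H"
    using card_subset_eq[OF finite_subgroup[OF H] set_mult_sub[OF H J(3) Rs(2)]] by simp
  moreover have "normalizes J U"
    using normalizes_Int[OF normalizes_self[OF J(1) subset_refl] normalizes_mono[OF Rs(3) J(3)]] JR by simp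
  ultimately show ?thesis
    using normalizes_set_mult_left[OF _ _ _ _ U(3), of J] subgroup.subset J(1) Rs(1) U(1) by metis
qed

section \<open>The dichotomy: a normal Sylow subgroup or a normal complement\<close>

lemma ex_p_complement:
  assumes ev: "evolving_in H" and H: "subgroup H G" and p: "prime p"
  obtains K k where "subgroup K G" "K \<subseteq> H" "\<not> p dvd card K" "card H = card K * p ^ k"
proof -
  \<comment> \<open>The evolving condition at the trivial subgroup: there |J| = b, so J has order
    prime to p and index a power of p.\<close>
  have "card {\<one>} = p ^ 0" by simp
  then obtain J b k where "subgroup J G" "{\<one>} \<subseteq> J" "J \<subseteq> H" "card J = card {\<one>} * b"
    "card H = card J * p ^ k" "\<not> p dvd b"
    using evolving_inE[OF ev p triv_subgroup] subgroup.one_closed[OF H] by blast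
  then show ?thesis using that[of J k] by simp
qed

lemma card_p_complement:
  assumes "normal_sylow p H R" "prime p" "subgroup H G" "\<not> p dvd card K" "card H = card K * p ^ k"
  shows "card R = p ^ k"
proof -
  have "p_part p (card H) = p ^ k"
    by (rule p_part_eqI[OF assms(2) _ assms(4)]) (use assms in simp)
  then show ?thesis using assms(1) by (simp add: normal_sylow_def)
qed

lemma sylow_set_mult_complement:
  assumes "normal_sylow p H R" "prime p" "subgroup H G" "subgroup K G" "K \<subseteq> H" "\<not> p dvd card K"
    "card H = card K * p ^ k"
  shows "R <#> K = H" "coprime (card R) (card K)" "card H = card R * card K"
proof -
  have Rs: "subgroup R G" "R \<subseteq> H" using assms by (auto simp: normal_sylow_def)
  have cR: "card R = p ^ k" by (rule card_p_complement[OF assms(1-3,6,7)])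
  show c: "coprime (card R) (card K)" using cR assms(2,6) by (simp add: prime_imp_coprime)
  show cH: "card H = card R * card K" using assms(7) cR by simp
  then show "R <#> K = H"
    using card_subset_eq[OF finite_subgroup[OF assms(3)] set_mult_sub[OF assms(3) Rs(2) assms(5)]]
      card_set_mult_coprime[OF Rs(1) assms(4) c] by simp
qed

text \<open>With D the intersection of W1 and W2, the group Q/D has order q^2, and a third subgroup
  of order q in it is also normalized by K. A commutator [g, x] with x in that third subgroup lies
  both there and in W1, hence in D; so g fixes the image of x in Q/W2, a generator.\<close>

lemma trivial_mod_of_second_maximal:
  assumes ev: "evolving_in K" and K: "subgroup K G" and q: "prime q" and Q: "normal_sylow q K Q"
    and W1: "normal_of_index q Q W1" "trivial_mod K Q W1"
    and W2: "normal_of_index q Q W2"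
  shows "trivial_mod K Q W2"
proof (cases "W1 = W2")
  case False
  have Qs: "subgroup Q G" "Q \<subseteq> K" "normalizes K Q" using Q by (auto simp: normal_sylow_def)
  note Qc = subgroup_sub[OF Qs(1)] and Kc = subgroup_sub[OF K]
  have W1s: "subgroup W1 G" "W1 \<subseteq> Q" "normalizes Q W1" "card Q = card W1 * q"
    and W2s: "subgroup W2 G" "W2 \<subseteq> Q" "normalizes Q W2" "card Q = card W2 * q"
    using W1 W2 by (auto simp: normal_of_index_def)
  have "card W1 = card W2" using W1s(4) W2s(4) prime_gt_0_nat[OF q] by simp
  then have "\<not> W1 \<subseteq> W2" "\<not> W2 \<subseteq> W1"
    using False card_subset_eq[OF finite_subgroup[OF W2s(1)]]
      card_subset_eq[OF finite_subgroup[OF W1s(1)]] by auto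
  then obtain a b where ab: "a \<in> W1" "a \<notin> W2" "b \<in> W2" "b \<notin> W1" by auto
  have abc: "a \<in> carrier G" "b \<in> carrier G" using ab subgroup_sub[OF W1s(1)] subgroup_sub[OF W2s(1)] by auto
  \<comment> \<open>With a only in W1 and b only in W2, the product lies in neither, so it generates
    both Q/W1 and Q/W2.\<close>
  define x where "x = a \<otimes> b"
  have xQ: "x \<in> Q" unfolding x_def using ab W1s W2s subgroup.m_closed[OF Qs(1)] by auto
  have x1: "x \<notin> W1"
  proof
    assume "x \<in> W1"
    then have "inv a \<otimes> x \<in> W1" using ab W1s(1) by (simp add: subgroup.m_closed subgroup.m_inv_closed)
    then show False using ab abc by (simp add: x_def inv_mult_cancel)
  qed
  have x2: "x \<notin> W2"
  proof
    assume "x \<in> W2"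
    then have "x \<otimes> inv b \<in> W2" using ab W2s(1) by (simp add: subgroup.m_closed subgroup.m_inv_closed)
    then show False using ab abc by (simp add: x_def m_assoc)
  qed
  let ?D = "W1 \<inter> W2" and ?X = "generate G {x}"
  have D: "subgroup ?D G" using subgroup_Int W1s W2s by blast
  have X: "subgroup ?X G" using generate_is_subgroup[of "{x}"] Qc xQ by simp
  have XQ: "?X \<subseteq> Q" using generate_subgroup_incl[OF _ Qs(1), of "{x}"] xQ by simp
  have nX: "normalizes Q ?D" using normalizes_Int W1s W2s by blast
  \<comment> \<open>The diagonal subgroup of Q/D. It is normal in Q because Q acts trivially modulo
    W1 and modulo W2, and therefore normal in K by
    \<open>normal_if_normal_in_normal_sylow\<close>.\<close>
  let ?U = "?X <#> ?D"
  have U: "subgroup ?U G" using set_mult_subgroupI[OF X D normalizes_mono[OF nX XQ]] .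
  have UQ: "?U \<subseteq> Q" using set_mult_sub[OF Qs(1) XQ, of ?D] W1s(2) by blast
  have DU: "?D \<subseteq> ?U" and XU: "?X \<subseteq> ?U" using sub_set_mult_right[OF X D] sub_set_mult_left[OF X D] by auto
  have xU: "x \<in> ?U" using XU generate.incl[of x "{x}" G] by auto
  have "normalizes Q ?U"
  proof (rule normalizesI)
    fix g u assume gu: "g \<in> Q" "u \<in> ?U"
    then have uQ: "u \<in> Q" using UQ by auto
    have "conj_by g u \<otimes> inv u \<in> ?D"
      using trivial_mod_self[OF W1(1) Qs(1) q] trivial_mod_self[OF W2(1) Qs(1) q] gu(1) uQ
      by (auto simp: trivial_mod_def)
    then have "(conj_by g u \<otimes> inv u) \<otimes> u \<in> ?U" using DU gu subgroup.m_closed[OF U] by blast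
    then show "conj_by g u \<in> ?U" using gu uQ Qc by (simp add: m_assoc)
  qed
  then have nU: "normalizes K ?U"
    using normal_if_normal_in_normal_sylow[OF ev K q Q U UQ] by simp
  have nW2: "normalizes K W2"
    by (rule normal_if_normal_in_normal_sylow[OF ev K q Q W2s(1-3)])
  have "conj_by g x \<otimes> inv x \<in> W2" if g: "g \<in> K" for g
  proof -
    let ?u = "conj_by g x \<otimes> inv x"
    have "?u \<in> ?U" using normalizesD[OF nU g xU] xU U by (simp add: subgroup.m_closed subgroup.m_inv_closed)
    then obtain y d where y: "y \<in> ?X" "d \<in> ?D" "?u = y \<otimes> d" by (auto simp: set_mult_def)
    then obtain i :: int where i: "y = x [^] i" using generate_pow[OF Qc[OF xQ]] by auto
    have u1: "?u \<in> W1" using W1(2) g xQ by (simp add: trivial_mod_def)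
    have dc: "d \<in> carrier G" "y \<in> carrier G" using y(2) subgroup_sub[OF D] y(1) XQ Qc by auto
    have "?u \<otimes> inv d \<in> W1" using u1 y(2) W1s(1) by (simp add: subgroup.m_closed subgroup.m_inv_closed)
    then have i1: "x [^] i \<in> W1" using y(3) dc i by (simp add: m_assoc)
    have xq: "x [^] (int q) \<in> W1" "x [^] (int q) \<in> W2"
      using pow_index_mem[OF W1(1) Qs(1) xQ] pow_index_mem[OF W2(1) Qs(1) xQ] by (simp_all add: int_pow_int)
    \<comment> \<open>If i were prime to q, a Bezout combination of x^q and x^i, both in W1, would
      put x itself into W1.\<close>
    have "int q dvd i"
    proof (rule ccontr)
      assume "\<not> int q dvd i"
      then have "gcd (int q) i = 1" using q prime_imp_coprime[of "int q" i] by simp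
      then obtain s t where st: "s * int q + t * i = 1" using bezout_int[of "int q" i] by auto
      have "x = x [^] (int q * s + i * t)" using st Qc[OF xQ] by (simp add: mult.commute)
      also have "\<dots> = (x [^] int q) [^] s \<otimes> (x [^] i) [^] t"
        using Qc[OF xQ] by (simp add: int_pow_mult int_pow_pow)
      also have "\<dots> \<in> W1"
        using xq i1 subgroup_int_pow_closed[OF W1s(1)] subgroup.m_closed[OF W1s(1)] by simp
      finally show False using x1 by simp
    qed
    then obtain j where "i = int q * j" by (auto elim: dvdE)
    then have "y = (x [^] int q) [^] j" using i Qc[OF xQ] by (simp add: int_pow_pow)
    then have "y \<in> W2" using xq subgroup_int_pow_closed[OF W2s(1)] by simp
    then show "?u \<in> W2" using y subgroup.m_closed[OF W2s(1)] by simp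
  qed
  then have "trivial_mod {g} Q W2" if "g \<in> K" for g
    using trivial_mod_if_one_point[OF W2 Qs(1) q Kc[OF that] _ _ xQ x2] that
      normalizes_mono[OF Qs(3)] normalizes_mono[OF nW2] by simp
  then show ?thesis by (simp add: trivial_mod_def)
qed (use W1 in simp)

text \<open>Some W1 of index q contains \<open>derived G K \<inter> Q\<close>, so K acts trivially
  on Q/W1 and then on every such quotient. Sylow subgroups of a q-complement J thus centralize Q,
  hence so does J, and J is normal in K = Q J.\<close>

lemma normal_sylow_in_derived_or_complement:
  assumes ev: "evolving_in K" and K: "subgroup K G" and q: "prime q" and Q: "normal_sylow q K Q"
    and nd: "\<not> Q \<subseteq> derived G K"
  shows "\<exists>M. normal_p_complement q K M"
proof -
  have Qs: "subgroup Q G" "Q \<subseteq> K" "normalizes K Q" using Q by (auto simp: normal_sylow_def)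
  obtain a where a: "card Q = q ^ a" using Q by (auto simp: normal_sylow_def p_part_def)
  note Qc = subgroup_sub[OF Qs(1)] and Kc = subgroup_sub[OF K]
  have dv: "subgroup (derived G K) G" using derived_is_subgroup subgroup.subset[OF K] by blast
  have C: "subgroup (derived G K \<inter> Q) G" using subgroup_Int dv Qs by blast
  have "derived G K \<inter> Q \<subset> Q" using nd by auto
  then obtain W1 where W1: "normal_of_index q Q W1" "derived G K \<inter> Q \<subseteq> W1"
    using ex_normal_of_index[OF q Qs(1) a C] by blast
  have "trivial_mod K Q W1"
    unfolding trivial_mod_def
  proof (intro ballI)
    fix g x assume gx: "g \<in> K" "x \<in> Q"
    have "conj_by g x \<otimes> inv x \<in> derived G K"
      unfolding derived_def conj_by_def using gx Qs(2) by (intro generate.incl) auto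
    moreover have "conj_by g x \<otimes> inv x \<in> Q"
      using gx normalizesD[OF Qs(3)] Qs(1) by (simp add: subgroup.m_closed subgroup.m_inv_closed)
    ultimately show "conj_by g x \<otimes> inv x \<in> W1" using W1 by auto
  qed
  then have tr: "trivial_mod K Q W" if "normal_of_index q Q W" for W
    using trivial_mod_of_second_maximal[OF ev K q Q W1(1) _ that] by simp
  obtain J k where J: "subgroup J G" "J \<subseteq> K" "\<not> q dvd card J" "card K = card J * q ^ k"
    using ex_p_complement[OF ev K q] .
  note Jc = subgroup_sub[OF J(1)]
  let ?C = "{j\<in>J. \<forall>x\<in>Q. conj_by j x = x}"
  have sC: "subgroup ?C G"
  proof
    show "?C \<subseteq> carrier G" using Jc by auto
    show "\<one> \<in> ?C" using subgroup.one_closed[OF J(1)] Qc by simp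
    show "inv j \<in> ?C" if j: "j \<in> ?C" for j
    proof -
      have "conj_by (inv j) x = x" if x: "x \<in> Q" for x
      proof -
        have "j \<in> carrier G" "x \<in> carrier G" "conj_by j x = x" using x j Jc Qc by auto
        then show ?thesis using conj_by_cancel(1)[of j x] by simp
      qed
      then show ?thesis using j J(1) by (simp add: subgroup.m_inv_closed)
    qed
    show "i \<otimes> j \<in> ?C" if "i \<in> ?C" "j \<in> ?C" for i j
      using that J(1) Jc Qc by (simp add: subgroup.m_closed conj_by_conj_by)
  qed
  have "?C = J"
  proof (rule subgroup_eqI_p_parts[OF sC J(1)])
    fix s assume s: "prime s" "s dvd card J"
    then have "s \<noteq> q" using J by auto
    obtain S where S: "subgroup S G" "S \<subseteq> J" "card S = p_part s (card J)"
      using sylow_in[OF J(1) s(1), of "multiplicity s (card J)"] p_part_dvd[of s "card J"]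
      unfolding p_part_def by blast
    have "conj_by g x = x" if "g \<in> S" "x \<in> Q" for g x
    proof (rule centralizes_if_trivial_mod[OF s(1) S(1) _ q Qs(1) a _ _ _ that])
      show "card S = s ^ multiplicity s (card J)" using S(3) by (simp add: p_part_def)
      show "q \<noteq> s" using \<open>s \<noteq> q\<close> by simp
      show "normalizes S Q" using normalizes_mono[OF Qs(3)] S J by blast
      show "trivial_mod S Q W" if "normal_of_index q Q W" for W
        using tr[OF that] S J by (auto simp: trivial_mod_def)
    qed
    then show "\<exists>S. subgroup S G \<and> S \<subseteq> ?C \<and> card S = p_part s (card J)"
      using S by blast
  qed auto
  then have fx: "conj_by j x = x" if "j \<in> J" "x \<in> Q" for j x using that by blast
  have QJ: "Q <#> J = K" using sylow_set_mult_complement(1)[OF Q q K J] .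
  have "normalizes K J"
    using normalizes_set_mult_left[of J Q J] QJ normalizes_self[OF J(1) subset_refl]
      normalizes_if_fixes[of Q J] fx subgroup.subset Qs(1) J(1) by metis
  then have "normal_p_complement q K J" using J by (auto simp: normal_p_complement_def)
  then show ?thesis by blast
qed

text \<open>Write H = R K with R the normal Sylow subgroup for the largest prime r \<noteq> q. A
  normal q-complement M of K gives R M in H. A normal Sylow q-subgroup Q of K inside the derived
  subgroup is trivial on each R/W, so it centralizes R and is normal in H; outside the derived
  subgroup the previous lemma returns to the first case.\<close>

lemma normal_sylow_or_complement:
  assumes "evolving_in H" "subgroup H G" "prime q"
  shows "(\<exists>Q. normal_sylow q H Q) \<or> (\<exists>M. normal_p_complement q H M)"
  using assms
proof (induction "card H" arbitrary: H rule: less_induct)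
  case less
  note ev = less.prems(1) and H = less.prems(2) and q = less.prems(3)
  show ?case
  proof (cases "q dvd card H")
    case False
    then show ?thesis using normal_p_complement_self[OF H] by blast
  next
    case True
    define r where "r = Max (prime_factors (card H))"
    have qf: "q \<in> prime_factors (card H)"
      using True q card_subgroup_pos[OF H] by (simp add: prime_factors_dvd)
    then have "r \<in> prime_factors (card H)" unfolding r_def by (intro Max_in) auto
    then have r: "prime r" "r dvd card H" by (auto simp: prime_factors_dvd)
    have "p \<le> r" if "prime p" "p dvd card H" for p
      unfolding r_def using that card_subgroup_pos[OF H] by (intro Max_ge) (auto simp: prime_factors_dvd)
    then obtain R where R: "normal_sylow r H R"
      using ex_normal_sylow_if_largest[OF ev H r(1)] by blast
    have Rs: "subgroup R G" "R \<subseteq> H" "normalizes H R" using R by (auto simp: normal_sylow_def)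
    obtain a where a: "card R = r ^ a" using R by (auto simp: normal_sylow_def p_part_def)
    show ?thesis
    proof (cases "q = r")
      case True
      then show ?thesis using R by auto
    next
      case qr: False
      obtain K k where K: "subgroup K G" "K \<subseteq> H" "\<not> r dvd card K" "card H = card K * r ^ k"
        using ex_p_complement[OF ev H r(1)] .
      note RK = sylow_set_mult_complement[OF R r(1) H K]
      have evK: "evolving_in K" by (rule evolving_in_complement[OF ev H Rs K(1,2) RK(3,2)])
      have "card K dvd card H" using K(4) by simp
      moreover have "card K \<noteq> card H" using K(3) r(2) by metis
      ultimately have lt: "card K < card H"
        using card_subgroup_pos[OF H] by (simp add: dvd_imp_le le_neq_implies_less)
      have qR: "\<not> q dvd card R" using a qr q r by (metis prime_dvd_power primes_dvd_imp_eq)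
      have compl: ?thesis if "normal_p_complement q K M" for M
      proof -
        obtain l where M: "subgroup M G" "M \<subseteq> K" "normalizes K M" "\<not> q dvd card M"
          "card K = card M * q ^ l" using \<open>normal_p_complement q K M\<close> by (auto simp: normal_p_complement_def)
        have sc: "R \<subseteq> carrier G" "M \<subseteq> carrier G" "K \<subseteq> carrier G"
          using Rs(1) M(1) K(1) subgroup.subset by auto
        have s: "subgroup (R <#> M) G"
          using set_mult_subgroupI'[OF Rs(1) M(1)] normalizes_mono[OF Rs(3)] M K by blast
        have "coprime (card R) (card M)" using RK(2) M(5) by simp
        then have c: "card (R <#> M) = card R * card M" by (rule card_set_mult_coprime[OF Rs(1) M(1)])
        have "normalizes K (R <#> M)"
          by (rule normalizes_set_mult_right[OF sc(3,1,2) normalizes_mono[OF Rs(3) K(2)] M(3)])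
        moreover have "normalizes R (R <#> M)"
          by (rule normalizes_self[OF s sub_set_mult_left[OF Rs(1) M(1)]])
        ultimately have "normalizes H (R <#> M)"
          using normalizes_set_mult_left[of "R <#> M" R K] RK(1) sc subgroup.subset[OF s] by simp
        moreover have "R <#> M \<subseteq> H" using set_mult_sub[OF H Rs(2)] M K by blast
        moreover have "\<not> q dvd card (R <#> M)" using c qR M q by (simp add: prime_dvd_mult_iff)
        moreover have "card H = card (R <#> M) * q ^ l" using RK(3) M(5) c by simp
        ultimately have "normal_p_complement q H (R <#> M)"
          unfolding normal_p_complement_def using s by blast
        then show ?thesis by blast
      qed
      from less.hyps[OF lt evK K(1) q] show ?thesis
      proof (elim disjE exE)
        fix Q assume Q: "normal_sylow q K Q"
        have Qs: "subgroup Q G" "Q \<subseteq> K" "normalizes K Q" "card Q = p_part q (card K)"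
          using Q by (auto simp: normal_sylow_def)
        show ?thesis
        proof (cases "Q \<subseteq> derived G K")
          case False
          then show ?thesis using normal_sylow_in_derived_or_complement[OF evK K(1) q Q] compl by blast
        next
          case True
          have fx: "conj_by g x = x" if "g \<in> Q" "x \<in> R" for g x
          proof (rule centralizes_if_trivial_mod[OF q Qs(1) _ r(1) Rs(1) a _ _ _ that])
            show "card Q = q ^ multiplicity q (card K)" using Qs(4) by (simp add: p_part_def)
            show "r \<noteq> q" using qr by simp
            show "normalizes Q R" using normalizes_mono[OF Rs(3)] Qs K by blast
            show "trivial_mod Q R W" if W: "normal_of_index r R W" for W
            proof -
              have "normalizes H W"
                using normal_if_normal_in_normal_sylow[OF ev H r(1) R] W by (simp add: normal_of_index_def)
              then have "trivial_mod (derived G K) R W"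
                using derived_trivial_mod[OF W Rs(1) r(1) K(1)] normalizes_mono Rs(3) K(2) by blast
              then show ?thesis using True by (auto simp: trivial_mod_def)
            qed
          qed
          have "normalizes H Q"
            using normalizes_set_mult_left[of Q R K] RK(1) Qs(3) normalizes_if_fixes[of R Q] fx
              subgroup.subset Rs(1) K(1) Qs(1) by metis
          moreover have "p_part q (card H) = p_part q (card K)"
            unfolding RK(3) using p_part_mult_coprime[OF q card_subgroup_pos[OF K(1)] qR]
            by (simp add: mult.commute)
          ultimately have "normal_sylow q H Q" using Qs K by (auto simp: normal_sylow_def)
          then show ?thesis by blast
        qed
      qed (use compl in blast)
    qed
  qed
qed

section \<open>Products of normal Sylow subgroups and intersections of coprime index\<close>

lemma ex_normal_Hall:
  assumes H: "subgroup H G" and A: "finite A" "\<And>p. p \<in> A \<Longrightarrow> prime p"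
    "\<And>p. p \<in> A \<Longrightarrow> \<exists>S. normal_sylow p H S"
  shows "\<exists>N. subgroup N G \<and> N \<subseteq> H \<and> normalizes H N \<and> card N = (\<Prod>p\<in>A. p_part p (card H))"
  using A
proof (induction A rule: finite_induct)
  case empty
  have "normalizes H {\<one>}" using subgroup_sub[OF H] by (auto simp: normalizes_def)
  then show ?case using triv_subgroup subgroup.one_closed[OF H] by (intro exI[of _ "{\<one>}"]) auto
next
  case (insert q A)
  obtain N where N: "subgroup N G" "N \<subseteq> H" "normalizes H N" "card N = (\<Prod>p\<in>A. p_part p (card H))"
    using insert by auto
  obtain S where S: "subgroup S G" "S \<subseteq> H" "normalizes H S" "card S = p_part q (card H)"
    using insert.prems(2)[of q] by (auto simp: normal_sylow_def)
  have "\<not> q dvd p_part p (card H)" if "p \<in> A" for p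
    using that insert.hyps(2) insert.prems(1)[of p] insert.prems(1)[of q]
    unfolding p_part_def by (metis insertCI prime_dvd_power primes_dvd_imp_eq)
  then have "\<not> q dvd card N"
    using N(4) insert.hyps(1) insert.prems(1)[of q] by (auto simp: prime_dvd_prod_iff)
  then have c: "coprime (card S) (card N)"
    unfolding S(4) by (intro coprime_p_part insert.prems(1)) auto
  have "subgroup (S <#> N) G" by (rule set_mult_subgroupI[OF S(1) N(1) normalizes_mono[OF N(3) S(2)]])
  moreover have "card (S <#> N) = card S * card N" by (rule card_set_mult_coprime[OF S(1) N(1) c])
  moreover have "normalizes H (S <#> N)"
    using normalizes_set_mult_right[OF _ _ _ S(3) N(3)] H S(1) N(1) subgroup.subset by metis
  ultimately show ?case
    using S(4) N(4) insert.hyps set_mult_sub[OF H S(2) N(2)] by auto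
qed

text \<open>Indices of subgroups that are powers of distinct primes multiply under intersection. The
  factor \<open>H\<close> in the intersection provides the value H when A is empty.\<close>

lemma card_Inter_coprime_index:
  assumes H: "subgroup H G" and A: "finite A" "\<And>p. p \<in> A \<Longrightarrow> prime p"
    "\<And>p. p \<in> A \<Longrightarrow> subgroup (J p) G" "\<And>p. p \<in> A \<Longrightarrow> J p \<subseteq> H"
    "\<And>p. p \<in> A \<Longrightarrow> card H = card (J p) * p ^ k p"
  shows "subgroup (H \<inter> \<Inter>(J ` A)) G \<and> card H = card (H \<inter> \<Inter>(J ` A)) * (\<Prod>p\<in>A. p ^ k p)"
  using A
proof (induction A rule: finite_induct)
  case empty
  then show ?case using H by simp
next
  case (insert q A)
  let ?L = "H \<inter> \<Inter>(J ` A)" and ?m = "\<Prod>p\<in>A. p ^ k p"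
  have L: "subgroup ?L G" "card H = card ?L * ?m" using insert by auto
  have J: "subgroup (J q) G" "J q \<subseteq> H" "card H = card (J q) * q ^ k q" "prime q"
    using insert.prems by auto
  have e: "H \<inter> \<Inter>(J ` insert q A) = ?L \<inter> J q" by auto
  have D: "subgroup (?L \<inter> J q) G" using subgroup_Int L J by blast
  have "\<not> q dvd p ^ k p" if "p \<in> A" for p
    using that insert.hyps(2) insert.prems(1)[of p] insert.prems(1)[of q]
    by (metis insertCI prime_dvd_power primes_dvd_imp_eq)
  then have "\<not> q dvd ?m"
    using insert.hyps(1) J(4) by (auto simp: prime_dvd_prod_iff)
  then have cop: "coprime (q ^ k q) ?m" using J(4) by (simp add: prime_imp_coprime)
  let ?n = "card (?L \<inter> J q)"
  obtain x where x: "card ?L = ?n * x" using card_subgroup_dvd[OF D L(1)] by (auto elim: dvdE)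
  obtain y where y: "card (J q) = ?n * y" using card_subgroup_dvd[OF D J(1)] by (auto elim: dvdE)
  have n0: "?n > 0" by (rule card_subgroup_pos[OF D])
  have eq: "x * ?m = y * q ^ k q"
  proof -
    have "?n * (x * ?m) = ?n * (y * q ^ k q)" using L(2) J(3) x y by (metis mult.assoc)
    then show ?thesis using n0 by (metis mult_left_cancel less_numeral_extra(3))
  qed
  \<comment> \<open>With y = |J_q : L \<inter> J_q| and m = |H : L|, the size of the set product
    gives y \<le> m. Conversely m divides y, since m is prime to q and divides y q^k.\<close>
  have "card (?L <#> J q) \<le> card H"
    using set_mult_sub[OF H Int_lower1 J(2)] H by (simp add: card_mono)
  then have "card ?L * card (J q) \<le> card H * ?n"
    using card_set_mult[OF L(1) J(1)] by (metis mult_le_mono1)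
  then have "?n * x * (?n * y) \<le> ?n * x * ?m * ?n" using x y L(2) by simp
  moreover have "?n * x > 0" using x card_subgroup_pos[OF L(1)] by simp
  ultimately have "y \<le> ?m" using n0 by (simp add: mult.assoc mult.left_commute mult.commute)
  have "?m dvd y * q ^ k q" using eq by (metis dvd_triv_right)
  then have "?m dvd y" using cop by (metis coprime_commute coprime_dvd_mult_left_iff)
  moreover have "y > 0" using y card_subgroup_pos[OF J(1)] by (cases y) auto
  ultimately have "y = ?m" using \<open>y \<le> ?m\<close> by (simp add: dvd_imp_le le_antisym)
  then have "card H = ?n * (q ^ k q * ?m)" using J(3) y by (simp add: mult.assoc mult.commute)
  then show ?case unfolding e using D insert.hyps by simp
qed

section \<open>Nilpotency and normal p-complements\<close>

lemma subgroup_lower_central: "subgroup (lower_central G n) G"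
proof (induction n)
  case 0
  show ?case by (simp add: subgroup_self)
next
  case (Suc n)
  have "{h \<otimes> k \<otimes> inv h \<otimes> inv k | h k. h \<in> lower_central G n \<and> k \<in> carrier G} \<subseteq> carrier G"
    using subgroup_sub[OF Suc] by auto
  then show ?case by (simp add: commutator_subgroup_def generate_is_subgroup)
qed

lemma commutator_subgroup_sub:
  assumes "subgroup Z G" "\<And>h k. h \<in> H \<Longrightarrow> k \<in> K \<Longrightarrow> h \<otimes> k \<otimes> inv h \<otimes> inv k \<in> Z"
  shows "commutator_subgroup G H K \<subseteq> Z"
  unfolding commutator_subgroup_def
  by (rule generate_subgroup_incl[OF _ assms(1)]) (use assms(2) in auto)

text \<open>Commutators of a normal Z with the whole group stay in Z, so the series never leaves it
  again. This allows the stages found for different primes to be merged into one later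
  stage.\<close>

lemma lower_central_sub_mono:
  assumes Z: "subgroup Z G" "normalizes (carrier G) Z" and "lower_central G n \<subseteq> Z" "n \<le> m"
  shows "lower_central G m \<subseteq> Z"
  using assms(4)
proof (induction m rule: dec_induct)
  case base
  show ?case by fact
next
  case (step m)
  have "h \<otimes> k \<otimes> inv h \<otimes> inv k \<in> Z" if "h \<in> lower_central G m" "k \<in> carrier G" for h k
  proof -
    have h: "h \<in> Z" "inv h \<in> Z" "h \<in> carrier G"
      using that step Z(1) subgroup_sub[OF Z(1)] by (auto simp: subgroup.m_inv_closed)
    have "h \<otimes> conj_by k (inv h) \<in> Z"
      using h subgroup.m_closed[OF Z(1)] normalizesD[OF Z(2) that(2)] by blast
    then show ?thesis using h that(2) by (simp add: conj_by_def m_assoc)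
  qed
  then show ?case using commutator_subgroup_sub[OF Z(1)] by simp
qed

lemma conj_by_l_coset:
  assumes Z: "subgroup Z G" "normalizes (carrier G) Z" and a: "a \<in> carrier G" and x: "x \<in> carrier G"
  shows "conj_by a ` (x <# Z) = conj_by a x <# Z"
proof -
  have s: "conj_by a ` Z \<subseteq> Z" using normalizesD[OF Z(2) a] by auto
  have e: "conj_by a ` Z = Z"
    by (rule card_subset_eq[OF finite_subgroup[OF Z(1)] s card_conj_by[OF a subgroup.subset[OF Z(1)]]])
  have "conj_by a ` (x <# Z) = (\<lambda>z. conj_by a x \<otimes> conj_by a z) ` Z"
  proof -
    have "x <# Z = (\<lambda>z. x \<otimes> z) ` Z" by (auto simp: l_coset_def)
    then show ?thesis
      unfolding \<open>x <# Z = _\<close> image_image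
      by (intro image_cong) (use a x subgroup_sub[OF Z(1)] in \<open>auto simp: conj_by_mult\<close>)
  qed
  also have "\<dots> = (\<lambda>z. conj_by a x \<otimes> z) ` conj_by a ` Z" by (simp add: image_image)
  also have "\<dots> = conj_by a x <# Z" unfolding e by (auto simp: l_coset_def)
  finally show ?thesis .
qed

text \<open>G/Z is a nontrivial p-group, and this is its nontrivial center, found without the
  quotient: a Sylow p-subgroup S acts by conjugation on the cosets of Z, their number is a positive
  power of p, and Z is fixed, so another coset is fixed too.\<close>

lemma ex_central_mod:
  assumes M: "normal_p_complement p (carrier G) M" and p: "prime p"
    and Z: "subgroup Z G" "M \<subseteq> Z" "normalizes (carrier G) Z" "Z \<noteq> carrier G"
  obtains x where "x \<in> carrier G" "x \<notin> Z" "\<And>g. g \<in> carrier G \<Longrightarrow> conj_by g x \<otimes> inv x \<in> Z"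
proof -
  obtain k where Ms: "subgroup M G" "normalizes (carrier G) M" "\<not> p dvd card M"
    "card (carrier G) = card M * p ^ k" using M by (auto simp: normal_p_complement_def)
  obtain S where S: "subgroup S G" "card S = p ^ k"
    using sylow_in[OF subgroup_self p, of k] Ms(4) by auto
  have "coprime (card S) (card M)" using S(2) Ms(3) p by (simp add: prime_imp_coprime)
  then have SM: "S <#> M = carrier G"
    using card_set_mult_coprime[OF S(1) Ms(1)] Ms(4) S(2)
      card_subset_eq[OF finite_carrier
        set_mult_sub[OF subgroup_self subgroup.subset[OF S(1)] subgroup.subset[OF Ms(1)]]]
    by simp
  note Sc = subgroup_sub[OF S(1)] and Zc = subgroup_sub[OF Z(1)] and Mc = subgroup_sub[OF Ms(1)]
  let ?E = "(\<lambda>x. x <# Z) ` carrier G"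
  have cE: "card (carrier G) = card ?E * card Z"
    by (rule card_l_cosets[OF subgroup_self Z(1) subgroup.subset[OF Z(1)]])
  obtain z where z: "card Z = card M * z"
    using card_subgroup_dvd[OF Ms(1) Z(1,2)] by (auto elim: dvdE)
  have "card M * p ^ k = card M * (card ?E * z)" using cE z Ms(4) by (metis mult.left_commute)
  then have "p ^ k = card ?E * z" using card_subgroup_pos[OF Ms(1)] by simp
  then have "card ?E dvd p ^ k" by (metis dvd_triv_left)
  then obtain j where j: "card ?E = p ^ j" using divides_primepow_nat[OF p] by auto
  have "j \<noteq> 0"
  proof
    assume "j = 0"
    then have "card Z = card (carrier G)" using cE j by simp
    then show False using Z(4) card_subset_eq[OF finite_carrier subgroup.subset[OF Z(1)]] by blast
  qed
  then have "p dvd card ?E" using j by simp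
  moreover have "p dvd card ?E \<longleftrightarrow> p dvd card {e\<in>?E. \<forall>a\<in>S. conj_by a ` e = e}"
  proof (rule fixed_points_cong[OF S p])
    show "finite ?E" using finite_carrier by simp
    fix a e assume a: "a \<in> S" "e \<in> ?E"
    then show "conj_by a ` e \<in> ?E" using conj_by_l_coset[OF Z(1,3)] Sc by auto
  next
    fix e assume "e \<in> ?E"
    then obtain x where "x \<in> carrier G" "e = x <# Z" by auto
    then show "conj_by \<one> ` e = e" using conj_by_l_coset[OF Z(1,3), of \<one> x] by simp
  next
    fix a b e assume ab: "a \<in> S" "b \<in> S" "e \<in> ?E"
    then obtain x where "x \<in> carrier G" "e = x <# Z" by auto
    then show "conj_by (a \<otimes> b) ` e = conj_by a ` conj_by b ` e"
      using conj_by_l_coset[OF Z(1,3)] Sc ab(1,2) by (simp add: conj_by_conj_by)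
  qed
  ultimately have d: "p dvd card {e\<in>?E. \<forall>a\<in>S. conj_by a ` e = e}" (is "p dvd card ?F") by simp
  have "?F \<noteq> {\<one> <# Z}"
  proof
    assume "?F = {\<one> <# Z}"
    then show False using d p by simp
  qed
  moreover have "\<one> <# Z \<in> ?F"
    using conj_by_l_coset[OF Z(1,3), of _ \<one>] Sc imageI[OF one_closed, of "\<lambda>x. x <# Z"] by simp
  ultimately obtain e where e: "e \<in> ?F" "e \<noteq> \<one> <# Z" by blast
  then obtain x where x: "x \<in> carrier G" "e = x <# Z" by auto
  have "x \<notin> Z"
  proof
    assume "x \<in> Z"
    then have "\<one> <# Z = x <# Z" using l_coset_eq_iff[OF Z(1), of \<one> x] x by simp
    then show False using e x by simp
  qed
  have xS: "conj_by s x \<otimes> inv x \<in> Z" if s: "s \<in> S" for s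
  proof -
    have "x <# Z = conj_by s x <# Z" using e(1) x s conj_by_l_coset[OF Z(1,3)] Sc by auto
    then have "inv x \<otimes> conj_by s x \<in> Z" using l_coset_eq_iff[OF Z(1)] x Sc s by simp
    then have "conj_by x (inv x \<otimes> conj_by s x) \<in> Z" by (rule normalizesD[OF Z(3) x(1)])
    then show ?thesis using x Sc s by (simp add: conj_by_def m_assoc inv_mult_cancel)
  qed
  have "conj_by g x \<otimes> inv x \<in> Z" if g: "g \<in> carrier G" for g
  proof -
    obtain s m where sm: "s \<in> S" "m \<in> M" "g = s \<otimes> m" using SM[symmetric] g by (auto simp: set_mult_def)
    have c: "s \<in> carrier G" "m \<in> carrier G" using sm Sc Mc by auto
    \<comment> \<open>The factor m acts trivially modulo Z because its commutator with x lies in the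
      normal subgroup M, which is contained in Z.\<close>
    have "conj_by x (inv m) \<in> M" using normalizesD[OF Ms(2) x(1)] sm Ms(1) by (simp add: subgroup.m_inv_closed)
    then have "m \<otimes> conj_by x (inv m) \<in> Z" using sm Z(2) subgroup.m_closed[OF Ms(1)] by blast
    then have "conj_by m x \<otimes> inv x \<in> Z" using c x by (simp add: conj_by_def m_assoc)
    then have "conj_by s (conj_by m x \<otimes> inv x) \<in> Z" by (rule normalizesD[OF Z(3) c(1)])
    then have "conj_by s (conj_by m x \<otimes> inv x) \<otimes> (conj_by s x \<otimes> inv x) \<in> Z"
      using xS[OF sm(1)] subgroup.m_closed[OF Z(1)] by blast
    moreover have "conj_by g x \<otimes> inv x = conj_by s (conj_by m x \<otimes> inv x) \<otimes> (conj_by s x \<otimes> inv x)"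
      using c x sm(3) by (simp add: conj_by_mult conj_by_inv conj_by_conj_by m_assoc inv_mult_cancel)
    ultimately show ?thesis by simp
  qed
  then show ?thesis using that x \<open>x \<notin> Z\<close> by blast
qed

text \<open>C is the preimage in G of the center of G/Z, written elementwise. It is the step from Z
  to the next term of an upper central series.\<close>

lemma central_mod_subgroup:
  assumes Z: "subgroup Z G" "normalizes (carrier G) Z"
  defines "C \<equiv> {x\<in>carrier G. \<forall>g\<in>carrier G. conj_by g x \<otimes> inv x \<in> Z}"
  shows "subgroup C G" "normalizes (carrier G) C" "Z \<subseteq> C"
proof -
  note Zc = subgroup_sub[OF Z(1)]
  have Zi: "inv z \<in> Z" if "z \<in> Z" for z using that Z(1) by (simp add: subgroup.m_inv_closed)
  have Zm: "y \<otimes> z \<in> Z" if "y \<in> Z" "z \<in> Z" for y z using that Z(1) by (simp add: subgroup.m_closed)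
  show "subgroup C G"
  proof
    show "C \<subseteq> carrier G" by (auto simp: C_def)
    show "\<one> \<in> C" using subgroup.one_closed[OF Z(1)] by (simp add: C_def)
    fix x assume x: "x \<in> C"
    have "conj_by g (inv x) \<otimes> inv (inv x) \<in> Z" if g: "g \<in> carrier G" for g
    proof -
      have "conj_by (inv x) (inv (conj_by g x \<otimes> inv x)) \<in> Z"
        using x g by (intro normalizesD[OF Z(2)] Zi) (auto simp: C_def)
      moreover have "x \<in> carrier G" using x by (simp add: C_def)
      ultimately show ?thesis
        using g by (simp add: conj_by_inv inv_mult_group conj_by_def m_assoc inv_mult_cancel)
    qed
    then show "inv x \<in> C" using x by (simp add: C_def)
    fix y assume y: "y \<in> C"
    have xy: "x \<in> carrier G" "y \<in> carrier G" using x y by (auto simp: C_def)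
    have "conj_by g (x \<otimes> y) \<otimes> inv (x \<otimes> y) \<in> Z" if g: "g \<in> carrier G" for g
    proof -
      have "(conj_by g x \<otimes> inv x) \<otimes> conj_by x (conj_by g y \<otimes> inv y) \<in> Z"
        using x y g xy by (intro Zm[OF _ normalizesD[OF Z(2)]]) (simp_all add: C_def)
      then show ?thesis
        using g xy by (simp add: inv_mult_group conj_by_def m_assoc inv_mult_cancel)
    qed
    then show "x \<otimes> y \<in> C" using xy by (simp add: C_def)
  qed
  show "normalizes (carrier G) C"
  proof (rule normalizesI)
    fix h x assume h: "h \<in> carrier G" and x: "x \<in> C"
    have xc: "x \<in> carrier G" using x by (simp add: C_def)
    have "conj_by g (conj_by h x) \<otimes> inv (conj_by h x) \<in> Z" if g: "g \<in> carrier G" for g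
    proof -
      have "conj_by h (conj_by (inv h \<otimes> g \<otimes> h) x \<otimes> inv x) \<in> Z"
        using x g h by (intro normalizesD[OF Z(2)]) (auto simp: C_def)
      then show ?thesis
        using g xc h by (simp add: inv_mult_group conj_by_def m_assoc inv_mult_cancel)
    qed
    then show "conj_by h x \<in> C" using h xc by (simp add: C_def)
  qed
  show "Z \<subseteq> C" using Zi Zm Zc normalizesD[OF Z(2)] by (auto simp: C_def)
qed

text \<open>G/M is a p-group, hence nilpotent. Starting from Z and passing to the preimage of the
  center of G/Z enlarges Z until G is reached; each such step costs one term of the lower central
  series.\<close>

lemma ex_lower_central_sub:
  assumes M: "normal_p_complement p (carrier G) M" and p: "prime p"
  shows "\<exists>n. lower_central G n \<subseteq> M"
proof -
  have "\<exists>n. lower_central G n \<subseteq> Z" if "subgroup Z G" "M \<subseteq> Z" "normalizes (carrier G) Z" for Z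
    using that
  proof (induction "card (carrier G) - card Z" arbitrary: Z rule: less_induct)
    case less
    show ?case
    proof (cases "Z = carrier G")
      case True
      then show ?thesis by (intro exI[of _ 0]) simp
    next
      case False
      note Z = less.prems
      let ?C = "{x\<in>carrier G. \<forall>g\<in>carrier G. conj_by g x \<otimes> inv x \<in> Z}"
      note C = central_mod_subgroup[OF Z(1,3)]
      obtain x where x: "x \<in> carrier G" "x \<notin> Z" "\<And>g. g \<in> carrier G \<Longrightarrow> conj_by g x \<otimes> inv x \<in> Z"
        using ex_central_mod[OF M p Z False] by blast
      have "Z \<subset> ?C" using C(3) x by blast
      then have "card Z < card ?C" using psubset_card_mono finite_subgroup[OF C(1)] by blast
      moreover have "card ?C \<le> card (carrier G)" by (rule card_mono[OF finite_carrier]) auto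
      ultimately have "card (carrier G) - card ?C < card (carrier G) - card Z" by linarith
      then obtain n where n: "lower_central G n \<subseteq> ?C"
        using less.hyps[of ?C] C Z(2) by blast
      have "h \<otimes> k \<otimes> inv h \<otimes> inv k \<in> Z" if "h \<in> lower_central G n" "k \<in> carrier G" for h k
      proof -
        have "h \<in> ?C" using that(1) n by blast
        then have h: "h \<in> carrier G" "inv (conj_by k h \<otimes> inv h) \<in> Z"
          using that(2) Z(1) by (auto simp: subgroup.m_inv_closed)
        then show ?thesis using that(2) by (simp add: conj_by_def inv_mult_group m_assoc)
      qed
      then have "lower_central G (Suc n) \<subseteq> Z" using commutator_subgroup_sub[OF Z(1)] by simp
      then show ?thesis by blast
    qed
  qed
  then show ?thesis using M by (auto simp: normal_p_complement_def)
qed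

text \<open>For each p the series eventually enters a subgroup of order prime to p and stays there.
  Beyond all these stages its order has no prime divisor left.\<close>

lemma nilpotent_if_normal_p_complements:
  assumes "\<And>p. prime p \<Longrightarrow> p dvd card (carrier G) \<Longrightarrow> \<exists>M. normal_p_complement p (carrier G) M"
  shows "nilpotent_group G"
proof -
  let ?A = "prime_factors (card (carrier G))"
  have pos: "card (carrier G) > 0" using card_subgroup_pos[OF subgroup_self] .
  have "\<exists>n. \<forall>m\<ge>n. \<not> p dvd card (lower_central G m)" if "p \<in> ?A" for p
  proof -
    have p: "prime p" "p dvd card (carrier G)" using that by (auto simp: prime_factors_dvd)
    obtain M where M: "normal_p_complement p (carrier G) M" using assms[OF p] by blast
    obtain n where n: "lower_central G n \<subseteq> M" using ex_lower_central_sub[OF M p(1)] by blast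
    have Ms: "subgroup M G" "normalizes (carrier G) M" "\<not> p dvd card M"
      using M by (auto simp: normal_p_complement_def)
    have "\<not> p dvd card (lower_central G m)" if "m \<ge> n" for m
      using card_subgroup_dvd[OF subgroup_lower_central Ms(1) lower_central_sub_mono[OF Ms(1,2) n that]]
        Ms(3) dvd_trans by blast
    then show ?thesis by blast
  qed
  then obtain f where f: "\<And>p m. p \<in> ?A \<Longrightarrow> m \<ge> f p \<Longrightarrow> \<not> p dvd card (lower_central G m)" by metis
  \<comment> \<open>The sum serves as a common upper bound for the finitely many stages
    \<open>f p\<close>.\<close>
  let ?L = "lower_central G (sum f ?A)"
  have L: "subgroup ?L G" by (rule subgroup_lower_central)
  have "card ?L = 1"
  proof (rule ccontr)
    assume "card ?L \<noteq> 1"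
    then obtain p where p: "prime p" "p dvd card ?L" using prime_factor_nat by blast
    then have "p dvd card (carrier G)"
      using card_subgroup_dvd[OF L subgroup_self subgroup.subset[OF L]] dvd_trans by blast
    then have pA: "p \<in> ?A" using p pos by (simp add: prime_factors_dvd)
    then have "f p \<le> sum f ?A" by (intro member_le_sum) auto
    then show False using f[OF pA] p by blast
  qed
  then have "?L = {\<one>}" using subgroup.one_closed[OF L] by (auto simp: card_1_singleton_iff)
  then show ?thesis using is_group unfolding nilpotent_group_def by blast
qed

text \<open>Let l be the last stage before the lower central series enters H. An x of that stage
  outside H has its commutators with H in the next stage, hence in H, so it normalizes H.\<close>

lemma nilpotent_normalizer_grows:
  assumes "nilpotent_group G" and H: "subgroup H G" "H \<noteq> carrier G"
  obtains x where "x \<in> carrier G" "x \<notin> H" "\<And>h. h \<in> H \<Longrightarrow> conj_by x h \<in> H"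
proof -
  let ?P = "\<lambda>n. lower_central G n \<subseteq> H"
  obtain m where "lower_central G m = {\<one>}" using assms(1) by (auto simp: nilpotent_group_def)
  then have "?P m" using subgroup.one_closed[OF H(1)] by simp
  define n where "n = (LEAST n. ?P n)"
  have n: "?P n" unfolding n_def by (rule LeastI[of ?P, OF \<open>?P m\<close>])
  have "n \<noteq> 0" using n H subgroup.subset[OF H(1)] by (intro notI) auto
  then obtain l where l: "n = Suc l" by (cases n) auto
  have "\<not> ?P l" using not_less_Least[of l ?P] l by (simp add: n_def)
  then obtain x where x: "x \<in> lower_central G l" "x \<notin> H" by blast
  have xc: "x \<in> carrier G" using x subgroup_sub[OF subgroup_lower_central] by blast
  show ?thesis
  proof (rule that[OF xc x(2)])
    fix h assume h: "h \<in> H"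
    have hc: "h \<in> carrier G" using h subgroup_sub[OF H(1)] by blast
    have "x \<otimes> h \<otimes> inv x \<otimes> inv h \<in> lower_central G n"
      unfolding l lower_central.simps commutator_subgroup_def
      using x hc by (intro generate.incl) auto
    then have "x \<otimes> h \<otimes> inv x \<otimes> inv h \<otimes> h \<in> H" using n h subgroup.m_closed[OF H(1)] by blast
    then show "conj_by x h \<in> H" using xc hc by (simp add: conj_by_def m_assoc)
  qed
qed

text \<open>Take H maximal among the subgroups in which S is normal. If H were proper, its
  normalizer would be larger, and S, a normal Hall subgroup of H, would be normal there as
  well.\<close>

lemma nilpotent_normal_sylow:
  assumes nil: "nilpotent_group G" and p: "prime p"
  shows "\<exists>S. normal_sylow p (carrier G) S"
proof -
  obtain S where S: "subgroup S G" "card S = p_part p (card (carrier G))"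
    using sylow_in[OF subgroup_self p, of "multiplicity p (card (carrier G))"]
      p_part_dvd[of p "card (carrier G)"]
    unfolding p_part_def by blast
  obtain m where m: "card (carrier G) = card S * m" "\<not> p dvd m"
    using p_part_decompose[OF p card_subgroup_pos[OF subgroup_self]] S(2) by metis
  let ?A = "{H. subgroup H G \<and> S \<subseteq> H \<and> normalizes H S}"
  have "finite ?A" using finite_carrier
    by (rule_tac finite_subset[of _ "Pow (carrier G)"]) (auto dest: subgroup.subset)
  moreover have "S \<in> ?A" using S normalizes_self by auto
  ultimately obtain H where H: "H \<in> ?A" "\<And>X. X \<in> ?A \<Longrightarrow> H \<subseteq> X \<Longrightarrow> H = X"
    using finite_has_maximal[of ?A] by (metis (lifting) empty_iff)
  have Hs: "subgroup H G" "S \<subseteq> H" "normalizes H S" using H(1) by auto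
  have "H = carrier G"
  proof (rule ccontr)
    assume "H \<noteq> carrier G"
    then obtain x where x: "x \<in> carrier G" "x \<notin> H" "\<And>h. h \<in> H \<Longrightarrow> conj_by x h \<in> H"
      using nilpotent_normalizer_grows[OF nil Hs(1)] by blast
    let ?N = "{x\<in>carrier G. \<forall>w\<in>H. conj_by x w \<in> H}"
    have N: "subgroup ?N G" by (rule subgroup_normalizing[OF subgroup_self Hs(1)])
    have HN: "H \<subseteq> ?N"
      using normalizesD[OF normalizes_self[OF Hs(1) subset_refl]] subgroup.subset[OF Hs(1)] by auto
    obtain l where l: "card H = card S * l" "l dvd m"
      using subgroup_card_factor[OF S(1) Hs(1) subgroup_self Hs(2) subgroup.subset[OF Hs(1)] m(1)] by blast
    have "\<not> p dvd l" using l(2) m(2) dvd_trans by blast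
    then have "coprime (card S) l" using coprime_p_part[OF p] S(2) by simp
    moreover have "normalizes ?N H" by (auto simp: normalizes_def)
    ultimately have "normalizes ?N S"
      using normalizes_Hall_trans[OF N Hs(1) HN S(1) Hs(2) _ Hs(3) l(1)] by simp
    then have "?N \<in> ?A" using N HN Hs(2) by blast
    then have "H = ?N" using H(2) HN by blast
    then show False using x by blast
  qed
  then show ?thesis using Hs S by (auto simp: normal_sylow_def)
qed

section \<open>Nilpotency of subgroups viewed as groups\<close>

lemma finite_group_sub: "subgroup K G \<Longrightarrow> finite_group (G\<lparr>carrier := K\<rparr>)"
  using subgroup_imp_group finite_subgroup by (simp add: finite_group_def finite_group_axioms_def)

lemma normalizes_sub_iff:
  assumes "subgroup K G" "A \<subseteq> K"
  shows "group.normalizes (G\<lparr>carrier := K\<rparr>) A B \<longleftrightarrow> normalizes A B"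
proof -
  interpret K: group "G\<lparr>carrier := K\<rparr>" by (rule subgroup_imp_group[OF assms(1)])
  show ?thesis using assms by (auto simp: K.normalizes_def normalizes_def K.conj_by_def conj_by_def subset_iff)
qed

lemma nilpotent_subgroup_if_normal_p_complements:
  assumes K: "subgroup K G"
    and c: "\<And>p. prime p \<Longrightarrow> p dvd card K \<Longrightarrow> \<exists>M. normal_p_complement p K M"
  shows "nilpotent_group (G\<lparr>carrier := K\<rparr>)"
proof -
  interpret K: finite_group "G\<lparr>carrier := K\<rparr>" by (rule finite_group_sub[OF K])
  show ?thesis
  proof (rule K.nilpotent_if_normal_p_complements)
    fix p :: nat assume "prime p" "p dvd card (carrier (G\<lparr>carrier := K\<rparr>))"
    then obtain M where "normal_p_complement p K M" using c by auto
    then have "K.normal_p_complement p K M"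
      using subgroup_incl[OF _ K] normalizes_sub_iff[OF K subset_refl]
      by (auto simp: K.normal_p_complement_def normal_p_complement_def)
    then show "\<exists>M. K.normal_p_complement p (carrier (G\<lparr>carrier := K\<rparr>)) M" by auto
  qed
qed

lemma normal_sylow_of_nilpotent_subgroup:
  assumes K: "subgroup K G" and "nilpotent_group (G\<lparr>carrier := K\<rparr>)" "prime p"
  shows "\<exists>S. normal_sylow p K S"
proof -
  interpret K: finite_group "G\<lparr>carrier := K\<rparr>" by (rule finite_group_sub[OF K])
  obtain S where "K.normal_sylow p K S" using K.nilpotent_normal_sylow[OF assms(2,3)] by auto
  then have "normal_sylow p K S"
    using incl_subgroup[OF K] normalizes_sub_iff[OF K subset_refl]
    by (auto simp: K.normal_sylow_def normal_sylow_def)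
  then show ?thesis by blast
qed

text \<open>The index |K : K \<inter> M| equals |K M : M|, a divisor of the power |H : M| of
  p.\<close>

lemma normal_p_complement_Int:
  assumes M: "normal_p_complement p H M" and p: "prime p" and H: "subgroup H G"
    and K: "subgroup K G" "K \<subseteq> H"
  shows "normal_p_complement p K (K \<inter> M)"
proof -
  obtain k where Ms: "subgroup M G" "M \<subseteq> H" "normalizes H M" "\<not> p dvd card M" "card H = card M * p ^ k"
    using M by (auto simp: normal_p_complement_def)
  have D: "subgroup (K \<inter> M) G" using subgroup_Int K Ms by blast
  have KM: "subgroup (K <#> M) G"
    using set_mult_subgroupI[OF K(1) Ms(1)] normalizes_mono[OF Ms(3) K(2)] by simp
  obtain d where d: "card (K <#> M) = card M * d"
    using card_subgroup_dvd[OF Ms(1) KM sub_set_mult_right[OF K(1) Ms(1)]] by (auto elim: dvdE)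
  have "card M * d dvd card M * p ^ k"
    using card_subgroup_dvd[OF KM H set_mult_sub[OF H K(2) Ms(2)]] d Ms(5) by simp
  then have "d dvd p ^ k" using card_subgroup_pos[OF Ms(1)] by simp
  then obtain e where e: "d = p ^ e" using divides_primepow_nat[OF p] by auto
  have "card M * d * card (K \<inter> M) = card K * card M" using card_set_mult[OF K(1) Ms(1)] d by simp
  then have "card K = card (K \<inter> M) * p ^ e"
    using card_subgroup_pos[OF Ms(1)] e by (simp add: mult.commute)
  moreover have "\<not> p dvd card (K \<inter> M)"
    using card_subgroup_dvd[OF D Ms(1)] Ms(4) dvd_trans by blast
  moreover have "normalizes K (K \<inter> M)"
    using normalizes_Int normalizes_self[OF K(1) subset_refl] normalizes_mono[OF Ms(3) K(2)] by blast
  ultimately show ?thesis using D by (auto simp: normal_p_complement_def)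
qed

end

section \<open>Decomposition of evolving groups\<close>

lemma not_dvd_of_p_part_dvd:
  fixes n :: nat
  assumes p: "prime p" "n > 0" "n = N * m" "p_part p n dvd N"
  shows "\<not> p dvd m"
proof
  assume "p dvd m"
  obtain b where b: "n = p_part p n * b" "\<not> p dvd b" using p_part_decompose[OF p(1,2)] by blast
  obtain c where c: "N = p_part p n * c" using p(4) by (auto elim: dvdE)
  have "p_part p n * b = p_part p n * (c * m)" using b(1) c p(3) by (metis mult.assoc)
  moreover have "p_part p n > 0" using prime_gt_0_nat[OF p(1)] by (simp add: p_part_def)
  ultimately have "b = c * m" by simp
  then show False using \<open>p dvd m\<close> b(2) by simp
qed

lemma prime_dvd_prod_p_parts:
  assumes "finite A" "\<And>p. p \<in> A \<Longrightarrow> prime p" "prime q" "q dvd (\<Prod>p\<in>A. p_part p n)"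
  shows "q \<in> A"
proof -
  obtain p where p: "p \<in> A" "q dvd p_part p n"
    using assms(1,3,4) by (auto simp: prime_dvd_prod_iff)
  then have "q dvd p" unfolding p_part_def using assms(3) prime_dvd_power by blast
  then show ?thesis using p(1) assms(2,3) primes_dvd_imp_eq by blast
qed

context finite_group
begin

lemma Hall_subgroup_sub:
  assumes H: "subgroup H G" and A: "finite A" "\<And>p. p \<in> A \<Longrightarrow> prime p"
    and N: "subgroup N G" "N \<subseteq> H" "normalizes H N" "card N = (\<Prod>p\<in>A. p_part p (card H))"
    and X: "subgroup X G" "X \<subseteq> H" "\<And>p. prime p \<Longrightarrow> p dvd card X \<Longrightarrow> p \<in> A"
  shows "X \<subseteq> N"
proof -
  obtain m where m: "card H = card N * m" using card_subgroup_dvd[OF N(1) H N(2)] by (auto elim: dvdE)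
  have "coprime (card X) m"
  proof (rule coprime_if_no_common_prime)
    fix p :: nat assume p: "prime p" "p dvd card X" "p dvd m"
    then have "p \<in> A" using X(3) by blast
    then have "p_part p (card H) dvd card N" unfolding N(4) using A(1) by (intro dvd_prodI)
    then show False using not_dvd_of_p_part_dvd[OF p(1) card_subgroup_pos[OF H] m] p(3) by blast
  qed
  then show ?thesis
    using subset_of_coprime_index[OF H X(1,2) N(1,2) _ m] normalizes_mono[OF N(3) X(2)] by blast
qed

text \<open>For each \<open>q\<close> take \<open>J\<^sub>q\<close> as in the definition of evolving for a Sylow \<open>q\<close>-subgroup of \<open>U\<close>, and
  let \<open>J\<close> be their intersection. Then \<open>J \<inter> N = U\<close>, so \<open>J\<close> normalizes \<open>U\<close>, and \<open>N J = G\<close>.\<close>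

lemma conj_subgroup_of_Hall:
  assumes ev: "evolving_in (carrier G)" and A: "finite A" "\<And>p. p \<in> A \<Longrightarrow> prime p"
    "\<And>p. p \<in> A \<Longrightarrow> \<exists>S. normal_sylow p (carrier G) S"
    and N: "subgroup N G" "normalizes (carrier G) N"
      "card N = (\<Prod>p\<in>A. p_part p (card (carrier G)))"
    and U: "subgroup U G" "U \<subseteq> N" and t: "t \<in> carrier G"
  shows "\<exists>x\<in>N. conj_by t ` U = conj_by x ` U"
proof -
  let ?g = "card (carrier G)"
  have Nc: "N \<subseteq> carrier G" by (rule subgroup.subset[OF N(1)])
  have NA: "p \<in> A" if "prime p" "p dvd card N" for p
    using prime_dvd_prod_p_parts[OF A(1,2)] that N(3) by metis
  have "\<exists>J k. subgroup J G \<and> U \<subseteq> J \<and> ?g = card J * q ^ k \<and>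
      (\<forall>e. q ^ e dvd card J \<longrightarrow> q ^ e dvd card U)" if q: "q \<in> A" for q
  proof -
    have pq: "prime q" by (rule A(2)[OF q])
    obtain I where I: "subgroup I G" "I \<subseteq> U" "card I = q ^ multiplicity q (card U)"
      using sylow_in[OF U(1) pq] p_part_dvd[of q "card U"] unfolding p_part_def by metis
    obtain J b k where J: "subgroup J G" "I \<subseteq> J" "J \<subseteq> carrier G" "card J = card I * b"
      "?g = card J * q ^ k" "\<not> q dvd b"
      using evolving_inE[OF ev pq I(1) _ I(3)] subgroup.subset[OF I(1)] by blast
    \<comment> \<open>The normal Hall subgroup for the other primes of A has order prime to q, while
      |G : J| is a power of q, so J contains it. It carries the Sylow s-subgroups of U for s
      \<noteq> q; the one for q is I.\<close>
    obtain M where M: "subgroup M G" "M \<subseteq> carrier G" "normalizes (carrier G) M"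
      "card M = (\<Prod>p\<in>A - {q}. p_part p ?g)"
      using ex_normal_Hall[OF subgroup_self, of "A - {q}"] A by auto
    have Aq: "finite (A - {q})" "\<And>p. p \<in> A - {q} \<Longrightarrow> prime p" using A by auto
    have MA: "p \<in> A - {q}" if "prime p" "p dvd card M" for p
      using prime_dvd_prod_p_parts[OF Aq] that M(4) by metis
    have "\<not> q dvd card M" using MA[OF pq] by blast
    then have "coprime (card M) (q ^ k)" using pq by (simp add: prime_imp_coprime coprime_commute)
    then have MJ: "M \<subseteq> J"
      using subset_of_coprime_index[OF subgroup_self M(1,2) J(1,3) _ J(5)] normalizes_mono[OF M(3) J(3)]
      by blast
    have JU: "subgroup (J \<inter> U) G" using subgroup_Int J U by blast
    have "J \<inter> U = U"
    proof (rule subgroup_eqI_p_parts[OF JU U(1) Int_lower2])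
      fix s assume s: "prime s" "s dvd card U"
      show "\<exists>S. subgroup S G \<and> S \<subseteq> J \<inter> U \<and> card S = p_part s (card U)"
      proof (cases "s = q")
        case True
        then show ?thesis using I J(2) by (intro exI[of _ I]) (auto simp: p_part_def)
      next
        case False
        have "s dvd card N" using s(2) card_subgroup_dvd[OF U(1) N(1) U(2)] dvd_trans by blast
        then have sA: "s \<in> A - {q}" using NA[OF s(1)] False by simp
        obtain S where S: "subgroup S G" "S \<subseteq> U" "card S = s ^ multiplicity s (card U)"
          using sylow_in[OF U(1) s(1)] p_part_dvd[of s "card U"] unfolding p_part_def by metis
        have SA: "p \<in> A - {q}" if "prime p" "p dvd card S" for p
          using that S(3) s(1) sA by (metis prime_dvd_power primes_dvd_imp_eq)
        have "S \<subseteq> M"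
          by (rule Hall_subgroup_sub[OF subgroup_self Aq M S(1) subgroup.subset[OF S(1)] SA])
        then show ?thesis using S MJ by (intro exI[of _ S]) (auto simp: p_part_def)
      qed
    qed
    then have "U \<subseteq> J" by blast
    moreover have "q ^ e dvd card U" if "q ^ e dvd card J" for e
    proof -
      have "coprime (q ^ e) b" using J(6) pq by (simp add: prime_imp_coprime)
      then have "q ^ e dvd card I" using that J(4) coprime_dvd_mult_left_iff by metis
      then show ?thesis using card_subgroup_dvd[OF I(1) U(1) I(2)] dvd_trans by blast
    qed
    ultimately show ?thesis using J(1,5) by blast
  qed
  then obtain J k where J: "\<And>q. q \<in> A \<Longrightarrow> subgroup (J q) G" "\<And>q. q \<in> A \<Longrightarrow> U \<subseteq> J q"
    "\<And>q. q \<in> A \<Longrightarrow> ?g = card (J q) * q ^ k q"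
    "\<And>q e. q \<in> A \<Longrightarrow> q ^ e dvd card (J q) \<Longrightarrow> q ^ e dvd card U"
    by metis
  let ?J = "carrier G \<inter> \<Inter>(J ` A)"
  have "subgroup ?J G \<and> ?g = card ?J * (\<Prod>p\<in>A. p ^ k p)"
    by (rule card_Inter_coprime_index[OF subgroup_self A(1,2)]) (use J(1,3) subgroup.subset[OF J(1)] in auto)
  then have K: "subgroup ?J G" "?g = card ?J * (\<Prod>p\<in>A. p ^ k p)" by auto
  have D: "subgroup (?J \<inter> N) G" using subgroup_Int K N by blast
  \<comment> \<open>All primes of |N| belong to A, and for s in A the s-part of the intersection is
    already bounded through \<open>J s\<close> by that of |U|.\<close>
  have "card (?J \<inter> N) dvd card U"
  proof (rule dvd_if_p_parts_dvd[OF card_subgroup_pos[OF D]])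
    fix s :: nat assume s: "prime s" "s dvd card (?J \<inter> N)"
    have "s dvd card N" using s(2) card_subgroup_dvd[OF D N(1)] dvd_trans by blast
    then have sA: "s \<in> A" using NA s by blast
    have "card (?J \<inter> N) dvd card (J s)" using card_subgroup_dvd[OF D J(1)[OF sA]] sA by blast
    then have "p_part s (card (?J \<inter> N)) dvd card (J s)" using p_part_dvd dvd_trans by blast
    then show "p_part s (card (?J \<inter> N)) dvd card U" unfolding p_part_def by (rule J(4)[OF sA])
  qed
  moreover have "U \<subseteq> ?J \<inter> N" using J(2) U subgroup.subset[OF U(1)] by auto
  ultimately have JN: "?J \<inter> N = U" using subgroup_eqI_card[OF U(1) D] by simp
  have nJN: "normalizes ?J N" using normalizes_mono[OF N(2)] by simp
  have NJ: "subgroup (N <#> ?J) G" by (rule set_mult_subgroupI'[OF N(1) K(1) nJN])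
  have "N <#> ?J = carrier G"
  proof (rule subgroup_eqI_card[OF NJ subgroup_self subgroup.subset[OF NJ]])
    show "?g dvd card (N <#> ?J)"
    proof (rule dvd_if_p_parts_dvd[OF card_subgroup_pos[OF subgroup_self]])
      fix s :: nat assume s: "prime s" "s dvd ?g"
      show "p_part s ?g dvd card (N <#> ?J)"
      proof (cases "s \<in> A")
        case True
        then have "p_part s ?g dvd card N" unfolding N(3) using A(1) by (intro dvd_prodI)
        then show ?thesis
          using card_subgroup_dvd[OF N(1) NJ sub_set_mult_left[OF N(1) K(1)]] dvd_trans by blast
      next
        case False
        then have "\<not> s dvd p ^ k p" if "p \<in> A" for p
          using that s(1) A(2)[OF that] by (metis prime_dvd_power primes_dvd_imp_eq)
        then have "\<not> s dvd (\<Prod>p\<in>A. p ^ k p)" using A(1) s(1) by (auto simp: prime_dvd_prod_iff)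
        then have "p_part s ?g = p_part s (card ?J)"
          unfolding K(2) by (rule p_part_mult_coprime[OF s(1) card_subgroup_pos[OF K(1)]])
        then have "p_part s ?g dvd card ?J" using p_part_dvd by simp
        then show ?thesis
          using card_subgroup_dvd[OF K(1) NJ sub_set_mult_right[OF N(1) K(1)]] dvd_trans by blast
      qed
    qed
  qed
  then have "t \<in> N <#> ?J" using t by simp
  then obtain x j where xj: "x \<in> N" "j \<in> ?J" "t = x \<otimes> j" unfolding set_mult_def by blast
  have jc: "j \<in> carrier G" "x \<in> carrier G" using xj Nc by auto
  have "normalizes ?J (?J \<inter> N)" by (rule normalizes_Int[OF normalizes_self[OF K(1) subset_refl] nJN])
  then have "conj_by j ` U \<subseteq> U" unfolding JN using normalizesD xj(2) by blast
  then have "conj_by j ` U = U"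
    by (rule card_subset_eq[OF finite_subgroup[OF U(1)] _ card_conj_by[OF jc(1) subgroup.subset[OF U(1)]]])
  moreover have "conj_by t ` U = conj_by x ` conj_by j ` U"
    unfolding xj(3) image_image
    by (rule image_cong) (use jc subgroup_sub[OF U(1)] in \<open>auto simp: conj_by_conj_by\<close>)
  ultimately show ?thesis using xj(1) by auto
qed

text \<open>The two factors are nilpotent for different reasons. In N the complement for q is the
  product of the Sylow subgroups for the remaining primes of A. A prime dividing |T| is outside A,
  so G has a normal complement for it, which T intersects in a normal complement.\<close>

theorem evolving_decomposition:
  assumes ev: "evolving_in (carrier G)"
  obtains N T where "subgroup N G" "subgroup T G" "normalizes (carrier G) N"
    "card (carrier G) = card N * card T" "coprime (card N) (card T)"
    "nilpotent_group (G\<lparr>carrier := N\<rparr>)" "nilpotent_group (G\<lparr>carrier := T\<rparr>)"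
    "\<And>U t. subgroup U G \<Longrightarrow> U \<subseteq> N \<Longrightarrow> t \<in> carrier G \<Longrightarrow> \<exists>x\<in>N. conj_by t ` U = conj_by x ` U"
proof -
  let ?g = "card (carrier G)"
  have pos: "?g > 0" by (rule card_subgroup_pos[OF subgroup_self])
  define A where "A = {p \<in> prime_factors ?g. \<not> (\<exists>M. normal_p_complement p (carrier G) M)}"
  have A: "finite A" "\<And>p. p \<in> A \<Longrightarrow> prime p" by (auto simp: A_def)
  have S: "\<exists>S. normal_sylow p (carrier G) S" if "p \<in> A" for p
    using normal_sylow_or_complement[OF ev subgroup_self A(2)[OF that]] that by (auto simp: A_def)
  obtain N where N: "subgroup N G" "N \<subseteq> carrier G" "normalizes (carrier G) N"
    "card N = (\<Prod>p\<in>A. p_part p ?g)"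
    using ex_normal_Hall[OF subgroup_self A S] by blast
  have "\<exists>K k. subgroup K G \<and> \<not> p dvd card K \<and> ?g = card K * p ^ k" if "p \<in> A" for p
    using ex_p_complement[OF ev subgroup_self A(2)[OF that]] by metis
  then obtain K k where K: "\<And>p. p \<in> A \<Longrightarrow> subgroup (K p) G" "\<And>p. p \<in> A \<Longrightarrow> \<not> p dvd card (K p)"
    "\<And>p. p \<in> A \<Longrightarrow> ?g = card (K p) * p ^ k p" by metis
  let ?T = "carrier G \<inter> \<Inter>(K ` A)"
  have "subgroup ?T G \<and> ?g = card ?T * (\<Prod>p\<in>A. p ^ k p)"
    by (rule card_Inter_coprime_index[OF subgroup_self A]) (use K subgroup.subset[OF K(1)] in auto)
  then have T: "subgroup ?T G" "?g = card ?T * (\<Prod>p\<in>A. p ^ k p)" by auto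
  have "p ^ k p = p_part p ?g" if p: "p \<in> A" for p
    by (rule p_part_eqI[symmetric, OF A(2)[OF p] _ K(2)[OF p]]) (use K(3)[OF p] in simp)
  then have "(\<Prod>p\<in>A. p ^ k p) = card N" unfolding N(4) by (rule prod.cong[OF refl])
  then have gNT: "?g = card N * card ?T" using T(2) by simp
  have NA: "p \<in> A" if "prime p" "p dvd card N" for p
    using prime_dvd_prod_p_parts[OF A] that N(4) by metis
  have TA: "p \<notin> A" if "prime p" "p dvd card ?T" for p
  proof
    assume "p \<in> A"
    then have "card ?T dvd card (K p)" using card_subgroup_dvd[OF T(1) K(1)] by auto
    then show False using that K(2)[OF \<open>p \<in> A\<close>] dvd_trans by blast
  qed
  have "coprime (card N) (card ?T)"
    by (rule coprime_if_no_common_prime) (use NA TA in blast)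
  moreover have "nilpotent_group (G\<lparr>carrier := N\<rparr>)"
  proof (rule nilpotent_subgroup_if_normal_p_complements[OF N(1)])
    fix q :: nat assume q: "prime q" "q dvd card N"
    then have qA: "q \<in> A" using NA by blast
    obtain M where M: "subgroup M G" "M \<subseteq> carrier G" "normalizes (carrier G) M"
      "card M = (\<Prod>p\<in>A - {q}. p_part p ?g)"
      using ex_normal_Hall[OF subgroup_self, of "A - {q}"] A S by auto
    have Aq: "finite (A - {q})" "\<And>p. p \<in> A - {q} \<Longrightarrow> prime p" using A by auto
    have MA: "p \<in> A - {q}" if "prime p" "p dvd card M" for p
      using prime_dvd_prod_p_parts[OF Aq] that M(4) by metis
    have "\<not> q dvd card M" using MA[OF q(1)] by blast
    moreover have "M \<subseteq> N"
      by (rule Hall_subgroup_sub[OF subgroup_self A N M(1,2)]) (use MA in auto)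
    moreover have "card N = card M * q ^ multiplicity q ?g"
      unfolding N(4) M(4) using prod.remove[OF A(1) qA, of "\<lambda>p. p_part p ?g"]
      by (simp add: p_part_def)
    moreover have "normalizes N M" using normalizes_mono[OF M(3) N(2)] .
    ultimately show "\<exists>M. normal_p_complement q N M"
      using M(1) unfolding normal_p_complement_def by blast
  qed
  moreover have "nilpotent_group (G\<lparr>carrier := ?T\<rparr>)"
  proof (rule nilpotent_subgroup_if_normal_p_complements[OF T(1)])
    fix p :: nat assume p: "prime p" "p dvd card ?T"
    then have "p dvd ?g" using T(2) by simp
    then have "p \<in> prime_factors ?g" using p pos by (simp add: prime_factors_dvd)
    then obtain M where "normal_p_complement p (carrier G) M" using TA[OF p] by (auto simp: A_def)
    then show "\<exists>M. normal_p_complement p ?T M"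
      using normal_p_complement_Int[OF _ p(1) subgroup_self T(1)] by blast
  qed
  ultimately show ?thesis
    using that[OF N(1) T(1) N(3) gNT] conj_subgroup_of_Hall[OF ev A S N(1,3,4)] by blast
qed

section \<open>Intense semidirect products are evolving\<close>

text \<open>The complement is the product of the normal Sylow subgroups for the primes other than
  p.\<close>

lemma ex_p_complement_of_sylows:
  assumes K: "subgroup K G" and S: "\<And>q. prime q \<Longrightarrow> \<exists>S. normal_sylow q K S" and p: "prime p"
  shows "\<exists>M. normal_p_complement p K M"
proof -
  have pos: "card K > 0" by (rule card_subgroup_pos[OF K])
  let ?A = "prime_factors (card K)"
  have A: "finite (?A - {p})" "\<And>q. q \<in> ?A - {p} \<Longrightarrow> prime q" by auto
  obtain M where M: "subgroup M G" "M \<subseteq> K" "normalizes K M"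
    "card M = (\<Prod>q\<in>?A - {p}. p_part q (card K))"
    using ex_normal_Hall[OF K A] S A(2) by blast
  have "\<not> p dvd card M" using prime_dvd_prod_p_parts[OF A p, of "card K"] M(4) by auto
  moreover have "card K = card M * p ^ multiplicity p (card K)"
  proof (cases "p \<in> ?A")
    case True
    have "card K = (\<Prod>q\<in>?A. p_part q (card K))"
      using prime_factorization_nat[OF pos] by (simp add: p_part_def)
    also have "\<dots> = p_part p (card K) * card M"
      unfolding M(4) by (rule prod.remove) (use True in auto)
    finally show ?thesis by (simp add: p_part_def mult.commute)
  next
    case False
    then have "multiplicity p (card K) = 0"
      using p pos by (simp add: prime_factors_dvd not_dvd_imp_multiplicity_0)
    moreover have "?A - {p} = ?A" using False by simp
    ultimately show ?thesis
      using prime_factorization_nat[OF pos] M(4) by (simp add: p_part_def)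
  qed
  ultimately show ?thesis using M unfolding normal_p_complement_def by blast
qed

text \<open>Among the subgroups \<open>L\<close> of \<open>Y\<close> with \<open>L N = G\<close> choose a minimal one. By the Frattini argument
  and minimality its Sylow \<open>s\<close>-subgroups, for \<open>s\<close> dividing \<open>|T|\<close>, are normal in \<open>L\<close>, and their
  product has order \<open>|T|\<close>.\<close>

lemma ex_subgroup_of_complement_order:
  assumes N: "subgroup N G" "normalizes (carrier G) N" and T: "subgroup T G"
    and c: "card (carrier G) = card N * card T" "coprime (card N) (card T)"
    and TS: "\<And>s. prime s \<Longrightarrow> \<exists>S. normal_sylow s T S"
    and Y: "subgroup Y G" "Y <#> N = carrier G"
  shows "\<exists>K. subgroup K G \<and> K \<subseteq> Y \<and> card K = card T"
proof -
  have Nc: "N \<subseteq> carrier G" by (rule subgroup.subset[OF N(1)])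
  have Tc: "T \<subseteq> carrier G" by (rule subgroup.subset[OF T])
  let ?A = "{L. subgroup L G \<and> L \<subseteq> Y \<and> L <#> N = carrier G}"
  have "finite ?A" using finite_subgroup[OF Y(1)] by (rule_tac finite_subset[of _ "Pow Y"]) auto
  moreover have "Y \<in> ?A" using Y by auto
  ultimately obtain L where L0: "L \<in> ?A" "\<And>X. X \<in> ?A \<Longrightarrow> X \<subseteq> L \<Longrightarrow> L = X"
    using finite_has_minimal[of ?A] by (metis (lifting) empty_iff)
  have L: "subgroup L G" "L \<subseteq> Y" "L <#> N = carrier G" using L0(1) by auto
  have Lc: "L \<subseteq> carrier G" by (rule subgroup.subset[OF L(1)])
  let ?D = "L \<inter> N"
  have D: "subgroup ?D G" using subgroup_Int L N by blast
  have nD: "normalizes L ?D"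
    using normalizes_Int[OF normalizes_self[OF L(1) subset_refl] normalizes_mono[OF N(2) Lc]] .
  have "card N * card T * card ?D = card L * card N" using card_set_mult[OF L(1) N(1)] L(3) c(1) by simp
  then have cL: "card L = card T * card ?D" using card_subgroup_pos[OF N(1)] by simp
  have TN: "T <#> N = carrier G"
    using card_set_mult_coprime[OF T N(1)] c
      card_subset_eq[OF finite_carrier set_mult_sub[OF subgroup_self Tc Nc]]
    by (simp add: coprime_commute mult.commute)
  have notD: "\<not> s dvd card ?D" if s: "prime s" "s dvd card T" for s
  proof
    assume "s dvd card ?D"
    then have "s dvd card N" using card_subgroup_dvd[OF D N(1)] dvd_trans by blast
    then show False using s c(2) by (metis coprime_common_divisor not_prime_unit)
  qed
  have pp: "p_part s (card L) = p_part s (card T)" if s: "prime s" "s dvd card T" for s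
    unfolding cL by (rule p_part_mult_coprime[OF s(1) card_subgroup_pos[OF T] notD[OF s]])
  have sylow: "\<exists>S. normal_sylow s L S" if s: "prime s" "s dvd card T" for s
  proof -
    obtain S where S: "subgroup S G" "S \<subseteq> L" "card S = s ^ multiplicity s (card L)"
      using sylow_in[OF L(1) s(1)] p_part_dvd[of s "card L"] unfolding p_part_def by metis
    have cS: "card S = p_part s (card T)" using S(3) pp[OF s] by (simp add: p_part_def)
    obtain Ts where Ts0: "normal_sylow s T Ts" using TS[OF s(1)] by blast
    then have Ts: "subgroup Ts G" "Ts \<subseteq> T" "normalizes T Ts" "card Ts = p_part s (card T)"
      by (auto simp: normal_sylow_def)
    obtain m where m: "card T = card Ts * m" "\<not> s dvd m"
      using normal_sylow_Hall[OF Ts0 s(1) T] by blast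
    have Tsc: "Ts \<subseteq> carrier G" by (rule subgroup.subset[OF Ts(1)])
    \<comment> \<open>Normal in G, being normalized by T and by N, and of index prime to s; hence it
      contains every Sylow s-subgroup of L, whichever one was chosen.\<close>
    let ?B = "Ts <#> N"
    have B: "subgroup ?B G" by (rule set_mult_subgroupI[OF Ts(1) N(1) normalizes_mono[OF N(2) Tsc]])
    have Bc: "?B \<subseteq> carrier G" by (rule subgroup.subset[OF B])
    have "normalizes T ?B"
      by (rule normalizes_set_mult_right[OF Tc Tsc Nc Ts(3) normalizes_mono[OF N(2) Tc]])
    moreover have "normalizes N ?B" by (rule normalizes_self[OF B sub_set_mult_right[OF Ts(1) N(1)]])
    ultimately have nB: "normalizes (carrier G) ?B"
      using normalizes_set_mult_left[OF Bc Tc Nc] TN by simp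
    have "card Ts dvd card T" using m(1) by simp
    then have "coprime (card Ts) (card N)" using c(2) by (metis coprime_commute coprime_divisors dvd_refl)
    then have cB: "card ?B = card Ts * card N" by (rule card_set_mult_coprime[OF Ts(1) N(1)])
    have "card (carrier G) = card ?B * m" using c(1) cB m(1) by simp
    moreover have "coprime (card S) m" unfolding cS by (rule coprime_p_part[OF s(1) m(2)])
    ultimately have SB: "S \<subseteq> ?B"
      using subset_of_coprime_index[OF subgroup_self S(1) subgroup.subset[OF S(1)] B Bc]
        normalizes_mono[OF nB subgroup.subset[OF S(1)]] by blast
    let ?V = "L \<inter> ?B"
    have V: "subgroup ?V G" using subgroup_Int L B by blast
    have nV: "normalizes L ?V"
      using normalizes_Int[OF normalizes_self[OF L(1) subset_refl] normalizes_mono[OF nB Lc]] .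
    have SV: "S \<subseteq> ?V" using S SB by auto
    have DV: "?D \<subseteq> ?V" using sub_set_mult_right[OF Ts(1) N(1)] by auto
    have "coprime (card ?D) (card S)"
      unfolding cS using coprime_p_part[OF s(1) notD[OF s]] coprime_commute by blast
    then have cDS: "card (?D <#> S) = card ?D * card S" by (rule card_set_mult_coprime[OF D S(1)])
    \<comment> \<open>Since V N lies in B and V meets N in D, counting bounds |V| by |D| |S|;
      therefore V = D S with S a Sylow s-subgroup of V.\<close>
    have "?V \<inter> N = ?D" using sub_set_mult_right[OF Ts(1) N(1)] by auto
    then have "card ?V * card N = card (?V <#> N) * card ?D" using card_set_mult[OF V N(1)] by simp
    also have "\<dots> \<le> card ?B * card ?D"
      using set_mult_sub[OF B Int_lower2 sub_set_mult_right[OF Ts(1) N(1)]] finite_subgroup[OF B]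
      by (simp add: card_mono)
    also have "\<dots> = card ?D * card S * card N" using cB Ts(4) cS by simp
    finally have leV: "card ?V \<le> card (?D <#> S)" using cDS card_subgroup_pos[OF N(1)] by simp
    have DS: "?D <#> S = ?V"
      by (rule card_seteq[OF finite_subgroup[OF V] set_mult_sub[OF V DV SV] leV])
    have cV: "card ?V = card S * card ?D" using DS cDS by simp
    define M where "M = {x\<in>L. \<forall>w\<in>S. conj_by x w \<in> S}"
    have M: "subgroup M G" unfolding M_def by (rule subgroup_normalizing[OF L(1) S(1)])
    have SM: "S \<subseteq> M"
      using S(2) normalizesD[OF normalizes_self[OF S(1) subset_refl]] by (auto simp: M_def)
    \<comment> \<open>The Frattini argument: S and its conjugate by l are Sylow s-subgroups of V, so
      some x = d y in V = D S carries S to that conjugate. The part y normalizes S, which leaves l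
      in D M with M the normalizer of S in L.\<close>
    have LDM: "l \<in> ?D <#> M" if l: "l \<in> L" for l
    proof -
      have lc: "l \<in> carrier G" using l Lc by auto
      have S': "subgroup (conj_by l ` S) G" by (rule subgroup_conj_by[OF lc S(1)])
      have S'V: "conj_by l ` S \<subseteq> ?V" using SV normalizesD[OF nV l] by auto
      have "card (conj_by l ` S) = s ^ multiplicity s (card L)"
        using card_conj_by[OF lc subgroup.subset[OF S(1)]] S(3) by simp
      then obtain x where x: "x \<in> ?V" "\<And>y. y \<in> conj_by l ` S \<Longrightarrow> conj_by (inv x) y \<in> S"
        using ex_conj_into[OF V S(1) SV S' S'V s(1) _ cV notD[OF s]] by blast
      have "x \<in> ?D <#> S" using x(1) DS by simp
      then obtain d y where dy: "d \<in> ?D" "y \<in> S" "x = d \<otimes> y" unfolding set_mult_def by blast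
      have dyc: "d \<in> carrier G" "y \<in> carrier G" "x \<in> carrier G"
        using dy subgroup_sub[OF D] subgroup_sub[OF S(1)] x(1) subgroup_sub[OF V] by auto
      have "x \<in> L" using x(1) by simp
      then have "inv x \<otimes> l \<in> L" using l L(1) by (simp add: subgroup.m_closed subgroup.m_inv_closed)
      moreover have "conj_by (inv x \<otimes> l) w \<in> S" if "w \<in> S" for w
        using x(2) that dyc lc subgroup_sub[OF S(1)] by (simp add: conj_by_conj_by)
      ultimately have "inv x \<otimes> l \<in> M" by (simp add: M_def)
      then have "y \<otimes> (inv x \<otimes> l) \<in> M" using dy(2) SM subgroup.m_closed[OF M] by blast
      moreover have "l = d \<otimes> (y \<otimes> (inv x \<otimes> l))"
        using dyc lc dy(3) by (simp add: inv_mult_group m_assoc inv_mult_cancel)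
      ultimately show ?thesis using dy(1) unfolding set_mult_def by blast
    qed
    have MN: "subgroup (M <#> N) G"
      by (rule set_mult_subgroupI[OF M N(1) normalizes_mono[OF N(2) subgroup.subset[OF M]]])
    have "L \<subseteq> M <#> N"
    proof -
      have "?D <#> M \<subseteq> M <#> N"
        using set_mult_sub[OF MN _ sub_set_mult_left[OF M N(1)]] sub_set_mult_right[OF M N(1)] by blast
      then show ?thesis using LDM by blast
    qed
    then have "L <#> N \<subseteq> M <#> N"
      using set_mult_sub[OF MN _ sub_set_mult_right[OF M N(1)]] by blast
    then have "M <#> N = carrier G" using L(3) subgroup.subset[OF MN] by auto
    \<comment> \<open>As D lies in N, the normalizer M still supplements N, and minimality of L
      forces M = L.\<close>
    then have "M \<in> ?A" using M L(2) by (auto simp: M_def)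
    then have "L = M" using L0(2)[of M] by (auto simp: M_def)
    then have "normalizes L S" unfolding normalizes_def M_def by blast
    then have "normal_sylow s L S" using S by (simp add: normal_sylow_def p_part_def)
    then show ?thesis by blast
  qed
  let ?P = "prime_factors (card T)"
  have "\<exists>K. subgroup K G \<and> K \<subseteq> L \<and> normalizes L K \<and> card K = (\<Prod>p\<in>?P. p_part p (card L))"
    by (rule ex_normal_Hall[OF L(1)]) (use sylow in \<open>auto simp: prime_factors_dvd\<close>)
  then obtain K where K: "subgroup K G" "K \<subseteq> L" "card K = (\<Prod>p\<in>?P. p_part p (card L))" by blast
  have "card K = (\<Prod>p\<in>?P. p_part p (card T))"
    unfolding K(3) by (rule prod.cong[OF refl pp]) (auto simp: prime_factors_dvd)
  also have "\<dots> = card T"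
    using prime_factorization_nat[OF card_subgroup_pos[OF T]] by (simp add: p_part_def)
  finally show ?thesis using K L(2) by blast
qed

theorem evolving_in_of_decomposition:
  assumes N: "subgroup N G" "normalizes (carrier G) N" and T: "subgroup T G"
    and c: "card (carrier G) = card N * card T" "coprime (card N) (card T)"
    and nil: "nilpotent_group (G\<lparr>carrier := N\<rparr>)" "nilpotent_group (G\<lparr>carrier := T\<rparr>)"
    and int: "\<And>U t. subgroup U G \<Longrightarrow> U \<subseteq> N \<Longrightarrow> t \<in> T \<Longrightarrow> \<exists>x\<in>N. conj_by t ` U = conj_by x ` U"
  shows "evolving_in (carrier G)"
proof (rule evolving_inI)
  fix p I i assume p: "prime p" and I: "subgroup I G" "I \<subseteq> carrier G" "card I = p ^ i"
  have Nc: "N \<subseteq> carrier G" by (rule subgroup.subset[OF N(1)])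
  have Tc: "T \<subseteq> carrier G" by (rule subgroup.subset[OF T])
  have TN: "T <#> N = carrier G"
    using card_set_mult_coprime[OF T N(1)] c
      card_subset_eq[OF finite_carrier set_mult_sub[OF subgroup_self Tc Nc]]
    by (simp add: coprime_commute mult.commute)
  note NS = normal_sylow_of_nilpotent_subgroup[OF N(1) nil(1)]
  note TS = normal_sylow_of_nilpotent_subgroup[OF T nil(2)]
  let ?goal = "\<exists>J b k. subgroup J G \<and> I \<subseteq> J \<and> J \<subseteq> carrier G \<and> card J = card I * b \<and>
      card (carrier G) = card J * p ^ k \<and> \<not> p dvd b"
  \<comment> \<open>It is enough to build J with |J| = |I| b and |G| = b p^k for the same b prime to
    p: then |I| divides p^k, and the index of J is the remaining power of p.\<close>
  have finish: ?goal
    if J: "subgroup J G" "I \<subseteq> J" "card J = card I * b" "\<not> p dvd b" "card (carrier G) = b * p ^ k" for J b k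
  proof -
    have "p ^ i dvd b * p ^ k" using card_subgroup_dvd[OF I(1) subgroup_self I(2)] I(3) J(5) by simp
    moreover have "coprime (p ^ i) b" using p J(4) by (simp add: prime_imp_coprime)
    ultimately have "p ^ i dvd p ^ k" by (metis coprime_dvd_mult_right_iff)
    then have "i \<le> k" using p prime_gt_1_nat power_dvd_imp_le by blast
    then have "p ^ k = p ^ i * p ^ (k - i)" by (simp flip: power_add)
    then have "card (carrier G) = card J * p ^ (k - i)" using J(3,5) I(3) by simp
    then show ?thesis using J subgroup.subset[OF J(1)] by blast
  qed
  show ?goal
  proof (cases "p dvd card N")
    case False
    obtain T0 k where T0: "subgroup T0 G" "T0 \<subseteq> T" "normalizes T T0" "\<not> p dvd card T0"
      "card T = card T0 * p ^ k"
      using ex_p_complement_of_sylows[OF T TS p] by (auto simp: normal_p_complement_def)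
    have T0c: "T0 \<subseteq> carrier G" by (rule subgroup.subset[OF T0(1)])
    let ?M = "T0 <#> N"
    have M: "subgroup ?M G" by (rule set_mult_subgroupI[OF T0(1) N(1) normalizes_mono[OF N(2) T0c]])
    have "coprime (card T0) (card N)" using c(2) T0(5) by (simp add: coprime_commute)
    then have cM: "card ?M = card T0 * card N" by (rule card_set_mult_coprime[OF T0(1) N(1)])
    have "normalizes T ?M"
      by (rule normalizes_set_mult_right[OF Tc T0c Nc T0(3) normalizes_mono[OF N(2) Tc]])
    moreover have "normalizes N ?M" by (rule normalizes_self[OF M sub_set_mult_right[OF T0(1) N(1)]])
    ultimately have nM: "normalizes (carrier G) ?M"
      using normalizes_set_mult_left[OF subgroup.subset[OF M] Tc Nc] TN by simp
    have pM: "\<not> p dvd card ?M" using cM T0(4) False p by (simp add: prime_dvd_mult_iff)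
    have J: "subgroup (I <#> ?M) G" by (rule set_mult_subgroupI[OF I(1) M normalizes_mono[OF nM I(2)]])
    have "coprime (card I) (card ?M)" unfolding I(3) using pM p by (simp add: prime_imp_coprime)
    then have "card (I <#> ?M) = card I * card ?M" by (rule card_set_mult_coprime[OF I(1) M])
    moreover have "card (carrier G) = card ?M * p ^ k" using c(1) T0(5) cM by simp
    ultimately show ?thesis using finish[OF J sub_set_mult_left[OF I(1) M] _ pM] by blast
  next
    case True
    then have pT: "\<not> p dvd card T" using c(2) p by (metis coprime_common_divisor not_prime_unit)
    then have "coprime (card I) (card T)" unfolding I(3) using p by (simp add: prime_imp_coprime)
    then have IN: "I \<subseteq> N"
      using subset_of_coprime_index[OF subgroup_self I(1,2) N(1) Nc _ c(1)] normalizes_mono[OF N(2) I(2)] by blast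
    obtain N0 k where N0: "subgroup N0 G" "N0 \<subseteq> N" "normalizes N N0" "\<not> p dvd card N0"
      "card N = card N0 * p ^ k"
      using ex_p_complement_of_sylows[OF N(1) NS p] by (auto simp: normal_p_complement_def)
    have "coprime (card N0) (p ^ k)" using N0(4) p by (simp add: prime_imp_coprime coprime_commute)
    then have nN0: "normalizes (carrier G) N0"
      using normalizes_Hall_trans[OF subgroup_self N(1) Nc N0(1,2) N(2) N0(3,5)] by blast
    define Y where "Y = {g\<in>carrier G. \<forall>w\<in>I. conj_by g w \<in> I}"
    have Y: "subgroup Y G" unfolding Y_def by (rule subgroup_normalizing[OF subgroup_self I(1)])
    have YN: "subgroup (Y <#> N) G"
      by (rule set_mult_subgroupI[OF Y N(1) normalizes_mono[OF N(2) subgroup.subset[OF Y]]])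
    have "T \<subseteq> Y <#> N"
    proof
      fix t assume t: "t \<in> T"
      obtain x where x: "x \<in> N" "conj_by t ` I = conj_by x ` I" using int[OF I(1) IN t] by blast
      have tx: "t \<in> carrier G" "x \<in> carrier G" using t x Tc Nc by auto
      have "conj_by (inv x \<otimes> t) w \<in> I" if w: "w \<in> I" for w
      proof -
        have "conj_by t w \<in> conj_by x ` I" using x(2) w by blast
        then obtain v where "v \<in> I" "conj_by t w = conj_by x v" by blast
        then show ?thesis using tx w I(2) by (simp add: conj_by_conj_by subset_iff)
      qed
      then have "inv x \<otimes> t \<in> Y" using tx by (simp add: Y_def)
      then have "x \<otimes> (inv x \<otimes> t) \<in> Y <#> N"
        using x(1) sub_set_mult_left[OF Y N(1)] sub_set_mult_right[OF Y N(1)] subgroup.m_closed[OF YN]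
        by blast
      then show "t \<in> Y <#> N" using tx by (simp add: inv_mult_cancel)
    qed
    then have "T <#> N \<subseteq> Y <#> N" using set_mult_sub[OF YN _ sub_set_mult_right[OF Y N(1)]] by blast
    then have "Y <#> N = carrier G" using TN subgroup.subset[OF YN] by auto
    then obtain K where K: "subgroup K G" "K \<subseteq> Y" "card K = card T"
      using ex_subgroup_of_complement_order[OF N T c TS Y] by blast
    have Kc: "K \<subseteq> carrier G" by (rule subgroup.subset[OF K(1)])
    \<comment> \<open>N0 is normal in G and K normalizes I, so K (I N0) is a subgroup. Coprimality
      makes its order |I| |T| |N0|, with |T| |N0| prime to p.\<close>
    let ?B = "I <#> N0"
    have B: "subgroup ?B G" by (rule set_mult_subgroupI[OF I(1) N0(1) normalizes_mono[OF nN0 I(2)]])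
    have "coprime (card I) (card N0)" unfolding I(3) using N0(4) p by (simp add: prime_imp_coprime)
    then have cB: "card ?B = card I * card N0" by (rule card_set_mult_coprime[OF I(1) N0(1)])
    have "normalizes K I" using K(2) unfolding normalizes_def Y_def by blast
    then have "normalizes K ?B"
      using normalizes_set_mult_right[OF Kc I(2) subgroup.subset[OF N0(1)]] normalizes_mono[OF nN0 Kc] by blast
    then have J: "subgroup (K <#> ?B) G" by (rule set_mult_subgroupI[OF K(1) B])
    have "card ?B dvd card N" by (rule card_subgroup_dvd[OF B N(1) set_mult_sub[OF N(1) IN N0(2)]])
    then have "coprime (card K) (card ?B)" using c(2) K(3) by (metis coprime_commute coprime_divisors dvd_refl)
    then have "card (K <#> ?B) = card K * card ?B" by (rule card_set_mult_coprime[OF K(1) B])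
    then have "card (K <#> ?B) = card I * (card T * card N0)" using K(3) cB by simp
    moreover have "\<not> p dvd card T * card N0" using pT N0(4) p by (simp add: prime_dvd_mult_iff)
    moreover have "card (carrier G) = card T * card N0 * p ^ k" using c(1) N0(5) by simp
    moreover have "I \<subseteq> K <#> ?B"
      using sub_set_mult_left[OF I(1) N0(1)] sub_set_mult_right[OF K(1) B] by blast
    ultimately show ?thesis using finish[OF J] by blast
  qed
qed

end

section \<open>External semidirect products\<close>

lemma (in finite_group) subgroup_index_mult_card:
  assumes J: "subgroup J G" and I: "subgroup I G" "I \<subseteq> J"
  shows "subgroup_index (G\<lparr>carrier := J\<rparr>) I * card I = card J"
proof -
  interpret J: group "G\<lparr>carrier := J\<rparr>" by (rule subgroup_imp_group[OF J])
  show ?thesis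
    using J.lagrange[OF subgroup_incl[OF I(1) J I(2)]] by (simp add: subgroup_index_def order_def)
qed

lemma (in finite_group) evolving_iff_evolving_in: "evolving G \<longleftrightarrow> evolving_in (carrier G)"
proof -
  have "(\<exists>J. subgroup J G \<and> I \<subseteq> J \<and> (\<exists>k. subgroup_index G J = p ^ k) \<and>
          coprime (subgroup_index (G\<lparr>carrier := J\<rparr>) I) p) \<longleftrightarrow>
      (\<exists>J b k. subgroup J G \<and> I \<subseteq> J \<and> J \<subseteq> carrier G \<and> card J = card I * b \<and>
          card (carrier G) = card J * p ^ k \<and> \<not> p dvd b)"
    if p: "prime p" and I: "subgroup I G" for p I
  proof -
    have "(\<exists>k. subgroup_index G J = p ^ k) \<and> coprime (subgroup_index (G\<lparr>carrier := J\<rparr>) I) p \<longleftrightarrow>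
        (\<exists>b k. card J = card I * b \<and> card (carrier G) = card J * p ^ k \<and> \<not> p dvd b)"
      if J: "subgroup J G" "I \<subseteq> J" for J
    proof -
      have 1: "subgroup_index G J * card J = card (carrier G)"
        using lagrange[OF J(1)] by (simp add: subgroup_index_def order_def)
      have 2: "subgroup_index (G\<lparr>carrier := J\<rparr>) I * card I = card J"
        by (rule subgroup_index_mult_card[OF J(1) I J(2)])
      have pos: "card I > 0" "card J > 0" using card_subgroup_pos I J by auto
      have "card (carrier G) = card J * k \<longleftrightarrow> subgroup_index G J = k" for k
        using 1 pos by (metis mult.commute mult_right_cancel less_numeral_extra(3))
      moreover have "card J = card I * b \<longleftrightarrow> subgroup_index (G\<lparr>carrier := J\<rparr>) I = b" for b
        using 2 pos by (metis mult.commute mult_right_cancel less_numeral_extra(3))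
      moreover have "coprime b p \<longleftrightarrow> \<not> p dvd b" for b
        using p by (metis coprime_commute coprime_absorb_left not_prime_unit prime_imp_coprime)
      ultimately show ?thesis by simp
    qed
    then have "subgroup J G \<and> I \<subseteq> J \<and> (\<exists>k. subgroup_index G J = p ^ k) \<and>
          coprime (subgroup_index (G\<lparr>carrier := J\<rparr>) I) p \<longleftrightarrow>
        (\<exists>b k. subgroup J G \<and> I \<subseteq> J \<and> J \<subseteq> carrier G \<and> card J = card I * b \<and>
          card (carrier G) = card J * p ^ k \<and> \<not> p dvd b)" for J
      using subgroup.subset[of J G] by (cases "subgroup J G"; cases "I \<subseteq> J"; simp)
    then show ?thesis by (rule ex_cong1)
  qed
  note eq = this
  show ?thesis
  proof
    assume ev: "evolving G"
    show "evolving_in (carrier G)"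
    proof (rule evolving_inI)
      fix p I i assume I: "prime p" "subgroup I G" "card I = p ^ i"
      then show "\<exists>J b k. subgroup J G \<and> I \<subseteq> J \<and> J \<subseteq> carrier G \<and> card J = card I * b \<and>
          card (carrier G) = card J * p ^ k \<and> \<not> p dvd b"
        unfolding eq[OF I(1,2), symmetric] using ev unfolding evolving_def by blast
    qed
  next
    assume ev: "evolving_in (carrier G)"
    have "\<exists>J. subgroup J G \<and> I \<subseteq> J \<and> (\<exists>k. subgroup_index G J = p ^ k) \<and>
          coprime (subgroup_index (G\<lparr>carrier := J\<rparr>) I) p"
      if "prime p" "subgroup I G" "card I = p ^ i" for p I i
      unfolding eq[OF that(1,2)]
      using ev subgroup.subset[OF that(2)] that unfolding evolving_in_def by blast
    then show "evolving G" unfolding evolving_def using is_group finite_carrier by blast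
  qed
qed

text \<open>A p-subgroup is pulled back along g, and the J found there is pushed forward along f.
  This connects G with the semidirect product, whose elements are pairs.\<close>

lemma evolving_iso:
  assumes G: "group G" and H: "group H" and iso: "G \<cong> H" and ev: "evolving G"
  shows "evolving H"
proof -
  interpret G: finite_group G
    using ev by (simp add: evolving_def finite_group_def finite_group_axioms_def)
  obtain f g where fg: "group_isomorphisms G H f g"
    using iso G.iso_iff_group_isomorphisms by (fastforce simp: is_iso_def)
  then have gf: "\<And>x. x \<in> carrier G \<Longrightarrow> g (f x) = x" "\<And>y. y \<in> carrier H \<Longrightarrow> f (g y) = y"
    and fh: "f \<in> hom G H" and gh: "g \<in> hom H G"
    by (auto simp: group_isomorphisms_def)
  interpret f: group_hom G H f using fh G H by (simp add: group_hom_def group_hom_axioms_def)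
  interpret g: group_hom H G g using gh G H by (simp add: group_hom_def group_hom_axioms_def)
  have fi: "inj_on f (carrier G)" by (rule inj_on_inverseI[of _ g]) (rule gf(1))
  have gi: "inj_on g (carrier H)" by (rule inj_on_inverseI[of _ f]) (rule gf(2))
  have fc: "f ` carrier G = carrier H"
  proof (intro subset_antisym subsetI)
    fix y assume "y \<in> carrier H"
    then show "y \<in> f ` carrier G" using gf(2)[of y] by (metis g.hom_closed imageI)
  qed auto
  interpret H: finite_group H
    using H G.finite_carrier fc by (metis finite_group.intro finite_group_axioms.intro finite_imageI)
  have "H.evolving_in (carrier H)"
  proof (rule H.evolving_inI)
    fix p I i assume I: "prime p" "subgroup I H" "I \<subseteq> carrier H" "card I = p ^ i"
    have cI: "card (g ` I) = card I" using gi I(3) by (meson card_image inj_on_subset)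
    have sI: "subgroup (g ` I) G" by (rule g.subgroup_img_is_subgroup[OF I(2)])
    obtain J b k where J: "subgroup J G" "g ` I \<subseteq> J" "J \<subseteq> carrier G" "card J = card (g ` I) * b"
      "card (carrier G) = card J * p ^ k" "\<not> p dvd b"
      using G.evolving_inE[OF _ I(1) sI subgroup.subset[OF sI], of i] ev G.evolving_iff_evolving_in cI I(4)
      by metis
    have "card (f ` J) = card J" using fi J(3) by (meson card_image inj_on_subset)
    moreover have "card (carrier H) = card (carrier G)" using fi fc card_image by metis
    moreover have "I \<subseteq> f ` J"
    proof
      fix y assume y: "y \<in> I"
      then have "f (g y) \<in> f ` J" using J(2) by blast
      then show "y \<in> f ` J" using gf(2) I(3) y by auto
    qed
    moreover have "subgroup (f ` J) H" by (rule f.subgroup_img_is_subgroup[OF J(1)])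
    ultimately show "\<exists>J b k. subgroup J H \<and> I \<subseteq> J \<and> J \<subseteq> carrier H \<and> card J = card I * b \<and>
        card (carrier H) = card J * p ^ k \<and> \<not> p dvd b"
      using J(4,5,6) cI subgroup.subset by metis
  qed
  then show ?thesis using H.evolving_iff_evolving_in by simp
qed

text \<open>Conjugation is cut down to N by a restricted abstraction because \<open>auto\<close>
  only contains functions that are extensional on the carrier.\<close>

lemma (in finite_group) intense_conj_by:
  assumes N: "subgroup N G" "normalizes (carrier G) N" and t: "t \<in> carrier G"
    and int: "\<And>U. subgroup U G \<Longrightarrow> U \<subseteq> N \<Longrightarrow> \<exists>x\<in>N. conj_by t ` U = conj_by x ` U"
  shows "intense (G\<lparr>carrier := N\<rparr>) (\<lambda>n\<in>N. conj_by t n)"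
proof -
  let ?N = "G\<lparr>carrier := N\<rparr>" and ?c = "\<lambda>n\<in>N. conj_by t n"
  note Nc = subgroup_sub[OF N(1)]
  have cN: "conj_by u n \<in> N" if "u \<in> carrier G" "n \<in> N" for u n using normalizesD[OF N(2) that] .
  have "?c \<in> hom ?N ?N"
    using cN[OF t] Nc t N(1) by (auto simp: hom_def conj_by_mult subgroup.m_closed)
  moreover have "bij_betw ?c N N"
    by (rule bij_betw_byWitness[where f' = "conj_by (inv t)"]) (use cN t Nc in auto)
  ultimately have "?c \<in> auto ?N" by (auto simp: auto_def Bij_def)
  moreover have "\<exists>x\<in>carrier ?N. ?c ` U = (x <#\<^bsub>?N\<^esub> U) #>\<^bsub>?N\<^esub> inv\<^bsub>?N\<^esub> x" if U: "subgroup U ?N" for U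
  proof -
    have UN: "U \<subseteq> N" using subgroup.subset[OF U] by simp
    obtain x where x: "x \<in> N" "conj_by t ` U = conj_by x ` U"
      using int[OF incl_subgroup[OF N(1) U] UN] by blast
    have "?c ` U = conj_by t ` U" by (rule image_cong) (use UN in auto)
    also have "\<dots> = (x <#\<^bsub>?N\<^esub> U) #>\<^bsub>?N\<^esub> inv\<^bsub>?N\<^esub> x"
      using x N(1) by (simp add: l_r_coset_eq_image conj_by_def[abs_def])
    finally show ?thesis using x(1) by auto
  qed
  ultimately show ?thesis by (simp add: intense_def)
qed

lemma (in finite_group) internal_semidirect_product:
  assumes N: "subgroup N G" "normalizes (carrier G) N" and T: "subgroup T G"
    and c: "card (carrier G) = card N * card T" "coprime (card N) (card T)"
    and int: "\<And>U t. subgroup U G \<Longrightarrow> U \<subseteq> N \<Longrightarrow> t \<in> carrier G \<Longrightarrow> \<exists>x\<in>N. conj_by t ` U = conj_by x ` U"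
  defines "\<phi> \<equiv> \<lambda>t. \<lambda>n\<in>N. conj_by t n"
  shows "\<phi> \<in> hom (G\<lparr>carrier := T\<rparr>) (IntGroup (G\<lparr>carrier := N\<rparr>))"
    and "G \<cong> semidirect_product (G\<lparr>carrier := N\<rparr>) (G\<lparr>carrier := T\<rparr>) \<phi>"
proof -
  let ?N = "G\<lparr>carrier := N\<rparr>" and ?T = "G\<lparr>carrier := T\<rparr>"
  note Nc = subgroup_sub[OF N(1)] and Tc = subgroup_sub[OF T]
  have cN: "conj_by u n \<in> N" if "u \<in> carrier G" "n \<in> N" for u n using normalizesD[OF N(2) that] .
  have i: "intense ?N (\<phi> t)" if "t \<in> carrier G" for t
    unfolding \<phi>_def by (rule intense_conj_by[OF N that int[OF _ _ that]])
  show \<phi>: "\<phi> \<in> hom ?T (IntGroup ?N)"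
  proof (rule homI)
    show "\<phi> t \<in> carrier (IntGroup ?N)" if "t \<in> carrier ?T" for t
      using i[of t] that Tc by (simp add: IntGroup_simps)
  next
    fix t u assume tu: "t \<in> carrier ?T" "u \<in> carrier ?T"
    then have tuc: "t \<in> carrier G" "u \<in> carrier G" using Tc by auto
    have "\<phi> (t \<otimes> u) = compose N (\<phi> t) (\<phi> u)"
      using tuc cN Nc by (auto simp: \<phi>_def compose_def conj_by_conj_by)
    then show "\<phi> (t \<otimes>\<^bsub>?T\<^esub> u) = \<phi> t \<otimes>\<^bsub>IntGroup ?N\<^esub> \<phi> u"
      using IntGroup_mult[OF i[OF tuc(1)] i[OF tuc(2)]] by simp
  qed
  let ?P = "semidirect_product ?N ?T \<phi>"
  let ?f = "\<lambda>(n, t). n \<otimes> t"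
  have gP: "group ?P"
    by (rule group_semidirect_product[OF subgroup_imp_group[OF N(1)] subgroup_imp_group[OF T] \<phi>])
  then interpret P: group ?P .
  have "?f \<in> hom ?P G"
    by (rule homI)
      (auto simp: semidirect_product_def \<phi>_def conj_by_def Nc Tc m_assoc inv_mult_cancel)
  moreover have "bij_betw ?f (N \<times> T) (carrier G)"
  proof -
    have im: "?f ` (N \<times> T) = N <#> T" by (auto simp: set_mult_def)
    have "card (N <#> T) = card (carrier G)" using card_set_mult_coprime[OF N(1) T c(2)] c(1) by simp
    then have NT: "N <#> T = carrier G"
      using card_subset_eq[OF finite_carrier
          set_mult_sub[OF subgroup_self subgroup.subset[OF N(1)] subgroup.subset[OF T]]] by simp
    have "inj_on ?f (N \<times> T)"
      by (rule eq_card_imp_inj_on) (use N T c NT im in \<open>simp_all add: card_cartesian_product\<close>)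
    then show ?thesis using im NT by (simp add: bij_betw_def)
  qed
  ultimately have "?f \<in> iso ?P G" by (simp add: iso_def semidirect_product_def)
  then show "G \<cong> ?P" using P.iso_sym by (auto simp: is_iso_def)
qed

text \<open>The factors are embedded as subgroups of the product, and intensity of \<phi> t becomes
  conjugation inside it. Finiteness is an assumption because an infinite carrier has
  \<open>order\<close> 0, which is coprime to 1.\<close>

lemma evolving_semidirect_product:
  assumes nN: "nilpotent_group N" and nT: "nilpotent_group T" and cop: "coprime (order N) (order T)"
    and \<phi>: "\<phi> \<in> hom T (IntGroup N)" and fin: "finite (carrier N)" "finite (carrier T)"
  shows "evolving (semidirect_product N T \<phi>)"
proof -
  have gN: "group N" and gT: "group T" using nN nT by (auto simp: nilpotent_group_def)
  interpret N: group N by fact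
  interpret T: group T by fact
  interpret I: group "IntGroup N" by (rule N.group_IntGroup)
  interpret p: group_hom T "IntGroup N" \<phi> using \<phi> by unfold_locales
  let ?P = "semidirect_product N T \<phi>"
  have P: "carrier ?P = carrier N \<times> carrier T"
    "\<And>n t n' t'. (n, t) \<otimes>\<^bsub>?P\<^esub> (n', t') = (n \<otimes>\<^bsub>N\<^esub> \<phi> t n', t \<otimes>\<^bsub>T\<^esub> t')"
    "\<one>\<^bsub>?P\<^esub> = (\<one>\<^bsub>N\<^esub>, \<one>\<^bsub>T\<^esub>)" by (simp_all add: semidirect_product_def)
  interpret P: finite_group ?P
    using group_semidirect_product[OF gN gT \<phi>] fin
    by (simp add: finite_group_def finite_group_axioms_def P)
  have \<phi>o: "\<phi> t \<one>\<^bsub>N\<^esub> = \<one>\<^bsub>N\<^esub>" if "t \<in> carrier T" for t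
    using Group.hom_one[OF intenseD(2)[OF action_hom(1)[OF \<phi> that]] gN gN] .
  have \<phi>c: "\<phi> t n \<in> carrier N" if "t \<in> carrier T" "n \<in> carrier N" for t n
    using intenseD(4)[OF action_hom(1)[OF \<phi>]] that by simp
  let ?i = "\<lambda>n. (n, \<one>\<^bsub>T\<^esub>)" and ?j = "\<lambda>t. (\<one>\<^bsub>N\<^esub>, t)"
  have ih: "?i \<in> hom N ?P" by (rule homI) (auto simp: P IntGroup_simps)
  have jh: "?j \<in> hom T ?P" by (rule homI) (auto simp: P \<phi>o)
  interpret i: group_hom N ?P ?i using ih by unfold_locales
  interpret j: group_hom T ?P ?j using jh by unfold_locales
  have "snd \<in> hom ?P T" by (rule homI) (auto simp: P)
  then interpret s: group_hom ?P T snd by unfold_locales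
  let ?N = "?i ` carrier N" and ?T = "?j ` carrier T"
  have sN: "subgroup ?N ?P" by (rule i.img_is_subgroup)
  have sT: "subgroup ?T ?P" by (rule j.img_is_subgroup)
  have cN: "card ?N = card (carrier N)" by (rule card_image) (auto simp: inj_on_def)
  have cT: "card ?T = card (carrier T)" by (rule card_image) (auto simp: inj_on_def)
  have nP: "P.normalizes (carrier ?P) ?N"
  proof -
    have k: "kernel ?P T snd = ?N" by (auto simp: kernel_def P)
    have "?N \<lhd> ?P" using s.normal_kernel unfolding k .
    then show ?thesis by (auto simp: P.normalizes_def P.conj_by_def normal.inv_op_closed2)
  qed
  have "?i \<in> iso N (?P\<lparr>carrier := ?N\<rparr>)"
    using ih by (auto simp: iso_def hom_def bij_betw_def inj_on_def)
  then have nil1: "nilpotent_group (?P\<lparr>carrier := ?N\<rparr>)"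
    using nilpotent_group_iso[OF nN P.subgroup_imp_group[OF sN]] by (auto simp: is_iso_def)
  have "?j \<in> iso T (?P\<lparr>carrier := ?T\<rparr>)"
    using jh by (auto simp: iso_def hom_def bij_betw_def inj_on_def)
  then have nil2: "nilpotent_group (?P\<lparr>carrier := ?T\<rparr>)"
    using nilpotent_group_iso[OF nT P.subgroup_imp_group[OF sT]] by (auto simp: is_iso_def)
  have "P.evolving_in (carrier ?P)"
  proof (rule P.evolving_in_of_decomposition[OF sN nP sT _ _ nil1 nil2])
    show "card (carrier ?P) = card ?N * card ?T" by (simp add: P cN cT card_cartesian_product)
    show "coprime (card ?N) (card ?T)" using cop by (simp add: cN cT order_def)
    fix U t assume U: "subgroup U ?P" "U \<subseteq> ?N" and "t \<in> ?T"
    then obtain t' where t: "t' \<in> carrier T" "t = ?j t'" by auto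
    \<comment> \<open>Intensity speaks about subgroups of N, so U is pulled back along the embedding
      before it is applied.\<close>
    let ?U = "{n \<in> carrier N. ?i n \<in> U}"
    have UU: "U = ?i ` ?U" using U(2) by auto
    have "subgroup ?U N"
    proof
      show "?U \<subseteq> carrier N" by auto
      show "\<one>\<^bsub>N\<^esub> \<in> ?U" using subgroup.one_closed[OF U(1)] by simp
      fix x assume x: "x \<in> ?U"
      show "inv\<^bsub>N\<^esub> x \<in> ?U" using x subgroup.m_inv_closed[OF U(1), of "?i x"] i.hom_inv[of x] by auto
      fix y assume "y \<in> ?U"
      then show "x \<otimes>\<^bsub>N\<^esub> y \<in> ?U"
        using x subgroup.m_closed[OF U(1), of "?i x" "?i y"] i.hom_mult[of x y] by auto
    qed
    then obtain x where x: "x \<in> carrier N" "\<phi> t' ` ?U = (\<lambda>h. x \<otimes>\<^bsub>N\<^esub> h \<otimes>\<^bsub>N\<^esub> inv\<^bsub>N\<^esub> x) ` ?U"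
      using action_hom(1)[OF \<phi> t(1)] by (auto simp: intense_def l_r_coset_eq_image)
    have a: "P.conj_by t (?i n) = ?i (\<phi> t' n)" if n: "n \<in> carrier N" for n
    proof -
      have tc: "t \<in> carrier ?P" "?i n \<in> carrier ?P" "?i (\<phi> t' n) \<in> carrier ?P"
        using t n \<phi>c by (auto simp: P)
      have "t \<otimes>\<^bsub>?P\<^esub> ?i n = ?i (\<phi> t' n) \<otimes>\<^bsub>?P\<^esub> t" using t n \<phi>c by (simp add: P IntGroup_simps \<phi>o)
      then show ?thesis using tc by (simp add: P.conj_by_def P.m_assoc)
    qed
    have b: "P.conj_by (?i x) (?i n) = ?i (x \<otimes>\<^bsub>N\<^esub> n \<otimes>\<^bsub>N\<^esub> inv\<^bsub>N\<^esub> x)" if n: "n \<in> carrier N" for n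
      unfolding P.conj_by_def using n x(1) i.hom_mult i.hom_inv by (metis N.inv_closed N.m_closed)
    have "P.conj_by t ` U = ?i ` \<phi> t' ` ?U"
      by (subst UU, unfold image_image) (rule image_cong, use a in auto)
    also have "\<dots> = P.conj_by (?i x) ` ?i ` ?U"
      unfolding x(2) unfolding image_image by (rule image_cong) (use b in auto)
    finally have "P.conj_by t ` U = P.conj_by (?i x) ` U" using UU by simp
    then show "\<exists>x\<in>?N. P.conj_by t ` U = P.conj_by x ` U" using x(1) by blast
  qed
  then show ?thesis using P.evolving_iff_evolving_in by simp
qed

text \<open>Stated for a plain \<open>'a monoid\<close> so that the substructures of G on N and T
  again have the type that the witnesses must have.\<close>

lemma evolving_imp_intense_decomposition:
  fixes G :: "'a monoid"
  assumes "evolving G"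
  shows "\<exists>(N :: 'a monoid) (T :: 'a monoid) \<phi>. nilpotent_group N \<and> nilpotent_group T \<and>
    coprime (order N) (order T) \<and> \<phi> \<in> hom T (IntGroup N) \<and> G \<cong> semidirect_product N T \<phi>"
proof -
  interpret G: finite_group G
    using assms by (simp add: evolving_def finite_group_def finite_group_axioms_def)
  have "G.evolving_in (carrier G)" using assms G.evolving_iff_evolving_in by simp
  then obtain N T where d: "subgroup N G" "subgroup T G" "G.normalizes (carrier G) N"
    "card (carrier G) = card N * card T" "coprime (card N) (card T)"
    "nilpotent_group (G\<lparr>carrier := N\<rparr>)" "nilpotent_group (G\<lparr>carrier := T\<rparr>)"
    "\<And>U t. subgroup U G \<Longrightarrow> U \<subseteq> N \<Longrightarrow> t \<in> carrier G \<Longrightarrow> \<exists>x\<in>N. G.conj_by t ` U = G.conj_by x ` U"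
    using G.evolving_decomposition by metis
  show ?thesis
    using G.internal_semidirect_product[OF d(1,3,2,4,5,8)] d(5,6,7)
    by (intro exI[of _ "G\<lparr>carrier := N\<rparr>"] exI[of _ "G\<lparr>carrier := T\<rparr>"] exI conjI) (auto simp: order_def)
qed

theorem theorem4:
  fixes G :: "('a, 'm) monoid_scheme"
  assumes "group G" and "finite (carrier G)"
  shows "evolving G \<longleftrightarrow>
    (\<exists>(N :: 'a monoid) (T :: 'a monoid) \<phi>.
      nilpotent_group N \<and> nilpotent_group T \<and> coprime (order N) (order T) \<and>
      \<phi> \<in> hom T (IntGroup N) \<and> G \<cong> semidirect_product N T \<phi>)"
proof
  interpret G: group G by fact
  \<comment> \<open>A copy of G without its additional record fields, to which the version for plain
    monoids applies.\<close>
  let ?G = "\<lparr>carrier = carrier G, monoid.mult = monoid.mult G, one = \<one>\<^bsub>G\<^esub>\<rparr> :: 'a monoid"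
  have iso: "G \<cong> ?G"
    by (auto simp: is_iso_def iso_def hom_def bij_betw_def inj_on_def intro!: exI[of _ "\<lambda>x. x"])
  have g: "group ?G"
  proof (rule groupI)
    fix x assume "x \<in> carrier ?G"
    then show "\<exists>y\<in>carrier ?G. y \<otimes>\<^bsub>?G\<^esub> x = \<one>\<^bsub>?G\<^esub>" by (auto intro: bexI[of _ "inv\<^bsub>G\<^esub> x"])
  qed (auto simp: G.m_assoc)
  assume "evolving G"
  then have "evolving ?G" by (rule evolving_iso[OF assms(1) g iso])
  then show "\<exists>(N :: 'a monoid) (T :: 'a monoid) \<phi>.
      nilpotent_group N \<and> nilpotent_group T \<and> coprime (order N) (order T) \<and>
      \<phi> \<in> hom T (IntGroup N) \<and> G \<cong> semidirect_product N T \<phi>"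
    using evolving_imp_intense_decomposition[of ?G] iso_trans[OF iso] by blast
next
  assume "\<exists>(N :: 'a monoid) (T :: 'a monoid) \<phi>.
      nilpotent_group N \<and> nilpotent_group T \<and> coprime (order N) (order T) \<and>
      \<phi> \<in> hom T (IntGroup N) \<and> G \<cong> semidirect_product N T \<phi>"
  then obtain N T :: "'a monoid" and \<phi> where d: "nilpotent_group N" "nilpotent_group T"
    "coprime (order N) (order T)" "\<phi> \<in> hom T (IntGroup N)" "G \<cong> semidirect_product N T \<phi>" by blast
  let ?P = "semidirect_product N T \<phi>"
  have gN: "group N" and gT: "group T" using d by (auto simp: nilpotent_group_def)
  have gP: "group ?P" by (rule group_semidirect_product[OF gN gT d(4)])
  obtain f where "f \<in> iso G ?P" using d(5) by (auto simp: is_iso_def)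
  then have "f ` carrier G = carrier N \<times> carrier T"
    by (auto simp: iso_def bij_betw_def semidirect_product_def)
  then have "finite (carrier N \<times> carrier T)" using assms(2) by (metis finite_imageI)
  \<comment> \<open>A finite product has finite factors only when neither factor is empty.\<close>
  moreover have "carrier N \<noteq> {}" "carrier T \<noteq> {}"
    using group.is_monoid[OF gN] group.is_monoid[OF gT] monoid.one_closed by blast+
  ultimately have "finite (carrier N)" "finite (carrier T)"
    by (auto simp: finite_cartesian_product_iff)
  then have "evolving ?P" by (rule evolving_semidirect_product[OF d(1-4)])
  then show "evolving G" by (rule evolving_iso[OF gP assms(1) group.iso_sym[OF assms(1) d(5)]])
qed

end
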